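(* Let $N$ be a tracial von Neumann algebra (a von Neumann algebra equipped with a faithful normal tracial state $\tau$) that has a direct summand of type $\mathrm{II}_1$. Then the theory of $N$, in the continuous-logic language of tracial von Neumann algebras, does not admit elimination of quantifiers.
   Context: Formulas are formulas of continuous first-order logic in the language of tracial von Neumann algebras; all free variables are taken to range over the operator unit ball. For an $n$-tuple of variables $\bar x$, let $\mathfrak F^{\bar x}$ be the $\mathbb R$-algebra of formulas with free variables among $\bar x$ and $\mathfrak F^{\bar x}_{\mathrm{qf}}$ the subalgebra of quantifier-free formulas. For a fixed tracial von Neumann algebra $N$ and a nonprincipal ultrafilter $\mathcal U$ on $\mathbb N$, define the seminorm $\|\varphi(\bar x)\|_N=\sup \varphi^{N^{\mathcal U}}(\bar a)$, where $\bar a$ ranges over $n$-tuples in the unit ball of the tracial ultrapower $N^{\mathcal U}$ and $\varphi^{N^{\mathcal U}}(\bar a)$ is the evaluation of $\varphi$ at $\bar a$. The theory of $N$ admits elimination of quantifiers if, for every tuple of variables $\bar x$, $\mathfrak F^{\bar x}_{\mathrm{qf}}$ is $\|\cdot\|_N$-dense in $\mathfrak F^{\bar x}$. *)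

theory Defs
  imports "HOL-Analysis.Analysis"
begin

section \<open>Complex Hilbert spaces and bounded operators\<close>

text \<open>
  The complex structure is added on top of the real Hilbert space structure of the library, so that
  norm, completeness and the operator norm of bounded linear maps are the library's. Positive
  definiteness of \<open>cinner\<close> follows from that of \<open>inner\<close>. The form is linear in the first argument.
\<close>

class complex_hilbert_space = real_inner + complete_space +
  fixes scaleC :: "complex \<Rightarrow> 'a \<Rightarrow> 'a" (infixr "*\<^sub>C" 75)
    and cinner :: "'a \<Rightarrow> 'a \<Rightarrow> complex"
  assumes scaleC_of_real: "complex_of_real r *\<^sub>C x = r *\<^sub>R x"
    and scaleC_add_left: "(c + d) *\<^sub>C x = c *\<^sub>C x + d *\<^sub>C x"
    and scaleC_add_right: "c *\<^sub>C (x + y) = c *\<^sub>C x + c *\<^sub>C y"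
    and scaleC_scaleC: "c *\<^sub>C d *\<^sub>C x = (c * d) *\<^sub>C x"
    and cinner_commute: "cinner x y = cnj (cinner y x)"
    and cinner_add_left: "cinner (x + y) z = cinner x z + cinner y z"
    and cinner_scaleC_left: "cinner (c *\<^sub>C x) y = c * cinner x y"
    and inner_eq_Re_cinner: "inner x y = Re (cinner x y)"

type_synonym 'h op = "'h \<Rightarrow>\<^sub>L 'h"

definition bounded_operators :: "'h::complex_hilbert_space op set" where
  "bounded_operators = {T. \<forall>c x. blinfun_apply T (c *\<^sub>C x) = c *\<^sub>C blinfun_apply T x}"

definition op_scale :: "complex \<Rightarrow> 'h::complex_hilbert_space op \<Rightarrow> 'h op" where
  "op_scale c T = Blinfun (\<lambda>x. c *\<^sub>C blinfun_apply T x)"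

definition op_adjoint :: "'h::complex_hilbert_space op \<Rightarrow> 'h op" where
  "op_adjoint T = (THE S. S \<in> bounded_operators \<and>
     (\<forall>x y. cinner (blinfun_apply T x) y = cinner x (blinfun_apply S y)))"

definition op_positive :: "'h::complex_hilbert_space op \<Rightarrow> bool" where
  "op_positive T \<longleftrightarrow> (\<forall>x. cinner (blinfun_apply T x) x \<in> \<real> \<and>
     0 \<le> Re (cinner (blinfun_apply T x) x))"

definition op_le :: "'h::complex_hilbert_space op \<Rightarrow> 'h op \<Rightarrow> bool" where
  "op_le S T \<longleftrightarrow> op_positive (T - S)"


section \<open>Tracial von Neumann algebras\<close>

definition commutant :: "'h::complex_hilbert_space op set \<Rightarrow> 'h op set" where
  "commutant A = {T \<in> bounded_operators. \<forall>S\<in>A. T o\<^sub>L S = S o\<^sub>L T}"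

text \<open>
  A commutant is always a unital subalgebra, so the last condition below also makes \<open>M\<close> a unital
  subalgebra of the bounded operators.
\<close>

definition von_neumann_algebra :: "'h::complex_hilbert_space op set \<Rightarrow> bool" where
  "von_neumann_algebra M \<longleftrightarrow>
     M \<subseteq> bounded_operators \<and> (\<forall>T\<in>M. op_adjoint T \<in> M) \<and> commutant (commutant M) = M"

definition self_adjoint_part :: "'h::complex_hilbert_space op set \<Rightarrow> 'h op set" where
  "self_adjoint_part M = {T \<in> M. op_adjoint T = T}"

definition tracial_state :: "'h::complex_hilbert_space op set \<Rightarrow> ('h op \<Rightarrow> complex) \<Rightarrow> bool" where
  "tracial_state M \<tau> \<longleftrightarrow>
     (\<forall>S\<in>M. \<forall>T\<in>M. \<tau> (S + T) = \<tau> S + \<tau> T) \<and>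
     (\<forall>c. \<forall>T\<in>M. \<tau> (op_scale c T) = c * \<tau> T) \<and>
     (\<forall>T\<in>M. \<tau> (op_adjoint T o\<^sub>L T) \<in> \<real> \<and> 0 \<le> Re (\<tau> (op_adjoint T o\<^sub>L T))) \<and>
     \<tau> id_blinfun = 1 \<and>
     (\<forall>S\<in>M. \<forall>T\<in>M. \<tau> (S o\<^sub>L T) = \<tau> (T o\<^sub>L S))"

definition faithful_on :: "'h::complex_hilbert_space op set \<Rightarrow> ('h op \<Rightarrow> complex) \<Rightarrow> bool" where
  "faithful_on M \<tau> \<longleftrightarrow> (\<forall>T\<in>M. \<tau> (op_adjoint T o\<^sub>L T) = 0 \<longrightarrow> T = 0)"

text \<open>
  Normality: preservation of suprema of bounded, upward directed sets of self-adjoint elements.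
  The values of a state on self-adjoint elements are real, hence the real parts.
\<close>

definition normal_on :: "'h::complex_hilbert_space op set \<Rightarrow> ('h op \<Rightarrow> complex) \<Rightarrow> bool" where
  "normal_on M \<tau> \<longleftrightarrow>
     (\<forall>D T. D \<noteq> {} \<longrightarrow> D \<subseteq> self_adjoint_part M \<longrightarrow>
        (\<forall>A\<in>D. \<forall>B\<in>D. \<exists>C\<in>D. op_le A C \<and> op_le B C) \<longrightarrow>
        T \<in> self_adjoint_part M \<longrightarrow> (\<forall>A\<in>D. op_le A T) \<longrightarrow>
        (\<forall>S\<in>self_adjoint_part M. (\<forall>A\<in>D. op_le A S) \<longrightarrow> op_le T S) \<longrightarrow>
        Re (\<tau> T) = (SUP A\<in>D. Re (\<tau> A)))"

definition tracial_von_neumann_algebra ::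
    "'h::complex_hilbert_space op set \<Rightarrow> ('h op \<Rightarrow> complex) \<Rightarrow> bool" where
  "tracial_von_neumann_algebra M \<tau> \<longleftrightarrow>
     von_neumann_algebra M \<and> tracial_state M \<tau> \<and> faithful_on M \<tau> \<and> normal_on M \<tau>"


section \<open>Type \<open>II\<^sub>1\<close> direct summands\<close>

text \<open>
  The notions below are used for a direct summand \<open>z M\<close> of a von Neumann algebra \<open>M\<close>. It is kept as
  an algebra of operators on the same Hilbert space, with unit the central projection \<open>z\<close>.
\<close>

definition projections :: "'h::complex_hilbert_space op set \<Rightarrow> 'h op set" where
  "projections M = {p \<in> M. op_adjoint p = p \<and> p o\<^sub>L p = p}"

definition central_projections :: "'h::complex_hilbert_space op set \<Rightarrow> 'h op set" where
  "central_projections M = {p \<in> projections M. \<forall>T\<in>M. p o\<^sub>L T = T o\<^sub>L p}"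

definition abelian_projection :: "'h::complex_hilbert_space op set \<Rightarrow> 'h op \<Rightarrow> bool" where
  "abelian_projection M p \<longleftrightarrow> p \<in> projections M \<and>
     (\<forall>S\<in>M. \<forall>T\<in>M. (p o\<^sub>L S o\<^sub>L p) o\<^sub>L (p o\<^sub>L T o\<^sub>L p) = (p o\<^sub>L T o\<^sub>L p) o\<^sub>L (p o\<^sub>L S o\<^sub>L p))"

definition finite_projection :: "'h::complex_hilbert_space op set \<Rightarrow> 'h op \<Rightarrow> bool" where
  "finite_projection M p \<longleftrightarrow> p \<in> projections M \<and>
     (\<forall>v\<in>M. op_adjoint v o\<^sub>L v = p \<longrightarrow> op_le (v o\<^sub>L op_adjoint v) p \<longrightarrow> v o\<^sub>L op_adjoint v = p)"

definition type_II :: "'h::complex_hilbert_space op set \<Rightarrow> bool" where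
  "type_II M \<longleftrightarrow>
     (\<forall>p. abelian_projection M p \<longrightarrow> p = 0) \<and>
     (\<forall>z\<in>central_projections M. z \<noteq> 0 \<longrightarrow> (\<exists>p. finite_projection M p \<and> p \<noteq> 0 \<and> op_le p z))"

definition type_II1 :: "'h::complex_hilbert_space op set \<Rightarrow> 'h op \<Rightarrow> bool" where
  "type_II1 M e \<longleftrightarrow> type_II M \<and> finite_projection M e"

definition has_type_II1_summand :: "'h::complex_hilbert_space op set \<Rightarrow> bool" where
  "has_type_II1_summand M \<longleftrightarrow>
     (\<exists>z\<in>central_projections M. z \<noteq> 0 \<and> type_II1 ((\<lambda>T. z o\<^sub>L T) ` M) z)"


section \<open>Structures for the language of tracial von Neumann algebras\<close>

record 'a tracial_structure =
  ts_carrier :: "'a set"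
  ts_zero :: 'a
  ts_one :: 'a
  ts_add :: "'a \<Rightarrow> 'a \<Rightarrow> 'a"
  ts_mult :: "'a \<Rightarrow> 'a \<Rightarrow> 'a"
  ts_scale :: "complex \<Rightarrow> 'a \<Rightarrow> 'a"
  ts_star :: "'a \<Rightarrow> 'a"
  ts_trace :: "'a \<Rightarrow> complex"
  ts_norm :: "'a \<Rightarrow> real"

definition ts_ball :: "'a tracial_structure \<Rightarrow> real \<Rightarrow> 'a set" where
  "ts_ball S r = {x \<in> ts_carrier S. ts_norm S x \<le> r}"

definition ts_norm2 :: "'a tracial_structure \<Rightarrow> 'a \<Rightarrow> real" where
  "ts_norm2 S x = sqrt (Re (ts_trace S (ts_mult S (ts_star S x) x)))"

definition ts_dist :: "'a tracial_structure \<Rightarrow> 'a \<Rightarrow> 'a \<Rightarrow> real" where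
  "ts_dist S x y = ts_norm2 S (ts_add S x (ts_scale S (- 1) y))"

definition vn_structure ::
    "'h::complex_hilbert_space op set \<Rightarrow> ('h op \<Rightarrow> complex) \<Rightarrow> 'h op tracial_structure" where
  "vn_structure M \<tau> = \<lparr>
     ts_carrier = M,
     ts_zero = 0,
     ts_one = id_blinfun,
     ts_add = (+),
     ts_mult = (o\<^sub>L),
     ts_scale = op_scale,
     ts_star = op_adjoint,
     ts_trace = \<tau>,
     ts_norm = norm \<rparr>"


section \<open>Tracial ultrapowers\<close>

definition nonprincipal_ultrafilter :: "nat filter \<Rightarrow> bool" where
  "nonprincipal_ultrafilter U \<longleftrightarrow>
     U \<noteq> bot \<and> (\<forall>P. eventually P U \<or> eventually (\<lambda>n. \<not> P n) U) \<and> (\<forall>k. U \<noteq> principal {k})"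

definition bounded_sequences :: "'a tracial_structure \<Rightarrow> (nat \<Rightarrow> 'a) set" where
  "bounded_sequences S = {a. (\<forall>n. a n \<in> ts_carrier S) \<and> bdd_above (range (\<lambda>n. ts_norm S (a n)))}"

definition ultra_rel :: "nat filter \<Rightarrow> 'a tracial_structure \<Rightarrow> ((nat \<Rightarrow> 'a) \<times> (nat \<Rightarrow> 'a)) set" where
  "ultra_rel U S = {(a, b). a \<in> bounded_sequences S \<and> b \<in> bounded_sequences S \<and>
     ((\<lambda>n. ts_dist S (a n) (b n)) \<longlongrightarrow> 0) U}"

definition ultra_class :: "nat filter \<Rightarrow> 'a tracial_structure \<Rightarrow> (nat \<Rightarrow> 'a) \<Rightarrow> (nat \<Rightarrow> 'a) set" where
  "ultra_class U S a = ultra_rel U S `` {a}"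

definition ultra_rep :: "(nat \<Rightarrow> 'a) set \<Rightarrow> nat \<Rightarrow> 'a" where
  "ultra_rep X = (SOME a. a \<in> X)"

text \<open>
  The quotient of the bounded sequences by the sequences that are null in 2-norm along \<open>U\<close>, with the
  coordinatewise operations, the limit trace and the quotient norm.
\<close>

definition tracial_ultrapower ::
    "nat filter \<Rightarrow> 'a tracial_structure \<Rightarrow> (nat \<Rightarrow> 'a) set tracial_structure" where
  "tracial_ultrapower U S = \<lparr>
     ts_carrier = bounded_sequences S // ultra_rel U S,
     ts_zero = ultra_class U S (\<lambda>n. ts_zero S),
     ts_one = ultra_class U S (\<lambda>n. ts_one S),
     ts_add = (\<lambda>X Y. ultra_class U S (\<lambda>n. ts_add S (ultra_rep X n) (ultra_rep Y n))),
     ts_mult = (\<lambda>X Y. ultra_class U S (\<lambda>n. ts_mult S (ultra_rep X n) (ultra_rep Y n))),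
     ts_scale = (\<lambda>c X. ultra_class U S (\<lambda>n. ts_scale S c (ultra_rep X n))),
     ts_star = (\<lambda>X. ultra_class U S (\<lambda>n. ts_star S (ultra_rep X n))),
     ts_trace = (\<lambda>X. Lim U (\<lambda>n. ts_trace S (ultra_rep X n))),
     ts_norm = (\<lambda>X. INF a\<in>X. SUP n. ts_norm S (a n)) \<rparr>"


section \<open>Formulas of continuous logic\<close>

datatype tvn_term =
    TVar nat
  | TZero
  | TOne
  | TAdd tvn_term tvn_term
  | TMult tvn_term tvn_term
  | TScale complex tvn_term
  | TStar tvn_term

text \<open>
  The quantifiers \<open>FSup x k\<close> and \<open>FInf x k\<close> bind the variable \<open>x\<close>, which ranges over the operator
  norm ball of radius \<open>k\<close>.
\<close>

datatype tvn_formula =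
    TraceRe tvn_term
  | TraceIm tvn_term
  | Distance tvn_term tvn_term
  | Connective "real list \<Rightarrow> real" "tvn_formula list"
  | FSup nat nat tvn_formula
  | FInf nat nat tvn_formula

fun term_vars :: "tvn_term \<Rightarrow> nat set" where
  "term_vars (TVar x) = {x}"
| "term_vars TZero = {}"
| "term_vars TOne = {}"
| "term_vars (TAdd s t) = term_vars s \<union> term_vars t"
| "term_vars (TMult s t) = term_vars s \<union> term_vars t"
| "term_vars (TScale c t) = term_vars t"
| "term_vars (TStar t) = term_vars t"

fun free_vars :: "tvn_formula \<Rightarrow> nat set" where
  "free_vars (TraceRe t) = term_vars t"
| "free_vars (TraceIm t) = term_vars t"
| "free_vars (Distance s t) = term_vars s \<union> term_vars t"
| "free_vars (Connective f \<phi>s) = (\<Union>\<phi>\<in>set \<phi>s. free_vars \<phi>)"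
| "free_vars (FSup x k \<phi>) = free_vars \<phi> - {x}"
| "free_vars (FInf x k \<phi>) = free_vars \<phi> - {x}"

text \<open>
  Continuity of the \<open>m\<close>-ary connective \<open>f\<close>, a function on lists of length \<open>m\<close>, is expressed through
  the product topology on \<open>nat \<Rightarrow> real\<close>: a function of the first \<open>m\<close> coordinates is continuous there
  if and only if it is continuous on \<open>m\<close>-dimensional Euclidean space.
\<close>

definition continuous_connective :: "nat \<Rightarrow> (real list \<Rightarrow> real) \<Rightarrow> bool" where
  "continuous_connective m f \<longleftrightarrow> continuous_on UNIV (\<lambda>v :: nat \<Rightarrow> real. f (map v [0..<m]))"

fun well_formed :: "tvn_formula \<Rightarrow> bool" where
  "well_formed (TraceRe t) = True"
| "well_formed (TraceIm t) = True"
| "well_formed (Distance s t) = True"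
| "well_formed (Connective f \<phi>s) =
     (continuous_connective (length \<phi>s) f \<and> (\<forall>\<phi>\<in>set \<phi>s. well_formed \<phi>))"
| "well_formed (FSup x k \<phi>) = (0 < k \<and> well_formed \<phi>)"
| "well_formed (FInf x k \<phi>) = (0 < k \<and> well_formed \<phi>)"

fun quantifier_free :: "tvn_formula \<Rightarrow> bool" where
  "quantifier_free (TraceRe t) = True"
| "quantifier_free (TraceIm t) = True"
| "quantifier_free (Distance s t) = True"
| "quantifier_free (Connective f \<phi>s) = (\<forall>\<phi>\<in>set \<phi>s. quantifier_free \<phi>)"
| "quantifier_free (FSup x k \<phi>) = False"
| "quantifier_free (FInf x k \<phi>) = False"

definition formulas :: "nat set \<Rightarrow> tvn_formula set" where
  "formulas X = {\<phi>. well_formed \<phi> \<and> free_vars \<phi> \<subseteq> X}"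

definition qf_formulas :: "nat set \<Rightarrow> tvn_formula set" where
  "qf_formulas X = {\<phi> \<in> formulas X. quantifier_free \<phi>}"

fun term_eval :: "'a tracial_structure \<Rightarrow> tvn_term \<Rightarrow> (nat \<Rightarrow> 'a) \<Rightarrow> 'a" where
  "term_eval S (TVar x) v = v x"
| "term_eval S TZero v = ts_zero S"
| "term_eval S TOne v = ts_one S"
| "term_eval S (TAdd s t) v = ts_add S (term_eval S s v) (term_eval S t v)"
| "term_eval S (TMult s t) v = ts_mult S (term_eval S s v) (term_eval S t v)"
| "term_eval S (TScale c t) v = ts_scale S c (term_eval S t v)"
| "term_eval S (TStar t) v = ts_star S (term_eval S t v)"

fun formula_eval :: "'a tracial_structure \<Rightarrow> tvn_formula \<Rightarrow> (nat \<Rightarrow> 'a) \<Rightarrow> real" where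
  "formula_eval S (TraceRe t) v = Re (ts_trace S (term_eval S t v))"
| "formula_eval S (TraceIm t) v = Im (ts_trace S (term_eval S t v))"
| "formula_eval S (Distance s t) v = ts_dist S (term_eval S s v) (term_eval S t v)"
| "formula_eval S (Connective f \<phi>s) v = f (map (\<lambda>\<phi>. formula_eval S \<phi> v) \<phi>s)"
| "formula_eval S (FSup x k \<phi>) v = (SUP b\<in>ts_ball S (real k). formula_eval S \<phi> (v(x := b)))"
| "formula_eval S (FInf x k \<phi>) v = (INF b\<in>ts_ball S (real k). formula_eval S \<phi> (v(x := b)))"

definition formula_diff :: "tvn_formula \<Rightarrow> tvn_formula \<Rightarrow> tvn_formula" where
  "formula_diff \<phi> \<psi> = Connective (\<lambda>rs. rs ! 0 - rs ! 1) [\<phi>, \<psi>]"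


section \<open>Elimination of quantifiers\<close>

text \<open>
  A tuple of variables is represented by the finite set \<open>X\<close> of its entries. Only the values of the
  assignment \<open>a\<close> on \<open>X\<close> matter for a formula with free variables in \<open>X\<close>.
\<close>

definition formula_seminorm ::
    "nat filter \<Rightarrow> 'a tracial_structure \<Rightarrow> nat set \<Rightarrow> tvn_formula \<Rightarrow> real" where
  "formula_seminorm U S X \<phi> =
     (SUP a\<in>(X \<rightarrow> ts_ball (tracial_ultrapower U S) 1).
        \<bar>formula_eval (tracial_ultrapower U S) \<phi> a\<bar>)"

definition admits_quantifier_elimination :: "nat filter \<Rightarrow> 'a tracial_structure \<Rightarrow> bool" where
  "admits_quantifier_elimination U S \<longleftrightarrow>
     (\<forall>X. finite X \<longrightarrow> (\<forall>\<phi>\<in>formulas X. \<forall>\<epsilon>>0. \<exists>\<psi>\<in>qf_formulas X.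
        formula_seminorm U S X (formula_diff \<phi> \<psi>) < \<epsilon>))"

end

theory Submission
  imports Defs
begin

text \<open>
  Quantifier-free formulas only see \<open>*\<close>-moments, so it suffices to find tuples with the same limiting moments that
  a formula with one quantifier tells apart. Let \<open>\<pi>\<^sub>i\<close> be the representation of
  \<open>\<int>\<^sup>2 \<rtimes> SL\<^sub>2(\<int>)\<close> on the functions on the primitive vectors of \<open>(\<int>/2\<^sup>i)\<^sup>2\<close>, where \<open>\<int>\<^sup>2\<close>
  acts by characters and the elementary matrices by permutations. For \<open>i \<noteq> j\<close> the
  characters of \<open>\<int>\<^sup>2\<close> in \<open>\<pi>\<^sub>i\<close> and \<open>\<pi>\<^sub>j\<close> are disjoint, and relative property (T) yields a spectral gap for
  intertwiners that does not depend on \<open>i\<close> and \<open>j\<close>. The type \<open>II\<^sub>1\<close> summand contains orthogonal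
  equivalent projections \<open>e\<close> and \<open>vv\<^sup>*\<close>, with matrix units of all sizes \<open>2\<^sup>k\<close> under \<open>e\<close>. Put the generators
  of \<open>\<pi>\<^sub>i\<close> under \<open>e\<close> and those of \<open>\<pi>\<^sub>j\<close> under \<open>vv\<^sup>*\<close>. The formula asking for an intertwiner of norm at most one
  between the halves has value at least a positive constant for \<open>i = j\<close> and value \<open>0\<close> for \<open>i \<noteq> j\<close>, whereas
  a quantifier-free formula converges along the ultrafilter in \<open>i\<close> and \<open>j\<close> jointly, and hence takes
  nearby values at some \<open>(i, i)\<close> and \<open>(i, j)\<close> with \<open>i \<noteq> j\<close>.
\<close>

section \<open>Adjoints of bounded operators\<close>

\<comment> \<open>One formula must serve all pairs (\<open>i\<close>, \<open>j\<close>), so the mere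
  absence of intertwiners between different levels is not enough: it yields a gap whose constant may
  degenerate as the matrices grow. This is why a uniform gap is needed; its constant 5 reappears
  inside the formula. On the other side, the moments must depend on \<open>i\<close> and
  \<open>j\<close> without interaction. Orthogonality of the two halves makes every trace of a term
  a function of \<open>i\<close> plus a function of \<open>j\<close>, so limits along
  \<open>U\<close> in each variable give a limit along the product filter. That filter need not
  concentrate on the diagonal or off it, but each of its members contains a rectangle P x Q with P
  and Q in \<open>U\<close>, and such a rectangle meets both the diagonal and its complement. Powers
  of two come from the matrix units, which are produced by repeated halving. At least half of the
  4^i vectors modulo 2^i are primitive, so the representation of level \<open>i\<close> fills a part
  of \<open>e\<close> whose trace is bounded below independently of \<open>i\<close>; this keeps the
  diagonal values of the formula away from 0.\<close>
subclass (in complex_hilbert_space) banach ..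

text \<open>Minimise |x|^2 - 2 f(x). It is bounded below, the parallelogram law makes a minimising
  sequence Cauchy, and the vanishing first variation at the minimiser is the representation.\<close>

lemma riesz_representation_exists:
  fixes f :: "'a::{real_inner,complete_space} \<Rightarrow> real"
  assumes f: "bounded_linear f"
  shows "\<exists>y. \<forall>x. f x = inner x y"
proof -
  interpret bounded_linear f by (rule f)
  define J where "J x = (norm x)\<^sup>2 - 2 * f x" for x
  obtain K where K: "\<And>x. norm (f x) \<le> norm x * K" using bounded by blast
  have "- K\<^sup>2 \<le> J x" for x
  proof -
    have "f x \<le> norm x * K" using K[of x] by simp
    moreover have "0 \<le> (norm x - K)\<^sup>2" by simp
    ultimately show ?thesis by (simp add: J_def power2_eq_square algebra_simps)
  qed
  hence bdd: "bdd_below (range J)" by (intro bdd_belowI[of _ "- K\<^sup>2"]) auto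
  define m where "m = Inf (range J)"
  have mle: "m \<le> J x" for x unfolding m_def by (rule cInf_lower[OF _ bdd]) auto
  have "\<exists>x. J x < m + 1 / real (Suc n)" for n
  proof -
    have "Inf (range J) < m + 1 / real (Suc n)" by (simp add: m_def)
    from cInf_lessD[OF _ this] show ?thesis by auto
  qed
  then obtain x where x: "\<And>n. J (x n) < m + 1 / real (Suc n)" by metis
  have par: "(norm (a - b))\<^sup>2 \<le> 2 * J a + 2 * J b - 4 * m" for a b
  proof -
    have "J ((1/2) *\<^sub>R (a + b)) \<ge> m" by (rule mle)
    moreover have "(norm (a - b))\<^sup>2 = 2 * J a + 2 * J b - 4 * J ((1/2) *\<^sub>R (a + b))"
      unfolding J_def power2_norm_eq_inner
      by (simp add: inner_simps scaleR add inner_commute field_simps)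
    ultimately show ?thesis by linarith
  qed
  have "Cauchy x"
  proof (rule metric_CauchyI)
    fix e :: real assume e: "e > 0"
    obtain M where M: "1 / real (Suc M) < e\<^sup>2 / 4" using nat_approx_posE[of "e\<^sup>2/4"] e by (metis divide_pos_pos zero_less_numeral zero_less_power)
    have "dist (x a) (x b) < e" if ab: "a \<ge> M" "b \<ge> M" for a b
    proof -
      have "1 / real (Suc a) \<le> 1 / real (Suc M)" "1 / real (Suc b) \<le> 1 / real (Suc M)"
        using ab by (auto intro!: divide_left_mono)
      hence "(norm (x a - x b))\<^sup>2 < e\<^sup>2" using par[of "x a" "x b"] x[of a] x[of b] M by linarith
      thus ?thesis using e by (simp add: dist_norm power2_less_imp_less)
    qed
    thus "\<exists>M. \<forall>m\<ge>M. \<forall>n\<ge>M. dist (x m) (x n) < e" by blast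
  qed
  then obtain y where y: "x \<longlonglongrightarrow> y" using Cauchy_convergent convergent_def by blast
  have "(\<lambda>n. J (x n)) \<longlonglongrightarrow> J y" unfolding J_def by (intro tendsto_intros y tendsto)
  moreover have "(\<lambda>n. m + 1 / real (Suc n)) \<longlonglongrightarrow> m"
    using tendsto_add[OF tendsto_const LIMSEQ_inverse_real_of_nat, of m] by (simp add: inverse_eq_divide)
  ultimately have "J y \<le> m" by (rule LIMSEQ_le) (use x less_imp_le in blast)
  have "f h = inner h y" for h
  proof -
    have q: "0 \<le> 2 * t * (inner y h - f h) + t\<^sup>2 * (norm h)\<^sup>2" for t
    proof -
      have "J y \<le> J (y + t *\<^sub>R h)" using \<open>J y \<le> m\<close> mle order_trans by blast
      thus ?thesis unfolding J_def power2_norm_eq_inner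
        by (simp add: inner_simps scaleR add inner_commute power2_eq_square algebra_simps)
    qed
    define d where "d = inner y h - f h"
    \<comment> \<open>The optimal \<open>t\<close> is -d / |h|^2; the added 1 avoids a separate case
      \<open>h = 0\<close> and still gives a negative value unless d = 0.\<close>
    define n where "n = (norm h)\<^sup>2 + 1"
    have n: "n > 0" "(norm h)\<^sup>2 \<le> n" by (auto simp: n_def add_nonneg_pos)
    have "0 \<le> 2 * (- d / n) * d + (- d / n)\<^sup>2 * (norm h)\<^sup>2" using q[of "- d / n"] unfolding d_def .
    also have "\<dots> \<le> 2 * (- d / n) * d + (- d / n)\<^sup>2 * n" using n by (intro add_left_mono mult_left_mono) auto
    also have "\<dots> = - d\<^sup>2 / n" using n by (simp add: power2_eq_square field_simps)
    finally have "d\<^sup>2 / n \<le> 0" by simp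
    hence "d = 0" using n by (simp add: divide_le_0_iff)
    thus ?thesis by (simp add: d_def inner_commute)
  qed
  thus ?thesis by blast
qed

lemma scaleC_one [simp]: "1 *\<^sub>C (x::'h::complex_hilbert_space) = x"
  using scaleC_of_real[of 1 x] by simp

lemma scaleC_right_simps [simp]:
  "c *\<^sub>C (0::'h::complex_hilbert_space) = 0"
  "c *\<^sub>C (r *\<^sub>R (x::'h)) = r *\<^sub>R (c *\<^sub>C x)"
  "c *\<^sub>C (- x) = - (c *\<^sub>C x)"
  "c *\<^sub>C (x - y) = c *\<^sub>C x - c *\<^sub>C y"
proof -
  show r: "c *\<^sub>C (r *\<^sub>R x) = r *\<^sub>R (c *\<^sub>C x)" for r and x :: 'h
    by (metis scaleC_of_real scaleC_scaleC mult.commute)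
  show "c *\<^sub>C (0::'h) = 0" using r[of 0 0] by simp
  show m: "c *\<^sub>C (- x) = - (c *\<^sub>C x)" for x :: 'h using r[of "-1" x] by simp
  show "c *\<^sub>C (x - y) = c *\<^sub>C x - c *\<^sub>C y" using scaleC_add_right[of c x "- y"] by (simp add: m)
qed

lemma inner_scaleC_left: "inner (c *\<^sub>C x) y = inner (x::'h::complex_hilbert_space) (cnj c *\<^sub>C y)"
proof -
  have "cinner x (cnj c *\<^sub>C y) = cnj (cinner (cnj c *\<^sub>C y) x)" by (rule cinner_commute)
  also have "\<dots> = c * cnj (cinner y x)" by (simp add: cinner_scaleC_left)
  also have "\<dots> = cinner (c *\<^sub>C x) y" by (simp add: cinner_scaleC_left cinner_commute[of x y])
  finally show ?thesis by (simp add: inner_eq_Re_cinner)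
qed

lemma norm_scaleC: "norm (c *\<^sub>C (x::'h::complex_hilbert_space)) = cmod c * norm x"
proof -
  have "inner (c *\<^sub>C x) (c *\<^sub>C x) = inner x ((cnj c * c) *\<^sub>C x)" by (simp add: inner_scaleC_left scaleC_scaleC)
  also have "cnj c * c = complex_of_real ((cmod c)\<^sup>2)" by (simp add: complex_norm_square mult.commute del: of_real_power)
  finally have "(norm (c *\<^sub>C x))\<^sup>2 = (cmod c * norm x)\<^sup>2"
    by (simp add: power2_norm_eq_inner power_mult_distrib scaleC_of_real del: of_real_power)
  thus ?thesis by (simp add: power2_eq_iff_nonneg)
qed

text \<open>Im z = Re (- i z), so the complex form is determined by its real part. With complex
  linearity this lets computations with adjoints use the real \<open>inner\<close> alone.\<close>

lemma cinner_eq_Complex: "cinner x y = Complex (inner x y) (inner ((- \<i>) *\<^sub>C x) (y::'h::complex_hilbert_space))"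
  by (rule complex_eqI) (simp_all add: inner_eq_Re_cinner cinner_scaleC_left)

lemma cinner_eqI_inner:
  assumes "\<And>x y. inner (f x) y = inner x (g y)" and "\<And>c x. f (c *\<^sub>C x) = c *\<^sub>C f x"
  shows "cinner (f x) y = cinner (x::'h::complex_hilbert_space) (g y)"
  unfolding cinner_eq_Complex using assms by (metis assms)

lemma bounded_operatorsD: "T \<in> bounded_operators \<Longrightarrow> T (c *\<^sub>C x) = c *\<^sub>C T x"
  by (simp add: bounded_operators_def)

lemma adjoint_exists:
  assumes T: "(T::'h::complex_hilbert_space op) \<in> bounded_operators"
  shows "\<exists>S\<in>bounded_operators. \<forall>x y. inner (T x) y = inner x (S y)"
proof -
  have "bounded_linear (\<lambda>x. inner (T x) y)" for y
    by (intro bounded_linear_inner_left[THEN bounded_linear_compose] blinfun.bounded_linear_right)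
  then have "\<forall>y. \<exists>z. \<forall>x. inner (T x) y = inner x z" using riesz_representation_exists by blast
  then obtain S where S: "\<And>x y. inner (T x) y = inner x (S y)" by metis
  have "bounded_linear S"
  proof (rule bounded_linear_intro[of _ "norm T"])
    show "S (a + b) = S a + S b" for a b
      by (rule vector_eq_rdot[THEN iffD1]) (metis S inner_add_right inner_commute)
    show "S (r *\<^sub>R a) = r *\<^sub>R S a" for r a
      by (rule vector_eq_rdot[THEN iffD1]) (metis S inner_scaleR_right inner_commute)
    show "norm (S y) \<le> norm y * norm T" for y
    proof -
      have "(norm (S y))\<^sup>2 = inner (T (S y)) y" by (simp add: S power2_norm_eq_inner)
      also have "\<dots> \<le> norm (T (S y)) * norm y" by (rule norm_cauchy_schwarz)
      also have "\<dots> \<le> norm T * norm (S y) * norm y" by (intro mult_right_mono norm_blinfun) auto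
      finally have "norm (S y) * norm (S y) \<le> norm (S y) * (norm y * norm T)" by (simp add: power2_eq_square ac_simps)
      thus ?thesis by (cases "norm (S y) = 0") (auto simp: mult_le_cancel_left)
    qed
  qed
  hence ap: "blinfun_apply (Blinfun S) = S" by (rule bounded_linear_Blinfun_apply)
  have "S (c *\<^sub>C y) = c *\<^sub>C S y" for c y
  proof (rule vector_eq_rdot[THEN iffD1], rule allI)
    fix z
    have "inner z (S (c *\<^sub>C y)) = inner (T z) (c *\<^sub>C y)" by (simp add: S)
    also have "\<dots> = inner (cnj c *\<^sub>C T z) y" by (simp add: inner_scaleC_left)
    also have "\<dots> = inner (cnj c *\<^sub>C z) (S y)" by (simp add: bounded_operatorsD[OF T, symmetric] S)
    also have "\<dots> = inner z (c *\<^sub>C S y)" by (simp add: inner_scaleC_left)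
    finally show "inner (S (c *\<^sub>C y)) z = inner (c *\<^sub>C S y) z" by (simp add: inner_commute)
  qed
  hence "Blinfun S \<in> bounded_operators" by (simp add: bounded_operators_def ap)
  thus ?thesis using S ap by metis
qed

text \<open>\<open>op_adjoint\<close> is a definite description in terms of \<open>cinner\<close>;
  here it becomes computable from the real inner product, which is how the algebra of adjoints below
  is obtained.\<close>

lemma op_adjoint_eqI:
  assumes T: "(T::'h::complex_hilbert_space op) \<in> bounded_operators" and S: "S \<in> bounded_operators"
    and eq: "\<And>x y. inner (T x) y = inner x (S y)"
  shows "op_adjoint T = S"
  unfolding op_adjoint_def
proof (rule the_equality)
  show "S \<in> bounded_operators \<and> (\<forall>x y. cinner (T x) y = cinner x (S y))"
    using S cinner_eqI_inner[of "blinfun_apply T" "blinfun_apply S", OF eq bounded_operatorsD[OF T]] by blast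
  fix R assume R: "R \<in> bounded_operators \<and> (\<forall>x y. cinner (T x) y = cinner x (R y))"
  show "R = S"
  proof (rule blinfun_eqI, rule vector_eq_ldot[THEN iffD1], rule allI)
    fix y x
    have "inner x (R y) = inner (T x) y" using R by (simp add: inner_eq_Re_cinner)
    thus "inner x (R y) = inner x (S y)" by (simp add: eq)
  qed
qed

lemma
  assumes T: "(T::'h::complex_hilbert_space op) \<in> bounded_operators"
  shows op_adjoint_bounded [simp]: "op_adjoint T \<in> bounded_operators"
    and inner_op_left: "inner (T x) y = inner x ((op_adjoint T) y)"
  using adjoint_exists[OF T] op_adjoint_eqI[OF T] by metis+

lemma inner_op_right:
  "(T::'h::complex_hilbert_space op) \<in> bounded_operators \<Longrightarrow>
    inner x (T y) = inner ((op_adjoint T) x) y"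
  by (metis inner_op_left inner_commute)

lemma blinfun_apply_op_scale [simp]: "(op_scale c T) x = c *\<^sub>C (T::'h::complex_hilbert_space op) x"
proof -
  have "bounded_linear (\<lambda>x. c *\<^sub>C T x)"
  proof (rule bounded_linear_intro[of _ "cmod c * norm T"])
    show "norm (c *\<^sub>C T x) \<le> norm x * (cmod c * norm T)" for x
      using mult_left_mono[OF norm_blinfun[of T x], of "cmod c"] by (simp add: norm_scaleC ac_simps)
  qed (simp_all add: blinfun.bilinear_simps scaleC_add_right)
  thus ?thesis unfolding op_scale_def by (simp add: bounded_linear_Blinfun_apply)
qed

lemma bounded_operators_closed [simp, intro]:
  fixes S T :: "'h::complex_hilbert_space op"
  shows "0 \<in> (bounded_operators :: 'h op set)"
    "id_blinfun \<in> (bounded_operators :: 'h op set)"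
    "S \<in> bounded_operators \<Longrightarrow> T \<in> bounded_operators \<Longrightarrow> S + T \<in> bounded_operators"
    "S \<in> bounded_operators \<Longrightarrow> T \<in> bounded_operators \<Longrightarrow> S - T \<in> bounded_operators"
    "T \<in> bounded_operators \<Longrightarrow> - T \<in> bounded_operators"
    "S \<in> bounded_operators \<Longrightarrow> T \<in> bounded_operators \<Longrightarrow> S o\<^sub>L T \<in> bounded_operators"
    "T \<in> bounded_operators \<Longrightarrow> r *\<^sub>R T \<in> bounded_operators"
    "T \<in> bounded_operators \<Longrightarrow> op_scale c T \<in> bounded_operators"
  by (auto simp: bounded_operators_def blinfun.bilinear_simps scaleC_add_right scaleC_scaleC mult.commute)

lemma op_adjoint_simps:
  fixes S T :: "'h::complex_hilbert_space op"
  shows op_adjoint_zero [simp]: "op_adjoint (0::'h op) = 0"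
    and op_adjoint_id [simp]: "op_adjoint (id_blinfun::'h op) = id_blinfun"
    and op_adjoint_add: "S \<in> bounded_operators \<Longrightarrow> T \<in> bounded_operators \<Longrightarrow> op_adjoint (S + T) = op_adjoint S + op_adjoint T"
    and op_adjoint_diff: "S \<in> bounded_operators \<Longrightarrow> T \<in> bounded_operators \<Longrightarrow> op_adjoint (S - T) = op_adjoint S - op_adjoint T"
    and op_adjoint_uminus: "T \<in> bounded_operators \<Longrightarrow> op_adjoint (- T) = - op_adjoint T"
    and op_adjoint_compose: "S \<in> bounded_operators \<Longrightarrow> T \<in> bounded_operators \<Longrightarrow> op_adjoint (S o\<^sub>L T) = op_adjoint T o\<^sub>L op_adjoint S"
    and op_adjoint_scaleR: "T \<in> bounded_operators \<Longrightarrow> op_adjoint (r *\<^sub>R T) = r *\<^sub>R op_adjoint T"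
    and op_adjoint_op_scale: "T \<in> bounded_operators \<Longrightarrow> op_adjoint (op_scale c T) = op_scale (cnj c) (op_adjoint T)"
  by (auto intro!: op_adjoint_eqI simp: blinfun.bilinear_simps inner_simps inner_scaleC_left inner_op_left
      bounded_operatorsD bounded_operatorsD[OF op_adjoint_bounded])

lemma op_adjoint_adjoint: "(T::'h::complex_hilbert_space op) \<in> bounded_operators \<Longrightarrow> op_adjoint (op_adjoint T) = T"
  by (rule op_adjoint_eqI) (simp_all add: inner_op_right)

lemma norm_op_adjoint_le:
  assumes "(T::'h::complex_hilbert_space op) \<in> bounded_operators" shows "norm (op_adjoint T) \<le> norm T"
proof (rule norm_blinfun_bound)
  fix y
  let ?S = "blinfun_apply (op_adjoint T)"
  have "(norm (?S y))\<^sup>2 = inner (T (?S y)) y" by (simp add: inner_op_left assms power2_norm_eq_inner)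
  also have "\<dots> \<le> norm (T (?S y)) * norm y" by (rule norm_cauchy_schwarz)
  also have "\<dots> \<le> norm T * norm (?S y) * norm y" by (intro mult_right_mono norm_blinfun) auto
  finally have "norm (?S y) * norm (?S y) \<le> norm (?S y) * (norm T * norm y)" by (simp add: power2_eq_square ac_simps)
  thus "norm (?S y) \<le> norm T * norm y" by (cases "norm (?S y) = 0") (auto simp: mult_le_cancel_left)
qed simp

lemma norm_op_adjoint: "(T::'h::complex_hilbert_space op) \<in> bounded_operators \<Longrightarrow> norm (op_adjoint T) = norm T"
  by (metis norm_op_adjoint_le op_adjoint_adjoint op_adjoint_bounded order_antisym)

lemma norm_op_scale_le: "norm (op_scale c T) \<le> cmod c * norm (T::'h::complex_hilbert_space op)"
  by (rule norm_blinfun_bound) (auto simp: norm_scaleC mult.assoc intro!: mult_left_mono norm_blinfun)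

section \<open>Positive operators and von Neumann algebras\<close>

lemma commutant_closed:
  fixes A :: "'h::complex_hilbert_space op set"
  shows "0 \<in> commutant A" and "id_blinfun \<in> commutant A"
    and "S \<in> commutant A \<Longrightarrow> T \<in> commutant A \<Longrightarrow> S + T \<in> commutant A"
    and "S \<in> commutant A \<Longrightarrow> T \<in> commutant A \<Longrightarrow> S o\<^sub>L T \<in> commutant A"
    and "A \<subseteq> bounded_operators \<Longrightarrow> T \<in> commutant A \<Longrightarrow> op_scale c T \<in> commutant A"
proof -
  assume S: "S \<in> commutant A" and T: "T \<in> commutant A"
  have "(S o\<^sub>L T) o\<^sub>L R = R o\<^sub>L (S o\<^sub>L T)" if "R \<in> A" for R
  proof (rule blinfun_eqI)
    fix x
    have "S o\<^sub>L R = R o\<^sub>L S" "T o\<^sub>L R = R o\<^sub>L T" using S T that by (auto simp: commutant_def)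
    hence "\<And>x. S (R x) = R (S x)"
      "\<And>x. T (R x) = R (T x)"
      by (metis blinfun_apply_blinfun_compose)+
    thus "((S o\<^sub>L T) o\<^sub>L R) x = (R o\<^sub>L (S o\<^sub>L T)) x" by simp
  qed
  thus "S o\<^sub>L T \<in> commutant A" using S T by (auto simp: commutant_def)
next
  assume A: "A \<subseteq> bounded_operators" and T: "T \<in> commutant A"
  have "op_scale c T o\<^sub>L R = R o\<^sub>L op_scale c T" if "R \<in> A" for R
  proof (rule blinfun_eqI)
    fix x
    have "T o\<^sub>L R = R o\<^sub>L T" using T that by (auto simp: commutant_def)
    hence "\<And>x. T (R x) = R (T x)"
      by (metis blinfun_apply_blinfun_compose)
    thus "(op_scale c T o\<^sub>L R) x = (R o\<^sub>L op_scale c T) x"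
      using A that by (auto simp: bounded_operatorsD)
  qed
  thus "op_scale c T \<in> commutant A" using T by (auto simp: commutant_def)
next
  assume S: "S \<in> commutant A" and T: "T \<in> commutant A"
  have "(S + T) o\<^sub>L R = R o\<^sub>L (S + T)" if "R \<in> A" for R
    using S T that by (auto simp: commutant_def bounded_bilinear.add_left[OF bounded_bilinear_blinfun_compose]
        bounded_bilinear.add_right[OF bounded_bilinear_blinfun_compose])
  thus "S + T \<in> commutant A" using S T by (auto simp: commutant_def)
qed (auto simp: commutant_def intro!: blinfun_eqI)

lemma commutant_strong_limit:
  fixes A :: "'h::complex_hilbert_space op set" and Tn :: "nat \<Rightarrow> 'h op" and T :: "'h op"
  assumes Tn: "\<And>n. Tn n \<in> commutant A" and A: "A \<subseteq> bounded_operators"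
    and lim: "\<And>x. (\<lambda>n. Tn n x) \<longlonglongrightarrow> T x"
  shows "T \<in> commutant A"
proof -
  have comm: "T (S x) = S (T x)"
    if S: "\<And>n x. Tn n (S x) = S (Tn n x)" for S :: "'h op" and x
  proof -
    have "(\<lambda>n. S (Tn n x)) \<longlonglongrightarrow> S (T x)"
      by (intro blinfun.tendsto tendsto_const lim)
    with lim[of "S x"] show ?thesis unfolding S using LIMSEQ_unique by blast
  qed
  \<comment> \<open>Complex linearity of the limit is an instance of \<open>comm\<close>:
    multiplication by \<open>c\<close> is one more operator that commutes with every
    \<open>Tn n\<close>.\<close>
  have "T (c *\<^sub>C x) = c *\<^sub>C T x" for c x
  proof -
    have "Tn n o\<^sub>L op_scale c id_blinfun = op_scale c id_blinfun o\<^sub>L Tn n" for n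
      using Tn[of n] by (intro blinfun_eqI) (simp add: commutant_def bounded_operatorsD)
    hence "Tn n (c *\<^sub>C x) = c *\<^sub>C (Tn n) x" for n x
      by (metis blinfun_apply_blinfun_compose blinfun_apply_op_scale blinfun_apply_id_blinfun id_apply)
    with comm[of "op_scale c id_blinfun"] show ?thesis by simp
  qed
  moreover have "T o\<^sub>L S = S o\<^sub>L T" if "S \<in> A" for S
  proof (rule blinfun_eqI)
    fix x
    have "Tn n o\<^sub>L S = S o\<^sub>L Tn n" for n using Tn[of n] that by (auto simp: commutant_def)
    with comm[of S x] show "(T o\<^sub>L S) x = (S o\<^sub>L T) x"
      by (metis blinfun_apply_blinfun_compose)
  qed
  ultimately show ?thesis by (auto simp: commutant_def bounded_operators_def)
qed

section \<open>Strong limits of bounded sequences of operators\<close>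

lemma strong_limit_exists:
  fixes Tn :: "nat \<Rightarrow> 'a::real_normed_vector \<Rightarrow>\<^sub>L 'b::banach"
  assumes bd: "\<And>n. norm (Tn n) \<le> C" and C: "\<And>x. Cauchy (\<lambda>n. Tn n x)"
  shows "\<exists>T :: 'a \<Rightarrow>\<^sub>L 'b. \<forall>x. (\<lambda>n. Tn n x) \<longlonglongrightarrow> T x"
proof -
  have "\<forall>x. \<exists>y. (\<lambda>n. Tn n x) \<longlonglongrightarrow> y"
    using C Cauchy_convergent convergent_def by blast
  then obtain f where f: "\<And>x. (\<lambda>n. Tn n x) \<longlonglongrightarrow> f x" by metis
  have "bounded_linear f"
  proof (rule bounded_linear_intro[of _ C])
    show "f (x + y) = f x + f y" for x y
      using f[of "x + y"] tendsto_add[OF f[of x] f[of y]] LIMSEQ_unique by (simp add: blinfun.add_right) blast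
    show "f (r *\<^sub>R x) = r *\<^sub>R f x" for r x
      using f[of "r *\<^sub>R x"] tendsto_scaleR[OF tendsto_const f[of x], of r] LIMSEQ_unique by (simp add: blinfun.scaleR_right) blast
    show "norm (f x) \<le> norm x * C" for x
    proof (rule LIMSEQ_le_const2[OF tendsto_norm[OF f[of x]]], intro exI allI impI)
      fix n
      have "norm (Tn n x) \<le> norm (Tn n) * norm x" by (rule norm_blinfun)
      also have "\<dots> \<le> C * norm x" by (intro mult_right_mono bd) auto
      finally show "norm (Tn n x) \<le> norm x * C" by (simp add: mult.commute)
    qed
  qed
  thus ?thesis using f by (intro exI[of _ "Blinfun f"]) (simp add: bounded_linear_Blinfun_apply)
qed

text \<open>The uniform bound on the left factors controls A n (B n x - B' x); what remains is the
  convergence of A n at the fixed vector B' x.\<close>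

lemma strong_limit_compose:
  fixes A :: "nat \<Rightarrow> 'b::real_normed_vector \<Rightarrow>\<^sub>L 'c::real_normed_vector"
    and B :: "nat \<Rightarrow> 'a::real_normed_vector \<Rightarrow>\<^sub>L 'b" and A' :: "'b \<Rightarrow>\<^sub>L 'c" and B' :: "'a \<Rightarrow>\<^sub>L 'b"
  assumes bd: "\<And>n. norm (A n) \<le> C"
    and A: "\<And>x. (\<lambda>n. A n x) \<longlonglongrightarrow> A' x"
    and B: "\<And>x. (\<lambda>n. B n x) \<longlonglongrightarrow> B' x"
  shows "(\<lambda>n. A n (B n x)) \<longlonglongrightarrow> A' (B' x)"
proof -
  have "(\<lambda>n. A n (B n x - B' x)) \<longlonglongrightarrow> 0"
  proof (rule Lim_null_comparison)
    show "\<forall>\<^sub>F n in sequentially. norm (A n (B n x - B' x))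
        \<le> C * norm (B n x - B' x)"
      using order_trans[OF norm_blinfun mult_right_mono[OF bd]] by (intro always_eventually) simp
    have "(\<lambda>n. C * norm (B n x - B' x)) \<longlonglongrightarrow> C * norm (B' x - B' x)"
      by (intro tendsto_intros B)
    thus "(\<lambda>n. C * norm (B n x - B' x)) \<longlonglongrightarrow> 0" by simp
  qed
  from tendsto_add[OF this A[of "B' x"]] show ?thesis by (simp add: blinfun.diff_right)
qed

text \<open>The sign of \<open>c\<close> is derived, since a negative leading coefficient would
  contradict the hypothesis for large \<open>t\<close>. Both Cauchy-Schwarz inequalities below, for
  positive operators and for the trace, rest on this.\<close>

lemma discriminant_le:
  fixes a b c :: real
  assumes "\<And>t. 0 \<le> a + 2 * t * b + t\<^sup>2 * c"
  shows "b\<^sup>2 \<le> a * c"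
proof (cases "c = 0")
  case True
  have "b = 0"
  proof (rule ccontr)
    assume "b \<noteq> 0"
    hence "2 * ((- a - 1) / (2 * b)) * b = - a - 1" by simp
    thus False using assms[of "(- a - 1) / (2 * b)"] True by simp
  qed
  thus ?thesis by (simp add: True)
next
  case False
  have "c \<ge> 0"
  proof (rule ccontr)
    assume "\<not> c \<ge> 0"
    \<comment> \<open>Chosen so that -c t = -c + |a| + 2 |b|; after multiplication by t >= 1 the
      quadratic term outweighs a + 2 t b.\<close>
    define t where "t = 1 + \<bar>a\<bar> / (- c) + 2 * \<bar>b\<bar> / (- c)"
    have "\<bar>a\<bar> / (- c) \<ge> 0" "2 * \<bar>b\<bar> / (- c) \<ge> 0" using \<open>\<not> c \<ge> 0\<close> by (intro divide_nonneg_nonneg; simp)+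
    hence t: "t \<ge> 1" unfolding t_def by linarith
    have t2: "t * (- c) = - c + \<bar>a\<bar> + 2 * \<bar>b\<bar>" using \<open>\<not> c \<ge> 0\<close> by (simp add: t_def field_simps)
    have "t\<^sup>2 * (- c) = t * (- c + \<bar>a\<bar> + 2 * \<bar>b\<bar>)" using arg_cong[OF t2, of "\<lambda>u. t * u"] by (simp add: power2_eq_square)
    also have "\<dots> = t * (- c) + t * \<bar>a\<bar> + 2 * t * \<bar>b\<bar>" by (simp add: algebra_simps)
    also have "\<dots> \<ge> t * (- c) + 1 * \<bar>a\<bar> + 2 * t * \<bar>b\<bar>" using t \<open>\<not> c \<ge> 0\<close> by (intro add_mono mult_right_mono) auto
    finally have "t\<^sup>2 * (- c) \<ge> t * (- c) + \<bar>a\<bar> + 2 * t * \<bar>b\<bar>" by simp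
    moreover have "t * (- c) > 0" using t \<open>\<not> c \<ge> 0\<close> by (intro mult_pos_pos) auto
    moreover have "2 * t * b \<le> 2 * t * \<bar>b\<bar>" using t by (intro mult_left_mono) auto
    ultimately show False using assms[of t] by linarith
  qed
  hence c: "c > 0" using False by simp
  have "0 \<le> a - b\<^sup>2 / c" using assms[of "- b / c"] c by (simp add: power2_eq_square field_simps)
  thus ?thesis using c by (simp add: field_simps)
qed

section \<open>Symmetric and positive operators on real inner product spaces\<close>

definition sym_op :: "('a::real_inner \<Rightarrow>\<^sub>L 'a) \<Rightarrow> bool" where
  "sym_op T \<longleftrightarrow> (\<forall>x y. inner (T x) y = inner x (T y))"

text \<open>Over the reals a nonnegative quadratic form does not force symmetry, as plane rotations
  by a right angle show, so symmetry is demanded separately.\<close>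

definition psd_op :: "('a::real_inner \<Rightarrow>\<^sub>L 'a) \<Rightarrow> bool" where
  "psd_op T \<longleftrightarrow> sym_op T \<and> (\<forall>x. 0 \<le> inner (T x) x)"

lemma sym_opD: "sym_op T \<Longrightarrow> inner (T x) y = inner x (T y)"
  by (simp add: sym_op_def)

lemma psd_op_sym: "psd_op T \<Longrightarrow> sym_op T" and psd_op_inner: "psd_op T \<Longrightarrow> 0 \<le> inner (T x) x"
  by (simp_all add: psd_op_def)

lemma sym_op_intros:
  "sym_op (0 :: 'a::real_inner \<Rightarrow>\<^sub>L 'a)" "sym_op (id_blinfun :: 'a \<Rightarrow>\<^sub>L 'a)"
  "sym_op S \<Longrightarrow> sym_op T \<Longrightarrow> sym_op (S + T)" "sym_op S \<Longrightarrow> sym_op T \<Longrightarrow> sym_op (S - T)"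
  "sym_op S \<Longrightarrow> sym_op (r *\<^sub>R S)"
  "sym_op S \<Longrightarrow> sym_op T \<Longrightarrow> S o\<^sub>L T = T o\<^sub>L S \<Longrightarrow> sym_op (S o\<^sub>L T)"
  "sym_op S \<Longrightarrow> sym_op T \<Longrightarrow> sym_op (T o\<^sub>L S o\<^sub>L T)"
  by (simp_all add: sym_op_def blinfun.bilinear_simps inner_simps)
    (metis blinfun_apply_blinfun_compose)

lemma psd_op_intros:
  "psd_op (0 :: 'a::real_inner \<Rightarrow>\<^sub>L 'a)" "psd_op (id_blinfun :: 'a \<Rightarrow>\<^sub>L 'a)"
  "psd_op S \<Longrightarrow> psd_op T \<Longrightarrow> psd_op (S + T)"
  "0 \<le> r \<Longrightarrow> psd_op S \<Longrightarrow> psd_op (r *\<^sub>R S)"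
  "psd_op S \<Longrightarrow> sym_op T \<Longrightarrow> psd_op (T o\<^sub>L S o\<^sub>L T)"
  "sym_op T \<Longrightarrow> psd_op (T o\<^sub>L T)"
proof -
  assume T: "sym_op T"
  show "psd_op (T o\<^sub>L T)" using sym_op_intros(6)[OF T T refl] T by (simp add: psd_op_def sym_opD[of T "blinfun_apply T _"])
  assume "psd_op S" thus "psd_op (T o\<^sub>L S o\<^sub>L T)" using T sym_op_intros(7)[of S T] by (simp add: psd_op_def sym_opD[OF T])
qed (auto simp: psd_op_def sym_op_intros blinfun.bilinear_simps inner_simps)

lemma psd_op_conj:
  assumes S: "psd_op S" and T: "(T::'h::complex_hilbert_space op) \<in> bounded_operators"
  shows "psd_op (op_adjoint T o\<^sub>L S o\<^sub>L T)"
proof -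
  have "inner ((op_adjoint T o\<^sub>L S o\<^sub>L T) x) y = inner (S (T x)) (T y)" for x y
    using inner_op_right[OF T, of y "S (T x)"] inner_op_left[OF T, of y "S (T x)"]
    by (simp add: inner_commute)
  moreover have "inner x ((op_adjoint T o\<^sub>L S o\<^sub>L T) y) = inner (T x) (S (T y))" for x y
    by (simp add: inner_op_left[OF T])
  moreover have "inner (S (T x)) (T y) = inner (T x) (S (T y))" for x y
    using S by (simp add: psd_op_def sym_op_def)
  ultimately show ?thesis unfolding psd_op_def sym_op_def using psd_op_inner[OF S] by metis
qed

lemma blinfun_compose_id [simp]: "T o\<^sub>L id_blinfun = T" "id_blinfun o\<^sub>L T = T"
  by (rule blinfun_eqI, simp)+

lemma psd_op_adj_compose: "(T::'h::complex_hilbert_space op) \<in> bounded_operators \<Longrightarrow> psd_op (op_adjoint T o\<^sub>L T)"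
  using psd_op_conj[OF psd_op_intros(2), of T] by simp

lemma psd_op_cauchy_schwarz:
  assumes A: "psd_op A"
  shows "(inner (A x) y)\<^sup>2 \<le> inner (A x) x * inner (A y) y"
proof (rule discriminant_le)
  fix t
  have "0 \<le> inner (A (x + t *\<^sub>R y)) (x + t *\<^sub>R y)" using A by (rule psd_op_inner)
  thus "0 \<le> inner (A x) x + 2 * t * inner (A x) y + t\<^sup>2 * inner (A y) y"
    using sym_opD[OF psd_op_sym[OF A], of y x]
    by (simp add: blinfun.bilinear_simps inner_simps power2_eq_square inner_commute algebra_simps)
qed

text \<open>Apply the Cauchy-Schwarz inequality of the form of \<open>A\<close> to \<open>x\<close>
  and \<open>A x\<close>, then cancel |A x|^2.\<close>

lemma psd_op_norm_le:
  assumes A: "psd_op A" and r: "0 \<le> r" and le: "\<And>x. inner (A x) x \<le> r * (norm x)\<^sup>2"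
  shows "norm A \<le> r"
proof (rule norm_blinfun_bound[OF r])
  fix x
  let ?n = "norm (A x)"
  have "(?n\<^sup>2)\<^sup>2 \<le> inner (A x) x * inner (A (A x)) (A x)"
    using psd_op_cauchy_schwarz[OF A, of x "A x"] by (simp add: power2_norm_eq_inner)
  also have "\<dots> \<le> (r * (norm x)\<^sup>2) * (r * ?n\<^sup>2)"
    using le r psd_op_inner[OF A] by (intro mult_mono) auto
  finally have "?n\<^sup>2 * ?n\<^sup>2 \<le> ?n\<^sup>2 * (r * norm x)\<^sup>2" by (simp add: power2_eq_square ac_simps)
  hence "?n = 0 \<or> ?n\<^sup>2 \<le> (r * norm x)\<^sup>2" using mult_le_cancel_left_pos[of "?n\<^sup>2"] by fastforce
  thus "?n \<le> r * norm x" using r by (auto intro: power2_le_imp_le)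
qed

text \<open>F. Riesz: with \<open>A\<^sub>0 = A\<close> and \<open>A\<^sub>k\<^sub>+\<^sub>1 = A\<^sub>k - A\<^sub>k\<^sup>2\<close> one has \<open>A = \<Sum>\<^sub>k A\<^sub>k\<^sup>2\<close> strongly,
  so \<open>AB\<close> is a sum of positive operators \<open>A\<^sub>k B A\<^sub>k\<close>.\<close>

lemma psd_op_compose_commuting:
  fixes A B :: "'a::real_inner \<Rightarrow>\<^sub>L 'a"
  assumes A: "psd_op A" and A1: "psd_op (id_blinfun - A)" and B: "psd_op B" and AB: "A o\<^sub>L B = B o\<^sub>L A"
  shows "psd_op (A o\<^sub>L B)"
proof -
  define a where "a = rec_nat A (\<lambda>_ X. X - (X o\<^sub>L X))"
  have a0: "a 0 = A" and aS: "a (Suc n) = a n - (a n o\<^sub>L a n)" for n by (simp_all add: a_def)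
  have inv: "psd_op (a n) \<and> psd_op (id_blinfun - a n) \<and> a n o\<^sub>L B = B o\<^sub>L a n" for n
  proof (induction n)
    case 0 show ?case using assms by (simp add: a0)
  next
    case (Suc n)
    let ?X = "a n" let ?Y = "(id_blinfun - a n)"
    have s: "sym_op ?X" "sym_op ?Y" using Suc psd_op_sym by auto
    \<comment> \<open>In one variable with y = 1 - x: x - x^2 = x y x + y x y and 1 - (x - x^2) = y
      + x^2. The right-hand sides are visibly positive, so 0 <= a n <= 1 persists.\<close>
    have i1: "a (Suc n) = (?X o\<^sub>L ?Y o\<^sub>L ?X) + (?Y o\<^sub>L ?X o\<^sub>L ?Y)"
      by (intro blinfun_eqI) (simp add: aS blinfun.bilinear_simps)
    have i2: "id_blinfun - a (Suc n) = ?Y + (?X o\<^sub>L ?X)"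
      by (intro blinfun_eqI) (simp add: aS blinfun.bilinear_simps)
    have "a (Suc n) o\<^sub>L B = B o\<^sub>L a (Suc n)"
    proof (rule blinfun_eqI)
      fix x
      have "\<And>x. ?X (B x) = B (?X x)"
        using Suc by (metis blinfun_apply_blinfun_compose)
      thus "(a (Suc n) o\<^sub>L B) x = (B o\<^sub>L a (Suc n)) x"
        by (simp add: aS blinfun.bilinear_simps)
    qed
    moreover have "psd_op (a (Suc n))" unfolding i1 using Suc s by (intro psd_op_intros(3,5)) auto
    moreover have "psd_op (id_blinfun - a (Suc n))" unfolding i2 using Suc s by (intro psd_op_intros(3,6)) auto
    ultimately show ?case by blast
  qed
  have aB: "a n (B x) = B (a n x)" for n x
    using inv by (metis blinfun_apply_blinfun_compose)
  have sa: "inner (a n x) y = inner x (a n y)" for n x y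
    using inv psd_op_sym sym_opD by blast
  have "0 \<le> inner ((A o\<^sub>L B) x) x" for x
  proof -
    have tel: "inner (A x) y = (\<Sum>k<n. inner (a k x) (a k y)) + inner (a n x) y" for n y
    proof (induction n)
      case (Suc n)
      have "inner (a n x) y = inner (a n x) (a n y) + inner ((a (Suc n)) x) y"
        by (simp add: aS blinfun.bilinear_simps inner_simps sa[of n "a n x" y])
      thus ?case using Suc by simp
    qed (simp add: a0)
    have "summable (\<lambda>k. (norm (a k x))\<^sup>2)"
    proof (rule summableI_nonneg_bounded)
      show "(\<Sum>k<n. (norm (a k x))\<^sup>2) \<le> inner (A x) x" for n
        using tel[of x n] inv[of n] psd_op_inner[of "a n" x] by (simp add: power2_norm_eq_inner)
    qed simp
    hence "(\<lambda>k. (norm (a k x))\<^sup>2) \<longlonglongrightarrow> 0" by (rule summable_LIMSEQ_zero)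
    hence "(\<lambda>k. norm (a k x)) \<longlonglongrightarrow> 0"
      using tendsto_real_sqrt by fastforce
    hence "(\<lambda>k. a k x) \<longlonglongrightarrow> 0" by (rule tendsto_norm_zero_cancel)
    hence lim: "(\<lambda>k. inner (a k x) (B x)) \<longlonglongrightarrow> 0"
      using tendsto_inner[OF _ tendsto_const, of _ 0] by fastforce
    \<comment> \<open>The terms dropped from the telescoped sum are inner products of
      \<open>a k x\<close> with \<open>B (a k x)\<close>, hence nonnegative.\<close>
    have "inner (a n x) (B x) \<le> inner (A x) (B x)" for n
      using tel[of "B x" n] inv psd_op_inner[OF B]
      by (auto simp: aB intro!: sum_nonneg) (metis inner_commute sum_nonneg)
    hence "0 \<le> inner (A x) (B x)"
      using LIMSEQ_le_const2[OF lim] by blast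
    thus ?thesis using sa[of 0 "B x" x] by (simp add: a0 inner_commute)
  qed
  moreover have "sym_op (A o\<^sub>L B)" using A B AB psd_op_sym by (intro sym_op_intros) auto
  ultimately show ?thesis by (simp add: psd_op_def)
qed

section \<open>Closure properties and square roots in a von Neumann algebra\<close>

locale vna =
  fixes N :: "'h::complex_hilbert_space op set"
  assumes vna: "von_neumann_algebra N"
begin

lemma bounded [simp]: "T \<in> N \<Longrightarrow> T \<in> bounded_operators"
  and adj [simp, intro]: "T \<in> N \<Longrightarrow> op_adjoint T \<in> N"
  and bicommutant: "N = commutant (commutant N)"
  using vna by (auto simp: von_neumann_algebra_def)

lemma commutant_bounded: "commutant N \<subseteq> bounded_operators" by (auto simp: commutant_def)

lemma zero [simp, intro]: "0 \<in> N" and one [simp, intro]: "id_blinfun \<in> N"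
  and add [simp, intro]: "S \<in> N \<Longrightarrow> T \<in> N \<Longrightarrow> S + T \<in> N"
  and mult [simp, intro]: "S \<in> N \<Longrightarrow> T \<in> N \<Longrightarrow> S o\<^sub>L T \<in> N"
  and scale [simp, intro]: "T \<in> N \<Longrightarrow> op_scale c T \<in> N"
  and strong_limit: "(\<And>n. (Tn :: nat \<Rightarrow> 'h op) n \<in> N) \<Longrightarrow> (\<And>x. (\<lambda>n. Tn n x) \<longlonglongrightarrow> (R :: 'h op) x) \<Longrightarrow> R \<in> N"
  using commutant_closed[where A = "commutant N"] commutant_strong_limit[where A = "commutant N" and Tn = Tn and T = R, OF _ commutant_bounded]
    commutant_bounded bicommutant by auto

lemma op_scale_of_real: "op_scale (complex_of_real r) T = r *\<^sub>R (T :: 'h op)"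
  by (rule blinfun_eqI) (simp add: scaleC_of_real blinfun.bilinear_simps)

lemma scaleR [simp, intro]: "T \<in> N \<Longrightarrow> r *\<^sub>R T \<in> N"
  using scale[of T "complex_of_real r"] by (simp add: op_scale_of_real)

lemma uminus [simp, intro]: "T \<in> N \<Longrightarrow> - T \<in> N" using scaleR[of T "-1"] by simp

lemma diff [simp, intro]: "S \<in> N \<Longrightarrow> T \<in> N \<Longrightarrow> S - T \<in> N"
  using add[of S "- T"] by simp

lemma sum_closed [simp, intro]: "(\<And>i. i \<in> I \<Longrightarrow> f i \<in> N) \<Longrightarrow> (\<Sum>i\<in>I. f i) \<in> N"
  by (induction I rule: infinite_finite_induct) auto

lemma sym_op_iff: "T \<in> N \<Longrightarrow> sym_op T \<longleftrightarrow> op_adjoint T = T"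
  by (metis bounded inner_op_left op_adjoint_eqI sym_op_def)

lemmas adj_simps = op_adjoint_add[OF bounded bounded] op_adjoint_diff[OF bounded bounded] op_adjoint_uminus[OF bounded]
  op_adjoint_compose[OF bounded bounded] op_adjoint_scaleR[OF bounded] op_adjoint_op_scale[OF bounded]
  op_adjoint_adjoint[OF bounded]

lemma adj_sum: "(\<And>i. i \<in> I \<Longrightarrow> f i \<in> N) \<Longrightarrow> op_adjoint (\<Sum>i\<in>I. f i) = (\<Sum>i\<in>I. op_adjoint (f i))"
  by (induction I rule: infinite_finite_induct) (auto simp: adj_simps)

text \<open>With \<open>z = 1 - w\<close> the equation \<open>z\<^sup>2 = 1 - h\<close> becomes the fixed point problem \<open>w = (h + w\<^sup>2)/2\<close>, a contraction
  on a small ball.\<close>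

lemma sqrt_exists:
  assumes h: "h \<in> N" "op_adjoint h = h" "norm h < 1"
  shows "\<exists>z\<in>N. op_adjoint z = z \<and> z o\<^sub>L z = id_blinfun - h"
proof -
  \<comment> \<open>The smaller root of r = (|h| + r^2) / 2: the ball of radius \<rho> is then
    mapped into itself, and \<rho> is also a Lipschitz constant on it.\<close>
  define \<rho> where "\<rho> = 1 - sqrt (1 - norm h)"
  have \<rho>: "0 \<le> \<rho>" "\<rho> < 1" using h by (auto simp: \<rho>_def)
  have "(1 - \<rho>)\<^sup>2 = 1 - norm h" using h by (simp add: \<rho>_def)
  hence \<rho>2: "norm h + \<rho> * \<rho> = 2 * \<rho>" by (simp add: power2_eq_square algebra_simps)
  define f where "f w = (1/2) *\<^sub>R (h + (w o\<^sub>L w))" for w :: "'h op"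
  define s where "s = {w \<in> N. sym_op w \<and> norm w \<le> \<rho>}"
  have "closed s"
  unfolding closed_sequential_limits
  proof (intro allI impI, elim conjE)
    fix x l assume x: "\<forall>n. x n \<in> s" and l: "x \<longlonglongrightarrow> l"
    have lim: "(\<lambda>n. x n v) \<longlonglongrightarrow> l v" for v by (intro blinfun.tendsto l tendsto_const)
    have "l \<in> N" using x by (intro strong_limit[OF _ lim]) (auto simp: s_def)
    moreover have "sym_op l" unfolding sym_op_def
    proof (intro allI)
      fix v w
      have "(\<lambda>n. inner (x n v) w) \<longlonglongrightarrow> inner (l v) w" by (intro tendsto_intros lim)
      moreover have "inner (x n v) w = inner v (x n w)" for n
        using x by (auto simp: s_def sym_opD)
      moreover have "(\<lambda>n. inner v (x n w)) \<longlonglongrightarrow> inner v (l w)" by (intro tendsto_intros lim)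
      ultimately show "inner (l v) w = inner v (l w)" using LIMSEQ_unique by simp blast
    qed
    moreover have "norm l \<le> \<rho>"
      using x by (intro LIMSEQ_le_const2[OF tendsto_norm[OF l]]) (auto simp: s_def)
    ultimately show "l \<in> s" by (simp add: s_def)
  qed
  hence "complete s" by (simp add: complete_eq_closed)
  moreover have "s \<noteq> {}" using \<rho> sym_op_intros(1) by (auto simp: s_def intro!: exI[of _ 0])
  moreover have "f ` s \<subseteq> s"
  proof (clarify)
    fix w assume w: "w \<in> s"
    have "norm (w o\<^sub>L w) \<le> norm w * norm w" by (rule norm_blinfun_compose)
    also have "\<dots> \<le> \<rho> * \<rho>" using w \<rho> by (intro mult_mono) (auto simp: s_def)
    finally have "norm (h + (w o\<^sub>L w)) \<le> 2 * \<rho>" using norm_triangle_ineq[of h "w o\<^sub>L w"] \<rho>2 by linarith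
    thus "f w \<in> s" using w h by (auto simp: s_def f_def sym_op_iff[symmetric] intro!: sym_op_intros)
  qed
  moreover have "dist (f w) (f v) \<le> \<rho> * dist w v" if "w \<in> s" "v \<in> s" for w v
  proof -
    have "f w - f v = (1/2) *\<^sub>R ((w o\<^sub>L (w - v)) + ((w - v) o\<^sub>L v))"
      by (intro blinfun_eqI) (simp add: f_def blinfun.bilinear_simps algebra_simps)
    moreover have "norm ((w o\<^sub>L (w - v)) + ((w - v) o\<^sub>L v)) \<le> norm w * norm (w - v) + norm (w - v) * norm v"
      by (intro norm_triangle_le add_mono norm_blinfun_compose)
    moreover have "norm w * norm (w - v) + norm (w - v) * norm v \<le> \<rho> * norm (w - v) + norm (w - v) * \<rho>"
      using that by (intro add_mono mult_right_mono mult_left_mono) (auto simp: s_def)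
    ultimately show ?thesis by (simp add: dist_norm)
  qed
  ultimately obtain w where w: "w \<in> s" "f w = w"
    using Banach_fix[of s \<rho> f] \<rho> by blast
  have "h + (w o\<^sub>L w) = 2 *\<^sub>R w" using w(2) by (simp add: f_def) (metis scaleR_half_double scaleR_2 scaleR_right_distrib)
  hence "(id_blinfun - w) o\<^sub>L (id_blinfun - w) = id_blinfun - h"
    by (simp add: bounded_bilinear.diff_left[OF bounded_bilinear_blinfun_compose]
        bounded_bilinear.diff_right[OF bounded_bilinear_blinfun_compose] scaleR_2 algebra_simps)
  moreover have "id_blinfun - w \<in> N" "sym_op (id_blinfun - w)"
    using w by (auto simp: s_def intro: sym_op_intros)
  ultimately show ?thesis using sym_op_iff by blast
qed

end

section \<open>Traces and polar decomposition\<close>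

lemmas blinfun_compose_simps =
  bounded_bilinear.add_left[OF bounded_bilinear_blinfun_compose]
  bounded_bilinear.add_right[OF bounded_bilinear_blinfun_compose]
  bounded_bilinear.diff_left[OF bounded_bilinear_blinfun_compose]
  bounded_bilinear.diff_right[OF bounded_bilinear_blinfun_compose]
  bounded_bilinear.minus_left[OF bounded_bilinear_blinfun_compose]
  bounded_bilinear.minus_right[OF bounded_bilinear_blinfun_compose]
  bounded_bilinear.scaleR_left[OF bounded_bilinear_blinfun_compose]
  bounded_bilinear.scaleR_right[OF bounded_bilinear_blinfun_compose]

lemma blinfun_compose_sum:
  "(\<Sum>i\<in>I. f i) o\<^sub>L T = (\<Sum>i\<in>I. f i o\<^sub>L T)" "T o\<^sub>L (\<Sum>i\<in>I. f i) = (\<Sum>i\<in>I. T o\<^sub>L f i)"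
  by (rule bounded_bilinear.sum_left[OF bounded_bilinear_blinfun_compose]
      bounded_bilinear.sum_right[OF bounded_bilinear_blinfun_compose])+

lemma op_scale_compose:
  fixes S T :: "'h::complex_hilbert_space op"
  shows "op_scale c S o\<^sub>L T = op_scale c (S o\<^sub>L T)"
    and "S \<in> bounded_operators \<Longrightarrow> S o\<^sub>L op_scale c T = op_scale c (S o\<^sub>L T)"
    and "op_scale c (op_scale d T) = op_scale (c * d) T"
    and "op_scale 1 T = T"
    and "op_scale c (S + T) = op_scale c S + op_scale c T"
    and "op_scale (c + d) T = op_scale c T + op_scale d T"
  by (auto intro!: blinfun_eqI simp: bounded_operatorsD scaleC_scaleC scaleC_add_right scaleC_add_left blinfun.bilinear_simps)

lemma blinfun_assoc: "(A o\<^sub>L B) o\<^sub>L C = A o\<^sub>L (B o\<^sub>L C)"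
  by (rule blinfun_eqI) simp

section \<open>The trace and its 2-norm\<close>

locale tracial_vna = vna N for N :: "'h::complex_hilbert_space op set" +
  fixes \<tau> :: "'h op \<Rightarrow> complex"
  assumes tracial_state: "tracial_state N \<tau>" and faithful: "faithful_on N \<tau>"
begin

lemma tr_add: "S \<in> N \<Longrightarrow> T \<in> N \<Longrightarrow> \<tau> (S + T) = \<tau> S + \<tau> T"
  and tr_scale: "T \<in> N \<Longrightarrow> \<tau> (op_scale c T) = c * \<tau> T"
  and tr_one [simp]: "\<tau> id_blinfun = 1"
  and tr_comm: "S \<in> N \<Longrightarrow> T \<in> N \<Longrightarrow> \<tau> (S o\<^sub>L T) = \<tau> (T o\<^sub>L S)"
  and tr_sq: "T \<in> N \<Longrightarrow> Im (\<tau> (op_adjoint T o\<^sub>L T)) = 0" "T \<in> N \<Longrightarrow> 0 \<le> Re (\<tau> (op_adjoint T o\<^sub>L T))"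
  using tracial_state by (auto simp: tracial_state_def complex_is_Real_iff)

lemma tr_zero [simp]: "\<tau> 0 = 0" using tr_add[of 0 0] by simp

lemma tr_scaleR: "T \<in> N \<Longrightarrow> \<tau> (r *\<^sub>R T) = complex_of_real r * \<tau> T"
  using tr_scale[of T "complex_of_real r"] by (simp add: op_scale_of_real)

lemma tr_uminus: "T \<in> N \<Longrightarrow> \<tau> (- T) = - \<tau> T" using tr_scaleR[of T "-1"] by simp

lemma tr_diff: "S \<in> N \<Longrightarrow> T \<in> N \<Longrightarrow> \<tau> (S - T) = \<tau> S - \<tau> T"
  using tr_add[of S "- T"] by (simp add: tr_uminus)

lemma tr_sum: "(\<And>i. i \<in> I \<Longrightarrow> f i \<in> N) \<Longrightarrow> \<tau> (\<Sum>i\<in>I. f i) = (\<Sum>i\<in>I. \<tau> (f i))"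
  by (induction I rule: infinite_finite_induct) (auto simp: tr_add)

text \<open>Compatibility of the trace with adjoints is not an axiom of
  \<open>tracial_state\<close>. It follows by polarisation from the reality of the trace on squares
  of S + T and of S + i T.\<close>

lemma tr_cross:
  assumes S: "S \<in> N" and T: "T \<in> N"
  shows "\<tau> (op_adjoint S o\<^sub>L T) = cnj (\<tau> (op_adjoint T o\<^sub>L S))"
proof (rule complex_eqI)
  have sq: "\<tau> (op_adjoint (S + T') o\<^sub>L (S + T')) = \<tau> (op_adjoint S o\<^sub>L S) + \<tau> (op_adjoint T' o\<^sub>L T') + (\<tau> (op_adjoint S o\<^sub>L T') + \<tau> (op_adjoint T' o\<^sub>L S))"
    if "T' \<in> N" for T'
    using S that by (simp add: adj_simps blinfun_compose_simps tr_add)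
  show "Im (\<tau> (op_adjoint S o\<^sub>L T)) = Im (cnj (\<tau> (op_adjoint T o\<^sub>L S)))"
    using arg_cong[OF sq[OF T], of Im] S T by (simp add: tr_sq)
  have "\<tau> (op_adjoint S o\<^sub>L op_scale \<i> T) = \<i> * \<tau> (op_adjoint S o\<^sub>L T)"
    "\<tau> (op_adjoint (op_scale \<i> T) o\<^sub>L S) = - \<i> * \<tau> (op_adjoint T o\<^sub>L S)"
    using S T by (simp_all add: op_scale_compose adj_simps tr_scale)
  thus "Re (\<tau> (op_adjoint S o\<^sub>L T)) = Re (cnj (\<tau> (op_adjoint T o\<^sub>L S)))"
    using arg_cong[OF sq[OF scale[OF T, of \<i>]], of Im] S T by (simp add: tr_sq)
qed

definition ip :: "'h op \<Rightarrow> 'h op \<Rightarrow> real" where "ip S T = Re (\<tau> (op_adjoint S o\<^sub>L T))"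

definition n2 :: "'h op \<Rightarrow> real" where "n2 T = sqrt (ip T T)"

lemma ip_commute: "S \<in> N \<Longrightarrow> T \<in> N \<Longrightarrow> ip S T = ip T S"
  using tr_cross[of S T] by (simp add: ip_def)

lemma ip_nonneg: "T \<in> N \<Longrightarrow> 0 \<le> ip T T" by (simp add: ip_def tr_sq)

lemma ip_add: "R \<in> N \<Longrightarrow> S \<in> N \<Longrightarrow> T \<in> N \<Longrightarrow> ip (R + S) T = ip R T + ip S T"
  "R \<in> N \<Longrightarrow> S \<in> N \<Longrightarrow> T \<in> N \<Longrightarrow> ip T (R + S) = ip T R + ip T S"
  by (simp_all add: ip_def adj_simps blinfun_compose_simps tr_add)

lemma ip_scaleR: "S \<in> N \<Longrightarrow> T \<in> N \<Longrightarrow> ip (r *\<^sub>R S) T = r * ip S T" "S \<in> N \<Longrightarrow> T \<in> N \<Longrightarrow> ip S (r *\<^sub>R T) = r * ip S T"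
  by (simp_all add: ip_def adj_simps blinfun_compose_simps tr_scaleR)

lemma n2_sq: "T \<in> N \<Longrightarrow> (n2 T)\<^sup>2 = ip T T" by (simp add: n2_def ip_nonneg)

lemma n2_nonneg [simp]: "T \<in> N \<Longrightarrow> 0 \<le> n2 T" by (simp add: n2_def ip_nonneg)

lemma ip_cauchy_schwarz: assumes S: "S \<in> N" and T: "T \<in> N" shows "ip S T \<le> n2 S * n2 T"
proof -
  have "(ip S T)\<^sup>2 \<le> ip S S * ip T T"
  proof (rule discriminant_le)
    fix t
    have "0 \<le> ip (S + t *\<^sub>R T) (S + t *\<^sub>R T)" using S T by (intro ip_nonneg) auto
    thus "0 \<le> ip S S + 2 * t * ip S T + t\<^sup>2 * ip T T"
      using S T by (simp add: ip_add ip_scaleR ip_commute[of T S] power2_eq_square algebra_simps)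
  qed
  also have "\<dots> = (n2 S * n2 T)\<^sup>2" using S T by (simp add: power_mult_distrib n2_sq)
  finally have "(ip S T)\<^sup>2 \<le> (n2 S * n2 T)\<^sup>2" .
  thus ?thesis by (rule power2_le_imp_le) (use S T in simp)
qed

lemma n2_triangle: assumes S: "S \<in> N" and T: "T \<in> N" shows "n2 (S + T) \<le> n2 S + n2 T"
proof (rule power2_le_imp_le)
  have "(n2 (S + T))\<^sup>2 = (n2 S)\<^sup>2 + (n2 T)\<^sup>2 + 2 * ip S T"
    using S T by (simp add: n2_sq ip_add ip_commute[of T S])
  also have "\<dots> \<le> (n2 S + n2 T)\<^sup>2" using ip_cauchy_schwarz[OF S T] by (simp add: power2_sum)
  finally show "(n2 (S + T))\<^sup>2 \<le> (n2 S + n2 T)\<^sup>2" .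
qed (use S T in auto)

lemma n2_zero [simp]: "n2 0 = 0" by (simp add: n2_def ip_def)

lemma n2_scale: assumes T: "T \<in> N" shows "n2 (op_scale c T) = cmod c * n2 T"
proof -
  have "\<tau> (op_adjoint (op_scale c T) o\<^sub>L op_scale c T) = (cnj c * c) * \<tau> (op_adjoint T o\<^sub>L T)"
    using T by (simp add: adj_simps op_scale_compose tr_scale)
  also have "cnj c * c = complex_of_real ((cmod c)\<^sup>2)" by (simp add: complex_norm_square mult.commute del: of_real_power)
  finally show ?thesis by (simp add: n2_def ip_def real_sqrt_mult del: of_real_power)
qed

lemma n2_uminus: "T \<in> N \<Longrightarrow> n2 (- T) = n2 T"
  using n2_scale[of T "-1"] op_scale_of_real[of "-1" T] by simp

lemma n2_diff_commute: "S \<in> N \<Longrightarrow> T \<in> N \<Longrightarrow> n2 (S - T) = n2 (T - S)"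
  using n2_uminus[of "S - T"] by simp

lemma n2_diff_triangle: "R \<in> N \<Longrightarrow> S \<in> N \<Longrightarrow> T \<in> N \<Longrightarrow> n2 (R - T) \<le> n2 (R - S) + n2 (S - T)"
  using n2_triangle[of "R - S" "S - T"] by simp

lemma n2_eq_zero: assumes T: "T \<in> N" and "n2 T = 0" shows "T = 0"
proof -
  have "\<tau> (op_adjoint T o\<^sub>L T) = 0" using assms by (intro complex_eqI) (simp_all add: n2_def ip_def tr_sq)
  thus ?thesis using faithful T by (auto simp: faithful_on_def)
qed

lemma n2_adj: "T \<in> N \<Longrightarrow> n2 (op_adjoint T) = n2 T"
  by (simp add: n2_def ip_def adj_simps tr_comm)

text \<open>The axioms give positivity only on squares, and square roots are available only for 1 -
  h with |h| < 1. Hence T is shifted by \<epsilon> and scaled by 1 / (|T| + \<epsilon>), which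
  brings it into that form.\<close>

lemma tr_psd: assumes T: "T \<in> N" and psd: "psd_op T" shows "0 \<le> Re (\<tau> T)"
proof (rule field_le_epsilon)
  fix \<epsilon> :: real assume \<epsilon>: "\<epsilon> > 0"
  define c where "c = norm T + \<epsilon>"
  have c: "c > 0" "\<epsilon> \<le> c" using \<epsilon> by (auto simp: c_def add_nonneg_pos)
  define h where "h = id_blinfun - (1/c) *\<^sub>R (T + \<epsilon> *\<^sub>R id_blinfun)"
  have hN: "h \<in> N" using T by (auto simp: h_def)
  have sh: "sym_op h" unfolding h_def using psd_op_sym[OF psd] by (intro sym_op_intros)
  have ih: "inner (h x) x = (norm x)\<^sup>2 - (inner (T x) x + \<epsilon> * (norm x)\<^sup>2) / c" for x
    by (simp add: h_def blinfun.bilinear_simps inner_simps power2_norm_eq_inner)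
  have Tx: "inner (T x) x \<le> norm T * (norm x)\<^sup>2" for x
    using norm_cauchy_schwarz[of "T x" x] mult_right_mono[OF norm_blinfun[of T x], of "norm x"]
    by (simp add: power2_eq_square)
  have "psd_op h" unfolding psd_op_def
  proof (intro conjI sh allI)
    fix x
    have "inner (T x) x + \<epsilon> * (norm x)\<^sup>2 \<le> c * (norm x)\<^sup>2" using Tx[of x] by (simp add: c_def algebra_simps)
    thus "0 \<le> inner (h x) x" using c by (simp add: ih field_simps)
  qed
  moreover have "inner (h x) x \<le> (1 - \<epsilon> / c) * (norm x)\<^sup>2" for x
    using psd_op_inner[OF psd, of x] c by (simp add: ih field_simps)
  ultimately have "norm h \<le> 1 - \<epsilon> / c" using c by (intro psd_op_norm_le) auto
  hence "norm h < 1" using divide_pos_pos[OF \<epsilon> c(1)] by linarith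
  then obtain z where z: "z \<in> N" "op_adjoint z = z" "z o\<^sub>L z = id_blinfun - h"
    using sqrt_exists hN sh sym_op_iff by blast
  have "0 \<le> Re (\<tau> (id_blinfun - h))" using tr_sq(2)[OF z(1)] z by simp
  also have "id_blinfun - h = (1/c) *\<^sub>R (T + \<epsilon> *\<^sub>R id_blinfun)" by (simp add: h_def)
  also have "Re (\<tau> \<dots>) = (Re (\<tau> T) + \<epsilon>) / c" using T by (simp add: tr_scaleR tr_add)
  finally show "0 \<le> Re (\<tau> T) + \<epsilon>" using c by (simp add: zero_le_divide_iff)
qed

lemma psd_norm_diff: assumes x: "x \<in> N" shows "psd_op ((norm x)\<^sup>2 *\<^sub>R id_blinfun - (op_adjoint x o\<^sub>L x))"
proof -
  have "inner (((norm x)\<^sup>2 *\<^sub>R id_blinfun - (op_adjoint x o\<^sub>L x)) v) v = (norm x * norm v)\<^sup>2 - (norm (x v))\<^sup>2" for v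
    using inner_op_right[of x v "x v"] inner_op_left[of x v "x v"] x
    by (simp add: blinfun.bilinear_simps inner_simps power2_norm_eq_inner power_mult_distrib inner_commute)
  moreover have "(norm (x v))\<^sup>2 \<le> (norm x * norm v)\<^sup>2" for v by (intro power_mono norm_blinfun) auto
  moreover have "sym_op ((norm x)\<^sup>2 *\<^sub>R id_blinfun - (op_adjoint x o\<^sub>L x))"
    using psd_op_sym[OF psd_op_adj_compose[of x]] x by (intro sym_op_intros(2,4,5)) auto
  ultimately show ?thesis by (simp add: psd_op_def)
qed

text \<open>Conjugate the operator inequality between the square of \<open>x\<close> and its squared
  norm by \<open>y\<close> and take traces.\<close>

lemma n2_mult_left: assumes x: "x \<in> N" and y: "y \<in> N" shows "n2 (x o\<^sub>L y) \<le> norm x * n2 y"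
proof (rule power2_le_imp_le)
  have "0 \<le> Re (\<tau> (op_adjoint y o\<^sub>L ((norm x)\<^sup>2 *\<^sub>R id_blinfun - (op_adjoint x o\<^sub>L x)) o\<^sub>L y))"
    using x y by (intro tr_psd psd_op_conj psd_norm_diff) auto
  also have "op_adjoint y o\<^sub>L ((norm x)\<^sup>2 *\<^sub>R id_blinfun - (op_adjoint x o\<^sub>L x)) o\<^sub>L y
     = (norm x)\<^sup>2 *\<^sub>R (op_adjoint y o\<^sub>L y) - (op_adjoint (x o\<^sub>L y) o\<^sub>L (x o\<^sub>L y))"
    using x y by (simp add: adj_simps blinfun_compose_simps blinfun_assoc)
  finally show "(n2 (x o\<^sub>L y))\<^sup>2 \<le> (norm x * n2 y)\<^sup>2"
    using x y by (simp add: n2_sq power_mult_distrib ip_def tr_diff tr_scaleR)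
qed (use x y in auto)

lemma n2_mult_right: assumes x: "x \<in> N" and y: "y \<in> N" shows "n2 (x o\<^sub>L y) \<le> n2 x * norm y"
  using n2_mult_left[of "op_adjoint y" "op_adjoint x"] n2_adj[of "x o\<^sub>L y"] n2_adj[of x] norm_op_adjoint[of y] x y
  by (simp add: adj_simps mult.commute)

lemma n2_one [simp]: "n2 id_blinfun = 1" by (simp add: n2_def ip_def)

lemma n2_le_norm: "T \<in> N \<Longrightarrow> n2 T \<le> norm T" using n2_mult_left[of T id_blinfun] by simp

lemma tr_le_n2: assumes T: "T \<in> N" shows "cmod (\<tau> T) \<le> n2 T"
proof (cases "\<tau> T = 0")
  case False
  define c where "c = cnj (\<tau> T) / cmod (\<tau> T)"
  have "c * \<tau> T = complex_of_real (cmod (\<tau> T))"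
    using False by (simp add: c_def complex_norm_square[symmetric] mult.commute power2_eq_square)
  hence "cmod (\<tau> T) = ip id_blinfun (op_scale c T)" using T by (simp add: ip_def tr_scale)
  also have "\<dots> \<le> n2 id_blinfun * n2 (op_scale c T)" using T by (intro ip_cauchy_schwarz) auto
  also have "\<dots> = n2 T" using False T by (simp add: n2_scale c_def norm_divide)
  finally show ?thesis .
qed (use T in simp)

text \<open>Faithfulness is assumed only on squares. After scaling to 0 <= A <= 1 the operator A (1
  - A) is a product of commuting positive operators, so the trace of A^2 is at most that of A, which
  is 0.\<close>

lemma tr_psd_zero: assumes T: "T \<in> N" and psd: "psd_op T" and tr: "Re (\<tau> T) = 0" shows "T = 0"
proof (rule ccontr)
  assume "T \<noteq> 0"
  define r where "r = norm T"
  have r: "r > 0" using \<open>T \<noteq> 0\<close> by (simp add: r_def)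
  define A where "A = (1/r) *\<^sub>R T"
  have pA: "psd_op A" unfolding A_def using psd r by (intro psd_op_intros) auto
  have nA: "norm A = 1" using r by (simp add: A_def r_def)
  have "psd_op (id_blinfun - A)" unfolding psd_op_def
  proof (intro conjI allI sym_op_intros psd_op_sym[OF pA])
    fix x
    have "inner (A x) x \<le> norm (A x) * norm x" by (rule norm_cauchy_schwarz)
    also have "\<dots> \<le> norm x * norm x" using norm_blinfun[of A x] nA by (intro mult_right_mono) auto
    finally show "0 \<le> inner ((id_blinfun - A) x) x"
      by (simp add: blinfun.bilinear_simps inner_simps power2_norm_eq_inner[symmetric] power2_eq_square)
  qed
  hence "psd_op (A o\<^sub>L (id_blinfun - A))"
    using pA by (intro psd_op_compose_commuting) (auto simp: blinfun_compose_simps)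
  moreover have AN: "A \<in> N" using T by (auto simp: A_def)
  ultimately have "0 \<le> Re (\<tau> (A o\<^sub>L (id_blinfun - A)))" by (intro tr_psd) auto
  moreover have "op_adjoint A = A" using AN psd_op_sym[OF pA] sym_op_iff by blast
  ultimately have "ip A A \<le> Re (\<tau> A)" using AN by (simp add: blinfun_compose_simps tr_diff ip_def)
  also have "\<dots> = 0" using T tr by (simp add: A_def tr_scaleR)
  finally have "n2 A = 0" using ip_nonneg[OF AN] by (simp add: n2_def)
  hence "A = 0" using AN n2_eq_zero by blast
  thus False using nA by simp
qed

end

text \<open>A bounded monotone scalar sequence controls the increments. This is the source of strong
  convergence both for the polar decomposition and for the greedy sums in
  \<open>halving\<close>.\<close>

lemma Cauchy_if_increments:
  fixes a :: "nat \<Rightarrow> 'a::real_normed_vector" and g :: "nat \<Rightarrow> real"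
  assumes diff: "\<And>m n. n \<le> m \<Longrightarrow> (norm (a m - a n))\<^sup>2 \<le> g m - g n" and bd: "\<And>n. g n \<le> B"
  shows "Cauchy a"
proof -
  have mono: "g n \<le> g m" if "n \<le> m" for n m
    using diff[OF that] zero_le_power2[of "norm (a m - a n)"] by linarith
  hence "convergent g"
    using incseq_convergent[of g] bd by (metis convergent_def incseq_def)
  hence C: "Cauchy g" by (simp add: Cauchy_convergent_iff)
  show ?thesis
  proof (rule metric_CauchyI)
    fix e :: real assume e: "e > 0"
    then obtain M where M: "\<And>m n. m \<ge> M \<Longrightarrow> n \<ge> M \<Longrightarrow> dist (g m) (g n) < e\<^sup>2"
      using metric_CauchyD[OF C, of "e\<^sup>2"] by auto
    have less: "norm (a m - a n) < e" if "n \<le> m" "n \<ge> M" for n m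
    proof -
      have "g m - g n < e\<^sup>2" using M[of m n] that by (auto simp: dist_real_def)
      hence "(norm (a m - a n))\<^sup>2 < e\<^sup>2" using diff[OF that(1)] by linarith
      thus ?thesis using e by (auto intro: power2_less_imp_less)
    qed
    have "dist (a m) (a n) < e" if "m \<ge> M" "n \<ge> M" for m n
      using less[of n m] less[of m n] that by (cases "n \<le> m") (auto simp: dist_norm norm_minus_commute)
    thus "\<exists>M. \<forall>m\<ge>M. \<forall>n\<ge>M. dist (a m) (a n) < e" by blast
  qed
qed

section \<open>Polar decomposition\<close>

context vna
begin

text \<open>The Newton-Schulz iteration \<open>T \<mapsto> (3T - TT\<^sup>*T)/2\<close> moves all nonzero singular values in \<open>(0, 1]\<close> monotonically to
  \<open>1\<close>; its strong limit is the partial isometry of the polar decomposition.\<close>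

definition nit :: "'h op \<Rightarrow> nat \<Rightarrow> 'h op" where
  "nit T = rec_nat T (\<lambda>_ X. (1/2) *\<^sub>R (3 *\<^sub>R X - (X o\<^sub>L (op_adjoint X o\<^sub>L X))))"

lemma nit_0: "nit T 0 = T"
  and nit_Suc: "nit T (Suc n) = (1/2) *\<^sub>R (3 *\<^sub>R nit T n - (nit T n o\<^sub>L (op_adjoint (nit T n) o\<^sub>L nit T n)))"
  by (simp_all add: nit_def)

lemma nit_closed [simp]: "T \<in> N \<Longrightarrow> nit T n \<in> N"
  by (induction n) (auto simp: nit_0 nit_Suc)

lemma nit_adj: "T \<in> N \<Longrightarrow> op_adjoint (nit T n) = nit (op_adjoint T) n"
proof (induction n)
  case (Suc n)
  have "op_adjoint (op_adjoint (nit T n)) = nit T n" by (rule op_adjoint_adjoint) (use Suc in simp)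
  with Suc show ?case by (simp add: nit_Suc adj_simps blinfun_assoc)
qed (simp add: nit_0)

lemma nit_left: "A o\<^sub>L T = 0 \<Longrightarrow> A o\<^sub>L nit T n = 0"
  by (induction n) (simp_all add: nit_0 nit_Suc blinfun_compose_simps blinfun_assoc[symmetric])

lemma nit_right: "T o\<^sub>L A = 0 \<Longrightarrow> nit T n o\<^sub>L A = 0"
  by (induction n) (simp_all add: nit_0 nit_Suc blinfun_compose_simps blinfun_assoc)

lemma nit_psd:
  assumes T: "T \<in> N" and n1: "norm T \<le> 1"
  defines "t \<equiv> nit T"
  defines "h \<equiv> \<lambda>n. op_adjoint (t n) o\<^sub>L t n"
  shows "psd_op (h n)" and "psd_op (id_blinfun - h n)"
    and "psd_op (op_adjoint (t n) o\<^sub>L t (n + k))" and "psd_op ((op_adjoint (t n) o\<^sub>L t (n + k)) - h n)"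
proof -
  have tN: "t n \<in> N" for n using T by (simp add: t_def)
  have hN: "h n \<in> N" for n using tN by (auto simp: h_def)
  show ph: "psd_op (h n)" for n unfolding h_def using tN by (intro psd_op_adj_compose) auto
  define q where "q n = (1/2) *\<^sub>R (3 *\<^sub>R id_blinfun - h n)" for n
  have qN: "q n \<in> N" for n using hN by (auto simp: q_def)
  have qs: "sym_op (q n)" for n unfolding q_def using psd_op_sym[OF ph] by (intro sym_op_intros)
  have tS: "t (Suc n) = t n o\<^sub>L q n" for n
    unfolding t_def nit_Suc by (simp add: q_def h_def t_def blinfun_compose_simps)
  have hS: "h (Suc n) = q n o\<^sub>L h n o\<^sub>L q n" for n
    using tN qN qs sym_op_iff by (simp add: h_def tS adj_simps blinfun_assoc)
  show p1: "psd_op (id_blinfun - h n)" for n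
  proof (induction n)
    case 0
    have "0 \<le> inner ((id_blinfun - h 0) x) x" for x
    proof -
      have "inner ((h 0) x) x = (norm (T x))\<^sup>2"
        using inner_op_left[of T x "T x"] T
        by (simp add: h_def t_def nit_0 power2_norm_eq_inner inner_commute)
      also have "\<dots> \<le> (norm x)\<^sup>2"
        using norm_blinfun[of T x] mult_right_mono[OF n1, of "norm x"] by (intro power_mono) auto
      finally show ?thesis by (simp add: blinfun.bilinear_simps inner_simps power2_norm_eq_inner)
    qed
    thus ?case using psd_op_sym[OF ph] by (auto simp: psd_op_def intro!: sym_op_intros)
  next
    case (Suc n)
    let ?g = "id_blinfun - h n"
    let ?k = "3 *\<^sub>R id_blinfun - h n"
    have three: "3 *\<^sub>R X = X + X + X" and four: "4 *\<^sub>R X = X + X + X + X" for X :: "'h op"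
      using scaleR_left_distrib[of 2 1 X] scaleR_left_distrib[of 2 2 X] by (simp_all add: scaleR_2)
    \<comment> \<open>In one variable the new h is h (3 - h)^2 / 4; with g = 1 - h, four times its
      distance to 1 is g (3 + g) g, which is positive.\<close>
    have "h (Suc n) = (1/4) *\<^sub>R (?k o\<^sub>L h n o\<^sub>L ?k)"
      unfolding hS q_def by (simp add: bounded_bilinear.scaleR_left[OF bounded_bilinear_blinfun_compose]
          bounded_bilinear.scaleR_right[OF bounded_bilinear_blinfun_compose])
    hence "4 *\<^sub>R (id_blinfun - h (Suc n)) = 4 *\<^sub>R id_blinfun - (?k o\<^sub>L h n o\<^sub>L ?k)"
      by (simp add: scaleR_right_diff_distrib)
    also have "\<dots> = ?g o\<^sub>L (3 *\<^sub>R id_blinfun + ?g) o\<^sub>L ?g"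
      unfolding three four by (simp add: blinfun_compose_simps blinfun_assoc algebra_simps)
    finally have "id_blinfun - h (Suc n) = (1/4) *\<^sub>R (?g o\<^sub>L (3 *\<^sub>R id_blinfun + ?g) o\<^sub>L ?g)"
      by (metis scaleR_scaleR scaleR_one divide_self_if times_divide_eq_left mult_1 zero_neq_numeral)
    thus ?case using Suc psd_op_sym[OF Suc] psd_op_intros(2) by (simp only:) (intro psd_op_intros(3,4,5); simp add: psd_op_intros)
  qed
  \<comment> \<open>The double commutant of \<open>h 0\<close>: closed under the iteration and
    commutative, so that all operators below commute without being written as polynomials in
    \<open>h 0\<close>.\<close>
  define CC where "CC = {X. \<forall>S. S o\<^sub>L h 0 = h 0 o\<^sub>L S \<longrightarrow> S o\<^sub>L X = X o\<^sub>L S}"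
  have CC0: "h 0 \<in> CC" and CC1: "id_blinfun \<in> CC" by (auto simp: CC_def)
  have CCd: "X \<in> CC \<Longrightarrow> Y \<in> CC \<Longrightarrow> X - Y \<in> CC" for X Y by (auto simp: CC_def blinfun_compose_simps)
  have CCs: "X \<in> CC \<Longrightarrow> r *\<^sub>R X \<in> CC" for X r by (auto simp: CC_def blinfun_compose_simps)
  have CCm: "X o\<^sub>L Y \<in> CC" if X: "X \<in> CC" and Y: "Y \<in> CC" for X Y
    unfolding CC_def
  proof (clarify)
    fix S assume "S o\<^sub>L h 0 = h 0 o\<^sub>L S"
    hence "S o\<^sub>L X = X o\<^sub>L S" "S o\<^sub>L Y = Y o\<^sub>L S" using X Y by (auto simp: CC_def)
    thus "S o\<^sub>L (X o\<^sub>L Y) = X o\<^sub>L Y o\<^sub>L S" by (metis blinfun_assoc)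
  qed
  have CCc: "X o\<^sub>L Y = Y o\<^sub>L X" if X: "X \<in> CC" and Y: "Y \<in> CC" for X Y
  proof -
    have "h 0 o\<^sub>L X = X o\<^sub>L h 0" using X unfolding CC_def by blast
    from this[symmetric] show ?thesis using Y unfolding CC_def by blast
  qed
  have hC: "h n \<in> CC" and qC: "q n \<in> CC" for n
  proof -
    have qh: "h n \<in> CC \<Longrightarrow> q n \<in> CC" for n unfolding q_def by (intro CCs CCd CC1)
    show "h n \<in> CC" by (induction n) (auto simp: hS CC0 intro!: CCm qh)
    thus "q n \<in> CC" by (rule qh)
  qed
  \<comment> \<open>Since q m = 1 + (1 - h m) / 2, each step adds to \<open>D n m\<close> half a
    product of commuting positive operators; so \<open>D n m\<close> grows with m from its initial
    value \<open>h n\<close>.\<close>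
  define D where "D n m = op_adjoint (t n) o\<^sub>L t m" for n m
  have DS: "D n (Suc m) = D n m o\<^sub>L q m" for n m by (simp add: D_def tS blinfun_assoc)
  have main: "psd_op (D n (n + k)) \<and> psd_op (D n (n + k) - h n) \<and> D n (n + k) \<in> CC"
  proof (induction k)
    case 0
    have "D n (n + 0) = h n" by (simp add: D_def h_def)
    thus ?case using ph hC psd_op_intros(1) by simp
  next
    case (Suc k)
    let ?D = "D n (n + k)" and ?g = "id_blinfun - h (n + k)"
    have gC: "?g \<in> CC" by (intro CCd CC1 hC)
    have "psd_op (?g o\<^sub>L ?D)"
      using Suc p1 ph gC CCc by (intro psd_op_compose_commuting) auto
    hence p: "psd_op ((1/2) *\<^sub>R (?g o\<^sub>L ?D))" by (intro psd_op_intros) auto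
    have "?D o\<^sub>L q (n + k) = ?D + (1/2) *\<^sub>R (?D o\<^sub>L ?g)"
      using scaleR_left_distrib[of 1 "1/2" ?D] by (simp add: q_def blinfun_compose_simps algebra_simps)
    moreover have "?g o\<^sub>L ?D = ?D o\<^sub>L ?g" using CCc[OF gC, of ?D] Suc by blast
    moreover have "D n (n + Suc k) = ?D o\<^sub>L q (n + k)" by (simp add: DS)
    ultimately have e: "D n (n + Suc k) = ?D + (1/2) *\<^sub>R (?g o\<^sub>L ?D)" by metis
    have "D n (n + Suc k) - h n = (?D - h n) + (1/2) *\<^sub>R (?g o\<^sub>L ?D)" unfolding e by simp
    moreover have "D n (n + Suc k) \<in> CC" using Suc qC by (auto simp: DS intro!: CCm)
    ultimately show ?case using p Suc psd_op_intros(3) e by metis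
  qed
  show "psd_op (op_adjoint (t n) o\<^sub>L t (n + k))" "psd_op ((op_adjoint (t n) o\<^sub>L t (n + k)) - h n)"
    using main by (simp_all add: D_def)
qed

text \<open>The inner product of \<open>t n x\<close> with a later \<open>t m x\<close> is at least
  |t n x|^2, so the squared increment is at most |t m x|^2 - |t n x|^2, and these norms are bounded
  by |x|. Their monotonicity is also what keeps the kernel of the limit inside that of T.\<close>

lemma nit_convergent:
  assumes T: "T \<in> N" and n1: "norm T \<le> 1"
  shows "norm (nit T n) \<le> 1" and "\<exists>W\<in>N. \<forall>x. (\<lambda>n. (nit T n) x) \<longlonglongrightarrow> W x"
    and "norm (T x) \<le> norm ((nit T n) x)"
proof -
  note psd = nit_psd[OF T n1]
  let ?t = "nit T"
  have in_t: "inner ((op_adjoint (?t n) o\<^sub>L ?t m) x) x = inner (?t n x) (?t m x)" for n m x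
    using inner_op_left[of "?t n" x "?t m x"] T by (simp add: inner_commute)
  have le1: "norm (?t n x) \<le> norm x" for n x
  proof (rule power2_le_imp_le)
    show "(norm (?t n x))\<^sup>2 \<le> (norm x)\<^sup>2"
      using psd_op_inner[OF psd(2), of n x] in_t[of n n x]
      by (simp add: blinfun.bilinear_simps inner_simps power2_norm_eq_inner)
  qed simp
  show bd: "norm (?t n) \<le> 1" for n using le1 by (intro norm_blinfun_bound) auto
  define g where "g n x = (norm (?t n x))\<^sup>2" for n x
  have diff: "(norm (?t m x - (?t n) x))\<^sup>2 \<le> g m x - g n x" if "n \<le> m" for n m x
  proof -
    have "g n x \<le> inner (?t n x) (?t m x)"
      using psd_op_inner[OF psd(4), of n "m - n" x] in_t[of n "n" x] in_t[of n m x] that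
      by (simp add: g_def blinfun.bilinear_simps inner_simps power2_norm_eq_inner)
    thus ?thesis by (simp add: g_def power2_norm_eq_inner inner_simps inner_commute)
  qed
  have mono: "g n x \<le> g m x" if "n \<le> m" for n m x
    using diff[OF that, of x] zero_le_power2[of "norm (?t m x - (?t n) x)"] by linarith
  show "norm (T x) \<le> norm (?t n x)"
    using mono[of 0 n x] by (auto simp: g_def nit_0 intro: power2_le_imp_le)
  have "Cauchy (\<lambda>n. ?t n x)" for x
  proof (rule Cauchy_if_increments)
    show "(norm (?t m x - (?t n) x))\<^sup>2 \<le> g m x - g n x" if "n \<le> m" for m n
      using that by (rule diff)
    show "g n x \<le> (norm x)\<^sup>2" for n using le1[of n x] by (simp add: g_def power_mono)
  qed
  from strong_limit_exists[OF bd this] obtain W :: "'h op" where "\<And>x. (\<lambda>n. ?t n x) \<longlonglongrightarrow> W x" by blast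
  thus "\<exists>W\<in>N. \<forall>x. (\<lambda>n. ?t n x) \<longlonglongrightarrow> W x"
    using strong_limit[of ?t W] T by auto
qed

text \<open>Taking adjoints is not strongly continuous, so convergence of the adjoints is a separate
  hypothesis; for the polar decomposition it comes from running the iteration on the adjoint of
  T.\<close>

lemma adjoint_strong_limit:
  fixes t :: "nat \<Rightarrow> 'h op" and W V :: "'h op"
  assumes "\<And>n. t n \<in> N" "W \<in> N" "V \<in> N"
    and W: "\<And>x. (\<lambda>n. t n x) \<longlonglongrightarrow> W x"
    and V: "\<And>x. (\<lambda>n. (op_adjoint (t n)) x) \<longlonglongrightarrow> V x"
  shows "op_adjoint W = V"
proof (rule op_adjoint_eqI)
  fix x y
  have "(\<lambda>n. inner (t n x) y) \<longlonglongrightarrow> inner (W x) y" by (intro tendsto_intros W)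
  moreover have "(\<lambda>n. inner x ((op_adjoint (t n)) y)) \<longlonglongrightarrow> inner x (V y)" by (intro tendsto_intros V)
  ultimately show "inner (W x) y = inner x (V y)"
    using assms LIMSEQ_unique by (simp add: inner_op_left)
qed (use assms in auto)

text \<open>The annihilator clauses stand in for statements about range and kernel: they keep W in
  every corner that contains T and let it inherit T^2 = 0. The positive operator in the third clause
  is |T|.\<close>

lemma polar_decomposition:
  assumes T: "T \<in> N" and n1: "norm T \<le> 1"
  shows "\<exists>W\<in>N. W o\<^sub>L op_adjoint W o\<^sub>L W = W \<and> T o\<^sub>L op_adjoint W o\<^sub>L W = T \<and> psd_op (op_adjoint T o\<^sub>L W) \<and>
    (\<forall>A :: 'h op. A o\<^sub>L T = 0 \<longrightarrow> A o\<^sub>L W = 0) \<and> (\<forall>A :: 'h op. T o\<^sub>L A = 0 \<longrightarrow> W o\<^sub>L A = 0) \<and> (op_adjoint T = T \<longrightarrow> op_adjoint W = W)"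
proof -
  let ?t = "nit T"
  obtain W :: "'h op" where W: "W \<in> N" "\<And>x. (\<lambda>n. ?t n x) \<longlonglongrightarrow> W x"
    using nit_convergent(2)[OF T n1] by blast
  have n1': "norm (op_adjoint T) \<le> 1" using T n1 by (simp add: norm_op_adjoint)
  obtain V :: "'h op" where V: "V \<in> N" "\<And>x. (\<lambda>n. (nit (op_adjoint T) n) x) \<longlonglongrightarrow> V x"
    using nit_convergent(2)[OF adj[OF T] n1'] by blast
  have VW: "op_adjoint W = V" using adjoint_strong_limit[of ?t W V] T W V by (simp add: nit_adj)
  note bd = nit_convergent(1)[OF T n1] and bd' = nit_convergent(1)[OF adj[OF T] n1']
  have h: "(\<lambda>n. (op_adjoint (?t n)) (?t n x)) \<longlonglongrightarrow> (op_adjoint W o\<^sub>L W) x" for x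
    using strong_limit_compose[OF bd' V(2) W(2)] T by (simp add: nit_adj VW)
  have th: "(\<lambda>n. ?t n ((op_adjoint (?t n) o\<^sub>L ?t n) x)) \<longlonglongrightarrow> W ((op_adjoint W o\<^sub>L W) x)" for x
    using strong_limit_compose[OF bd W(2), of "\<lambda>n. op_adjoint (?t n) o\<^sub>L ?t n" "op_adjoint W o\<^sub>L W"] h by simp
  have WWW: "W o\<^sub>L op_adjoint W o\<^sub>L W = W"
  proof (rule blinfun_eqI)
    fix x
    have "(\<lambda>n. (?t (Suc n)) x) \<longlonglongrightarrow> W x" using W(2) LIMSEQ_Suc by blast
    moreover have "(\<lambda>n. (1/2) *\<^sub>R (3 *\<^sub>R (?t n) x - (?t n) ((op_adjoint (?t n) o\<^sub>L ?t n) x)))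
      \<longlonglongrightarrow> (1/2) *\<^sub>R (3 *\<^sub>R W x - W ((op_adjoint W o\<^sub>L W) x))"
      by (intro tendsto_intros W(2) th)
    ultimately have "W x = (1/2) *\<^sub>R (3 *\<^sub>R W x - W ((op_adjoint W o\<^sub>L W) x))"
      using LIMSEQ_unique by (simp add: nit_Suc blinfun.bilinear_simps) blast
    hence "2 *\<^sub>R W x = 3 *\<^sub>R W x - W ((op_adjoint W o\<^sub>L W) x)"
      by (metis scaleR_half_double scaleR_2 scaleR_right_distrib scaleR_left_distrib)
    moreover have "3 *\<^sub>R W x = 2 *\<^sub>R W x + W x"
      by (simp add: scaleR_left_distrib[of 2 1, simplified])
    ultimately show "(W o\<^sub>L op_adjoint W o\<^sub>L W) x = W x" by simp
  qed
  have "T o\<^sub>L op_adjoint W o\<^sub>L W = T"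
  proof (rule blinfun_eqI)
    fix x
    \<comment> \<open>The component of x in the kernel of W; there T vanishes too, because |T y| <=
      |W y|.\<close>
    define y where "y = x - (op_adjoint W) (W x)"
    have "W y = 0" using WWW by (simp add: y_def blinfun.bilinear_simps) (metis blinfun_apply_blinfun_compose)
    moreover have "norm (T y) \<le> norm (W y)"
      by (rule LIMSEQ_le_const[OF tendsto_norm[OF W(2)]]) (use nit_convergent(3)[OF T n1] in blast)
    ultimately have "T y = 0" by simp
    thus "(T o\<^sub>L op_adjoint W o\<^sub>L W) x = T x" by (simp add: y_def blinfun.bilinear_simps)
  qed
  moreover have "psd_op (op_adjoint T o\<^sub>L W)"
  proof -
    have D: "psd_op (op_adjoint T o\<^sub>L ?t n)" for n using nit_psd(3)[OF T n1, of 0 n] by (simp add: nit_0)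
    have lim: "(\<lambda>n. inner ((op_adjoint T o\<^sub>L ?t n) x) y) \<longlonglongrightarrow> inner ((op_adjoint T o\<^sub>L W) x) y" for x y
      by (simp, intro tendsto_intros blinfun.tendsto W(2))
    have lim': "(\<lambda>n. inner x ((op_adjoint T o\<^sub>L ?t n) y)) \<longlonglongrightarrow> inner x ((op_adjoint T o\<^sub>L W) y)" for x y
      by (simp, intro tendsto_intros blinfun.tendsto W(2))
    have "inner ((op_adjoint T o\<^sub>L W) x) y = inner x ((op_adjoint T o\<^sub>L W) y)" for x y
      using LIMSEQ_unique[OF lim[of x y]] lim'[of x y] sym_opD[OF psd_op_sym[OF D]] by simp
    moreover have "0 \<le> inner ((op_adjoint T o\<^sub>L W) x) x" for x
      by (rule LIMSEQ_le_const[OF lim]) (use psd_op_inner[OF D] in blast)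
    ultimately show ?thesis by (simp add: psd_op_def sym_op_def)
  qed
  moreover have "A o\<^sub>L W = 0" if "A o\<^sub>L T = 0" for A :: "'h op"
  proof (rule blinfun_eqI)
    fix x
    have "A (?t n x) = 0" for n
      using nit_left[OF that, of n] by (metis blinfun_apply_blinfun_compose blinfun.zero_left)
    moreover have "(\<lambda>n. A (?t n x)) \<longlonglongrightarrow> A (W x)"
      by (intro blinfun.tendsto tendsto_const W(2))
    ultimately show "(A o\<^sub>L W) x = blinfun_apply 0 x" by (simp add: LIMSEQ_const_iff)
  qed
  moreover have "W o\<^sub>L A = 0" if "T o\<^sub>L A = 0" for A :: "'h op"
  proof (rule blinfun_eqI)
    fix x
    have "?t n (A x) = 0" for n
      using nit_right[OF that, of n] by (metis blinfun_apply_blinfun_compose blinfun.zero_left)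
    with W(2)[of "A x"] show "(W o\<^sub>L A) x = blinfun_apply 0 x" by (simp add: LIMSEQ_const_iff)
  qed
  moreover have "op_adjoint W = W" if "op_adjoint T = T"
  proof -
    have "V = W" by (rule blinfun_eqI, rule LIMSEQ_unique[OF V(2)[unfolded that] W(2)])
    thus ?thesis using VW by simp
  qed
  ultimately show ?thesis using W(1) WWW by blast
qed

end

section \<open>Matrix units in algebras of type \<open>II\<^sub>1\<close>\<close>

lemma scaleC_minus_left: "(- c) *\<^sub>C x = - (c *\<^sub>C (x::'h::complex_hilbert_space))"
proof -
  have "(- c) *\<^sub>C x + c *\<^sub>C x = 0" using scaleC_add_left[of "- c" c x] scaleC_of_real[of 0 x] by simp
  thus ?thesis by (simp add: eq_neg_iff_add_eq_0)
qed

lemma op_scale_diff: "op_scale c (S - T) = op_scale c S - op_scale c (T :: 'h::complex_hilbert_space op)"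
  and op_scale_minus_left: "op_scale (- c) T = - op_scale c T"
  by (rule blinfun_eqI, simp add: blinfun.bilinear_simps scaleC_minus_left)+

context vna
begin

section \<open>Corners and nilpotent partial isometries\<close>

definition corner :: "'h op \<Rightarrow> 'h op set" where
  "corner p = {x \<in> N. p o\<^sub>L x = x \<and> x o\<^sub>L p = x}"

lemma projectionsD:
  "p \<in> projections N \<Longrightarrow> p \<in> N" "p \<in> projections N \<Longrightarrow> op_adjoint p = p" "p \<in> projections N \<Longrightarrow> p o\<^sub>L p = p"
  by (auto simp: projections_def)

lemma projection_compose: "p \<in> projections N \<Longrightarrow> p o\<^sub>L (p o\<^sub>L x) = p o\<^sub>L x"
  by (simp add: projectionsD flip: blinfun_assoc)

lemma cornerI: "x \<in> N \<Longrightarrow> p o\<^sub>L x = x \<Longrightarrow> x o\<^sub>L p = x \<Longrightarrow> x \<in> corner p" by (simp add: corner_def)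

lemma cornerD: "x \<in> corner p \<Longrightarrow> x \<in> N" "x \<in> corner p \<Longrightarrow> p o\<^sub>L x = x" "x \<in> corner p \<Longrightarrow> x o\<^sub>L p = x"
  by (auto simp: corner_def)

lemma corner_closed:
  "x \<in> corner p \<Longrightarrow> y \<in> corner p \<Longrightarrow> x + y \<in> corner p" "x \<in> corner p \<Longrightarrow> y \<in> corner p \<Longrightarrow> x - y \<in> corner p"
  "x \<in> corner p \<Longrightarrow> r *\<^sub>R x \<in> corner p" "p \<in> N \<Longrightarrow> x \<in> corner p \<Longrightarrow> op_scale c x \<in> corner p"
  "x \<in> corner p \<Longrightarrow> y \<in> corner p \<Longrightarrow> x o\<^sub>L y \<in> corner p"
  "p \<in> projections N \<Longrightarrow> x \<in> corner p \<Longrightarrow> op_adjoint x \<in> corner p"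
  "p \<in> projections N \<Longrightarrow> p \<in> corner p"
proof -
  show "x o\<^sub>L y \<in> corner p" if "x \<in> corner p" "y \<in> corner p"
    using that by (auto simp: corner_def blinfun_assoc) (metis blinfun_assoc)
  show "op_adjoint x \<in> corner p" if p: "p \<in> projections N" and x: "x \<in> corner p"
  proof (rule cornerI)
    show "op_adjoint x \<in> N" using x by (simp add: corner_def)
    have "op_adjoint (x o\<^sub>L p) = p o\<^sub>L op_adjoint x" "op_adjoint (p o\<^sub>L x) = op_adjoint x o\<^sub>L p"
      using p x by (simp_all add: adj_simps projectionsD cornerD(1))
    thus "p o\<^sub>L op_adjoint x = op_adjoint x" "op_adjoint x o\<^sub>L p = op_adjoint x"
      using x by (simp_all add: cornerD)
  qed
qed (auto simp: corner_def blinfun_compose_simps op_scale_compose projectionsD)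

lemma corner_trans: "q \<in> corner p \<Longrightarrow> x \<in> corner q \<Longrightarrow> x \<in> corner p"
  unfolding corner_def by (auto simp: blinfun_assoc[symmetric]) (metis blinfun_assoc)+

text \<open>Real and imaginary parts of \<open>y\<close> again lie in the corner, since it is closed
  under adjoints and complex scalars.\<close>

lemma commute_corner_if_self_adjoint:
  assumes p: "p \<in> projections N" and z: "z \<in> N" and y: "y \<in> corner p"
    and sa: "\<And>b. b \<in> corner p \<Longrightarrow> op_adjoint b = b \<Longrightarrow> z o\<^sub>L b = b o\<^sub>L z"
  shows "z o\<^sub>L y = y o\<^sub>L z"
proof -
  note pN = projectionsD(1)[OF p] note yN = cornerD(1)[OF y]
  define b1 where "b1 = op_scale (1/2) (y + op_adjoint y)"
  define b2 where "b2 = op_scale (- \<i> / 2) (y - op_adjoint y)"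
  have b: "b1 \<in> corner p" "b2 \<in> corner p" using p pN y by (auto simp: b1_def b2_def intro!: corner_closed)
  have "op_adjoint b1 = b1" "op_adjoint b2 = b2"
    using yN by (simp_all add: b1_def b2_def adj_simps add.commute) (simp add: op_scale_diff op_scale_minus_left)
  moreover have "y = b1 + op_scale \<i> b2"
  proof -
    have "b1 + op_scale \<i> b2 = op_scale (1/2) y + op_scale (1/2) y"
      by (simp add: b1_def b2_def op_scale_compose(3,5) op_scale_diff)
    also have "\<dots> = y" by (simp add: op_scale_compose(4) flip: op_scale_compose(6))
    finally show ?thesis by simp
  qed
  ultimately show ?thesis using sa[of b1] sa[of b2] b z
    by (simp add: blinfun_compose_simps op_scale_compose)
qed

text \<open>For a partial isometry, v^2 = 0 says that the initial and final projections are
  orthogonal. Such a v is the off-diagonal unit of a copy of the 2 x 2 matrices inside the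
  corner.\<close>

definition nil_pi :: "'h op \<Rightarrow> 'h op set" where
  "nil_pi p = {v \<in> corner p. v o\<^sub>L op_adjoint v o\<^sub>L v = v \<and> v o\<^sub>L v = 0}"

lemma polar_scaled:
  assumes T: "T \<in> N"
  obtains W r where "W \<in> N" "r > 0" "W o\<^sub>L op_adjoint W o\<^sub>L W = W" "T o\<^sub>L op_adjoint W o\<^sub>L W = T" "psd_op (r *\<^sub>R (op_adjoint T o\<^sub>L W))"
    "\<And>A :: 'h op. A o\<^sub>L T = 0 \<Longrightarrow> A o\<^sub>L W = 0" "\<And>A :: 'h op. T o\<^sub>L A = 0 \<Longrightarrow> W o\<^sub>L A = 0" "op_adjoint T = T \<Longrightarrow> op_adjoint W = W"
proof -
  define r where "r = 1 / (1 + norm T)"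
  have r: "r > 0" by (simp add: r_def add_pos_nonneg)
  have "norm (r *\<^sub>R T) \<le> 1" by (simp add: r_def field_simps add_pos_nonneg)
  from polar_decomposition[OF scaleR[OF T] this] obtain W where W:
    "W \<in> N" "W o\<^sub>L op_adjoint W o\<^sub>L W = W" "(r *\<^sub>R T) o\<^sub>L op_adjoint W o\<^sub>L W = r *\<^sub>R T"
    "psd_op (op_adjoint (r *\<^sub>R T) o\<^sub>L W)" "\<forall>A :: 'h op. A o\<^sub>L (r *\<^sub>R T) = 0 \<longrightarrow> A o\<^sub>L W = 0"
    "\<forall>A :: 'h op. (r *\<^sub>R T) o\<^sub>L A = 0 \<longrightarrow> W o\<^sub>L A = 0" "op_adjoint (r *\<^sub>R T) = r *\<^sub>R T \<longrightarrow> op_adjoint W = W" by (elim bexE conjE) (rule that)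
  show thesis
  proof (rule that[OF W(1) r W(2)])
    show "T o\<^sub>L op_adjoint W o\<^sub>L W = T" using W(3) r by (simp add: blinfun_compose_simps)
    show "psd_op (r *\<^sub>R (op_adjoint T o\<^sub>L W))" using W(4) T by (simp add: adj_simps blinfun_compose_simps)
    show "A o\<^sub>L W = 0" if "A o\<^sub>L T = 0" for A :: "'h op" using W(5) that by (simp add: blinfun_compose_simps)
    show "W o\<^sub>L A = 0" if "T o\<^sub>L A = 0" for A :: "'h op" using W(6) that by (simp add: blinfun_compose_simps)
    show "op_adjoint W = W" if "op_adjoint T = T" using W(7) that T by (simp add: adj_simps)
  qed
qed

text \<open>The partial isometry W of x inherits nilpotency: x x = 0 gives W x = 0 by one
  annihilator clause, then W W = 0 by the other. Applied to 1 - p, the same clauses keep W in the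
  corner.\<close>

lemma nil_pi_exists:
  assumes p: "p \<in> projections N" and x: "x \<in> corner p" "x o\<^sub>L x = 0" "x \<noteq> 0"
  shows "\<exists>v\<in>nil_pi p. v \<noteq> 0"
proof -
  note xN = cornerD(1)[OF x(1)]
  obtain W r where W: "W \<in> N" "W o\<^sub>L op_adjoint W o\<^sub>L W = W" "x o\<^sub>L op_adjoint W o\<^sub>L W = x"
    and l: "\<And>A :: 'h op. A o\<^sub>L x = 0 \<Longrightarrow> A o\<^sub>L W = 0" and r: "\<And>A :: 'h op. x o\<^sub>L A = 0 \<Longrightarrow> W o\<^sub>L A = 0"
    by (rule polar_scaled[OF xN]) auto
  have "W o\<^sub>L W = 0" using l[OF r[OF x(2)]] .
  moreover have "(id_blinfun - p) o\<^sub>L W = 0" "W o\<^sub>L (id_blinfun - p) = 0"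
    using x by (intro l r; simp add: blinfun_compose_simps cornerD)+
  hence "p o\<^sub>L W = W" "W o\<^sub>L p = W" by (simp_all add: blinfun_compose_simps)
  hence "W \<in> corner p" using W by (auto intro!: cornerI)
  moreover have "W \<noteq> 0" using W x by auto
  ultimately show ?thesis using W by (auto simp: nil_pi_def)
qed

lemma nil_piD:
  assumes v: "v \<in> nil_pi p" and p: "p \<in> projections N"
  shows "v \<in> N" "p o\<^sub>L v = v" "v o\<^sub>L p = v" "v o\<^sub>L v = 0" "v o\<^sub>L (op_adjoint v o\<^sub>L v) = v"
    "op_adjoint v \<in> N" "p o\<^sub>L op_adjoint v = op_adjoint v" "op_adjoint v o\<^sub>L p = op_adjoint v"
    "op_adjoint v o\<^sub>L op_adjoint v = 0" "op_adjoint v o\<^sub>L (v o\<^sub>L op_adjoint v) = op_adjoint v"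
    "op_adjoint v \<in> nil_pi p"
proof -
  show vN: "v \<in> N" "p o\<^sub>L v = v" "v o\<^sub>L p = v" "v o\<^sub>L v = 0" "v o\<^sub>L (op_adjoint v o\<^sub>L v) = v" "op_adjoint v \<in> N"
    using v by (auto simp: nil_pi_def corner_def blinfun_assoc)
  have c: "op_adjoint v \<in> corner p" using v p corner_closed(6) by (auto simp: nil_pi_def)
  thus "p o\<^sub>L op_adjoint v = op_adjoint v" "op_adjoint v o\<^sub>L p = op_adjoint v" by (auto simp: cornerD)
  have "op_adjoint (v o\<^sub>L v) = op_adjoint v o\<^sub>L op_adjoint v" "op_adjoint (v o\<^sub>L (op_adjoint v o\<^sub>L v)) = op_adjoint v o\<^sub>L (v o\<^sub>L op_adjoint v)"
    using vN(1) by (simp_all add: adj_simps blinfun_assoc)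
  from this[symmetric] show e: "op_adjoint v o\<^sub>L op_adjoint v = 0" "op_adjoint v o\<^sub>L (v o\<^sub>L op_adjoint v) = op_adjoint v"
    using vN(4,5) by simp_all
  show "op_adjoint v \<in> nil_pi p" using c e vN by (simp add: nil_pi_def adj_simps blinfun_assoc)
qed

lemma partial_isometry_norm_le:
  assumes v: "v \<in> N" "v o\<^sub>L (op_adjoint v o\<^sub>L v) = v"
  shows "norm v \<le> 1"
proof (rule norm_blinfun_bound)
  fix x
  let ?y = "(op_adjoint v) (v x)"
  have "v ?y = v x" using v(2) by (metis blinfun_apply_blinfun_compose)
  hence "(norm ?y)\<^sup>2 = inner (v x) (v x)"
    using inner_op_left[of v ?y "v x"] v by (simp add: power2_norm_eq_inner)
  also have e: "\<dots> = inner x ?y" using v by (simp add: inner_op_left)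
  finally have "(norm ?y)\<^sup>2 \<le> norm x * norm ?y" using norm_cauchy_schwarz[of x ?y] by simp
  hence "norm ?y \<le> norm x" by (cases "norm ?y = 0") (auto simp: power2_eq_square mult_le_cancel_right)
  hence "(norm (v x))\<^sup>2 \<le> norm x * norm x"
    using e norm_cauchy_schwarz[of x ?y] mult_left_mono[of "norm ?y" "norm x" "norm x"] by (simp add: power2_norm_eq_inner)
  thus "norm (v x) \<le> 1 * norm x" by (auto intro: power2_le_imp_le simp: power2_eq_square)
qed simp

definition rest :: "'h op \<Rightarrow> 'h op \<Rightarrow> 'h op" where
  "rest p v = p - (op_adjoint v o\<^sub>L v) - (v o\<^sub>L op_adjoint v)"

lemma rest:
  assumes p: "p \<in> projections N" and v: "v \<in> nil_pi p"
  shows "rest p v \<in> projections N" and "rest p v \<in> corner p"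
    and "rest p v o\<^sub>L v = 0" "v o\<^sub>L rest p v = 0" "op_adjoint v o\<^sub>L rest p v = 0" "rest p v o\<^sub>L op_adjoint v = 0"
proof -
  note vD = nil_piD[OF v p]
  have z: "v o\<^sub>L (v o\<^sub>L x) = 0" "op_adjoint v o\<^sub>L (op_adjoint v o\<^sub>L x) = 0" for x
    using vD by (simp_all add: blinfun_assoc[symmetric])
  show r: "rest p v o\<^sub>L v = 0" "v o\<^sub>L rest p v = 0" "op_adjoint v o\<^sub>L rest p v = 0" "rest p v o\<^sub>L op_adjoint v = 0"
    using vD z by (simp_all add: rest_def blinfun_compose_simps blinfun_assoc)
  show c: "rest p v \<in> corner p"
    unfolding rest_def using v p nil_piD(11)[OF v p] by (auto simp: nil_pi_def intro!: corner_closed)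
  have "rest p v o\<^sub>L rest p v = rest p v"
    using r cornerD[OF c] by (subst (2) rest_def) (simp add: blinfun_compose_simps flip: blinfun_assoc)
  moreover have "op_adjoint (rest p v) = rest p v"
    using vD projectionsD[OF p] by (simp add: rest_def adj_simps)
  ultimately show "rest p v \<in> projections N" using cornerD[OF c] by (simp add: projections_def)
qed

text \<open>All mixed products of \<open>v\<close>, \<open>w\<close> and their adjoints vanish
  because \<open>w\<close> lives under the remainder of \<open>v\<close>. This is one step of the
  greedy construction.\<close>

lemma nil_pi_extend:
  assumes p: "p \<in> projections N" and v: "v \<in> nil_pi p" and w: "w \<in> nil_pi (rest p v)"
  shows "v + w \<in> nil_pi p" and "op_adjoint (v + w) o\<^sub>L (v + w) = (op_adjoint v o\<^sub>L v) + (op_adjoint w o\<^sub>L w)"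
    and "rest p (v + w) = rest (rest p v) w"
proof -
  note vD = nil_piD[OF v p] note wD = nil_piD[OF w rest(1)[OF p v]]
  have z: "v o\<^sub>L w = 0" "op_adjoint v o\<^sub>L w = 0" "v o\<^sub>L op_adjoint w = 0" "op_adjoint v o\<^sub>L op_adjoint w = 0"
    "w o\<^sub>L v = 0" "w o\<^sub>L op_adjoint v = 0" "op_adjoint w o\<^sub>L v = 0" "op_adjoint w o\<^sub>L op_adjoint v = 0"
    using rest(3-6)[OF p v] wD
    by (metis (no_types) blinfun_assoc blinfun_compose_zero)+
  have a: "op_adjoint (v + w) = op_adjoint v + op_adjoint w" using vD wD by (simp add: adj_simps)
  show e1: "op_adjoint (v + w) o\<^sub>L (v + w) = (op_adjoint v o\<^sub>L v) + (op_adjoint w o\<^sub>L w)"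
    unfolding a using z by (simp add: blinfun_compose_simps)
  have e2: "(v + w) o\<^sub>L op_adjoint (v + w) = (v o\<^sub>L op_adjoint v) + (w o\<^sub>L op_adjoint w)"
    unfolding a using z by (simp add: blinfun_compose_simps)
  show "rest p (v + w) = rest (rest p v) w" unfolding rest_def e1 e2 by simp
  have "w \<in> corner p" using w corner_trans[OF rest(2)[OF p v]] by (auto simp: nil_pi_def)
  hence "v + w \<in> corner p" using v corner_closed(1) by (auto simp: nil_pi_def)
  moreover have "(v + w) o\<^sub>L op_adjoint (v + w) o\<^sub>L (v + w) = v + w"
  proof -
    have "v o\<^sub>L (op_adjoint w o\<^sub>L w) = 0" "w o\<^sub>L (op_adjoint v o\<^sub>L v) = 0" using z by (simp_all add: blinfun_assoc[symmetric])
    thus ?thesis unfolding blinfun_assoc e1 using vD wD by (simp add: blinfun_compose_simps)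
  qed
  moreover have "(v + w) o\<^sub>L (v + w) = 0" using z vD wD by (simp add: blinfun_compose_simps)
  ultimately show "v + w \<in> nil_pi p" by (simp add: nil_pi_def)
qed

end

section \<open>Halving projections\<close>

context tracial_vna
begin

text \<open>If \<open>pNp\<close> had no nilpotent element, every projection of \<open>pNp\<close> would be central in \<open>pNp\<close>, hence so would be
  the sign \<open>W\<close> of \<open>c = \<i>(ab - ba)\<close> for self-adjoint \<open>a\<close>, \<open>b\<close>; then \<open>\<tau>(|c|) = \<tau>(cW) = 0\<close>, so \<open>c = 0\<close>.\<close>

lemma nilpotent_exists:
  assumes p: "p \<in> projections N" and ST: "S \<in> corner p" "T \<in> corner p" "S o\<^sub>L T \<noteq> T o\<^sub>L S"
  shows "\<exists>x\<in>corner p. x o\<^sub>L x = 0 \<and> x \<noteq> 0"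
proof (rule ccontr)
  assume "\<not> ?thesis"
  hence no: "\<And>x. x \<in> corner p \<Longrightarrow> x o\<^sub>L x = 0 \<Longrightarrow> x = 0" by blast
  note pN = projectionsD(1)[OF p]
  have half: "e o\<^sub>L x = e o\<^sub>L (x o\<^sub>L e)" if e: "e \<in> projections N" "e \<in> corner p" and x: "x \<in> corner p" for e x
  proof -
    \<comment> \<open>This is e x (1 - e), which squares to 0.\<close>
    define y where "y = (e o\<^sub>L x) - (e o\<^sub>L (x o\<^sub>L e))"
    have "y \<in> corner p" unfolding y_def using e x by (intro corner_closed)
    moreover have "y o\<^sub>L y = 0"
      by (simp add: y_def blinfun_compose_simps blinfun_assoc projectionsD(3)[OF e(1)] projection_compose[OF e(1)])
    ultimately have "y = 0" by (rule no)
    thus ?thesis by (simp add: y_def)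
  qed
  have proj: "e o\<^sub>L x = x o\<^sub>L e" if e: "e \<in> projections N" "e \<in> corner p" and x: "x \<in> corner p" for e x
  proof -
    have "op_adjoint (e o\<^sub>L op_adjoint x) = op_adjoint (e o\<^sub>L (op_adjoint x o\<^sub>L e))"
      using half[OF e corner_closed(6)[OF p x]] by simp
    thus ?thesis using half[OF e x] projectionsD[OF e(1)] cornerD(1)[OF x] by (simp add: adj_simps blinfun_assoc)
  qed
  have sgn: "w o\<^sub>L x = x o\<^sub>L w" if w: "w \<in> corner p" "op_adjoint w = w" "w o\<^sub>L w o\<^sub>L w = w" and x: "x \<in> corner p" for w x
  proof -
    have w4: "w o\<^sub>L w o\<^sub>L (w o\<^sub>L w) = w o\<^sub>L w" using w(3) by (simp add: blinfun_assoc)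
    have w3: "w o\<^sub>L (w o\<^sub>L w) = w" using w(3) by (simp add: blinfun_assoc)
    \<comment> \<open>\<open>e1\<close> and \<open>e2\<close> are the spectral projections of
      \<open>w\<close> for the eigenvalues 1 and -1.\<close>
    define e1 where "e1 = (1/2) *\<^sub>R ((w o\<^sub>L w) + w)"
    define e2 where "e2 = (1/2) *\<^sub>R ((w o\<^sub>L w) - w)"
    have dbl: "X + X = 2 *\<^sub>R X" for X :: "'h op" by (simp add: scaleR_2)
    have "e1 \<in> corner p" "e2 \<in> corner p" unfolding e1_def e2_def using w by (intro corner_closed; simp)+
    moreover have "op_adjoint e1 = e1" "op_adjoint e2 = e2"
      using w cornerD(1)[OF w(1)] by (simp_all add: e1_def e2_def adj_simps)
    moreover have "e1 o\<^sub>L e1 = e1"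
    proof -
      have "((w o\<^sub>L w) + w) o\<^sub>L ((w o\<^sub>L w) + w) = 2 *\<^sub>R ((w o\<^sub>L w) + w)"
        using w w3 w4 by (simp add: blinfun_compose_simps blinfun_assoc scaleR_2)
      thus ?thesis by (simp add: e1_def blinfun_compose_simps(7,8))
    qed
    moreover have "e2 o\<^sub>L e2 = e2"
    proof -
      have "((w o\<^sub>L w) - w) o\<^sub>L ((w o\<^sub>L w) - w) = 2 *\<^sub>R ((w o\<^sub>L w) - w)"
        using w w3 w4 by (simp add: blinfun_compose_simps blinfun_assoc scaleR_2)
      thus ?thesis by (simp add: e2_def blinfun_compose_simps(7,8))
    qed
    ultimately have "e1 \<in> projections N" "e2 \<in> projections N" "e1 \<in> corner p" "e2 \<in> corner p"
      using cornerD(1) by (auto simp: projections_def)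
    hence c: "e1 o\<^sub>L x = x o\<^sub>L e1" "e2 o\<^sub>L x = x o\<^sub>L e2" using proj x by auto
    have "e1 - e2 = (1/2) *\<^sub>R (w + w)"
      unfolding e1_def e2_def scaleR_right_diff_distrib[symmetric] by simp
    hence "w = e1 - e2" by (simp add: dbl)
    thus ?thesis using c by (simp add: blinfun_compose_simps)
  qed
  have sa: "a o\<^sub>L b = b o\<^sub>L a" if a: "a \<in> corner p" "op_adjoint a = a" and b: "b \<in> corner p" "op_adjoint b = b" for a b
  proof -
    note aN = cornerD(1)[OF a(1)] note bN = cornerD(1)[OF b(1)]
    define c where "c = op_scale \<i> ((a o\<^sub>L b) - (b o\<^sub>L a))"
    have c: "c \<in> corner p" unfolding c_def using pN a b by (intro corner_closed)
    have cN: "c \<in> N" using cornerD(1)[OF c] .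
    have csa: "op_adjoint c = c" using a b aN bN by (simp add: c_def adj_simps op_scale_diff op_scale_minus_left)
    obtain W r where W: "W \<in> N" "r > 0" "W o\<^sub>L op_adjoint W o\<^sub>L W = W" "c o\<^sub>L op_adjoint W o\<^sub>L W = c" "psd_op (r *\<^sub>R (op_adjoint c o\<^sub>L W))"
      and l: "\<And>A :: 'h op. A o\<^sub>L c = 0 \<Longrightarrow> A o\<^sub>L W = 0" and rr: "\<And>A :: 'h op. c o\<^sub>L A = 0 \<Longrightarrow> W o\<^sub>L A = 0" and ws: "op_adjoint W = W"
      by (rule polar_scaled[OF cN]) (use csa in auto)
    have "(id_blinfun - p) o\<^sub>L W = 0" "W o\<^sub>L (id_blinfun - p) = 0"
      using c by (intro l rr; simp add: blinfun_compose_simps cornerD)+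
    hence "p o\<^sub>L W = W" "W o\<^sub>L p = W" by (simp_all add: blinfun_compose_simps)
    hence Wc: "W \<in> corner p" using W by (auto intro!: cornerI)
    have comm: "W o\<^sub>L x = x o\<^sub>L W" if "x \<in> corner p" for x using sgn[OF Wc ws _ that] W ws by simp
    have "\<tau> ((a o\<^sub>L b) o\<^sub>L W) = \<tau> (a o\<^sub>L (b o\<^sub>L W))" by (simp add: blinfun_assoc)
    also have "\<dots> = \<tau> (b o\<^sub>L W o\<^sub>L a)" using aN bN W by (intro tr_comm) auto
    also have "b o\<^sub>L W o\<^sub>L a = (b o\<^sub>L a) o\<^sub>L W" using comm[OF a(1)] by (simp add: blinfun_assoc)
    finally have "\<tau> (c o\<^sub>L W) = 0" using aN bN W
      by (simp add: c_def op_scale_compose blinfun_compose_simps tr_scale tr_diff)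
    hence "r *\<^sub>R (c o\<^sub>L W) = 0" using W cN csa by (intro tr_psd_zero) (auto simp: tr_scaleR)
    hence "c o\<^sub>L W = 0" using W by simp
    hence "c = 0" using W(4) ws by simp
    hence "op_scale (- \<i>) c = 0" by (intro blinfun_eqI) simp
    hence "(a o\<^sub>L b) - (b o\<^sub>L a) = 0" by (simp add: c_def op_scale_compose)
    thus ?thesis by simp
  qed
  have sa2: "a o\<^sub>L y = y o\<^sub>L a" if "a \<in> corner p" "op_adjoint a = a" "y \<in> corner p" for a y
    using commute_corner_if_self_adjoint[OF p cornerD(1)[OF that(1)] that(3)] sa that by blast
  have "T o\<^sub>L S = S o\<^sub>L T"
    using commute_corner_if_self_adjoint[OF p cornerD(1)[OF ST(2)] ST(1)] sa2 ST by metis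
  thus False using ST by simp
qed

lemma nil_pi_ip_le: "v \<in> nil_pi p \<Longrightarrow> p \<in> projections N \<Longrightarrow> ip v v \<le> 1"
proof -
  assume v: "v \<in> nil_pi p" and p: "p \<in> projections N"
  note vD = nil_piD[OF v p]
  have "n2 v \<le> 1" using n2_le_norm[of v] partial_isometry_norm_le[of v] vD by linarith
  hence "(n2 v)\<^sup>2 \<le> 1" using vD by (simp add: power_le_one)
  thus "ip v v \<le> 1" using vD by (simp add: n2_sq)
qed

lemma zero_nil_pi: "0 \<in> nil_pi p" by (simp add: nil_pi_def corner_def)

text \<open>The supremum of the traces need not be attained; the factor 2 makes room for an actual
  element when the supremum is positive, and 0 serves otherwise.\<close>

lemma nil_pi_almost_maximal:
  assumes q: "q \<in> projections N"
  shows "\<exists>w\<in>nil_pi q. \<forall>v\<in>nil_pi q. ip v v \<le> 2 * ip w w"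
proof -
  define A where "A = (\<lambda>v. ip v v) ` nil_pi q"
  have A: "A \<noteq> {}" "bdd_above A" using zero_nil_pi nil_pi_ip_le[OF _ q] by (auto simp: A_def intro!: bdd_aboveI[of _ 1])
  have up: "ip v v \<le> Sup A" if "v \<in> nil_pi q" for v using that A by (auto simp: A_def intro!: cSup_upper)
  show ?thesis
  proof (cases "Sup A \<le> 0")
    case True
    have "ip (0::'h op) 0 = 0" by (simp add: ip_def)
    thus ?thesis using True up zero_nil_pi by (intro bexI[of _ 0]) (auto intro: order_trans)
  next
    case False
    hence "Sup A / 2 < Sup A" by simp
    then obtain w where "w \<in> nil_pi q" "Sup A / 2 < ip w w" using less_cSupE[OF _ A(1)] unfolding A_def by (metis (mono_tags, lifting) imageE)
    thus ?thesis using up by (intro bexI[of _ w] ballI) fastforce+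
  qed
qed

text \<open>A maximal nilpotent partial isometry is built greedily as \<open>v = \<Sum>\<^sub>n w\<^sub>n\<close>: if \<open>v\<^sup>*v + vv\<^sup>* \<noteq> p\<close>, the remainder
  supports some \<open>u \<noteq> 0\<close> that competed at every stage, so \<open>\<tau>(w\<^sub>n\<^sup>*w\<^sub>n) \<ge> \<tau>(u\<^sup>*u)/2\<close> for all \<open>n\<close>.\<close>

lemma halving:
  assumes p: "p \<in> projections N"
    and ex: "\<And>q. q \<in> projections N \<Longrightarrow> q \<in> corner p \<Longrightarrow> q \<noteq> 0 \<Longrightarrow> \<exists>x\<in>corner q. x o\<^sub>L x = 0 \<and> x \<noteq> 0"
  shows "\<exists>v\<in>nil_pi p. rest p v = 0"
proof -
  define w where "w q = (SOME w. w \<in> nil_pi q \<and> (\<forall>v\<in>nil_pi q. ip v v \<le> 2 * ip w w))" for q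
  have w: "w q \<in> nil_pi q" "\<And>v. v \<in> nil_pi q \<Longrightarrow> ip v v \<le> 2 * ip (w q) (w q)" if "q \<in> projections N" for q
    using someI_ex[OF nil_pi_almost_maximal[OF that, unfolded Bex_def]] unfolding w_def[symmetric] by blast+
  define V where "V = rec_nat 0 (\<lambda>_ v. v + w (rest p v))"
  have V0: "V 0 = 0" and VS: "V (Suc n) = V n + w (rest p (V n))" for n by (simp_all add: V_def)
  have Vn: "V n \<in> nil_pi p" for n
    by (induction n) (auto simp: V0 VS zero_nil_pi intro!: nil_pi_extend(1)[OF p] w(1) rest(1)[OF p])
  define R where "R n = rest p (V n)" for n
  have Rn: "R n \<in> projections N" "R n \<in> corner p" for n using rest[OF p Vn] by (auto simp: R_def)
  have wR: "w (R n) \<in> nil_pi (R n)" for n using w(1) Rn by blast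
  have VS': "V (Suc n) = V n + w (R n)" for n by (simp add: VS R_def)
  have RS: "R (Suc n) = rest (R n) (w (R n))" for n
    using nil_pi_extend(3)[OF p Vn wR[of n, unfolded R_def]] by (simp add: R_def VS)
  note VD = nil_piD[OF Vn p] note wD = nil_piD[OF wR Rn(1)]
  have RR: "R n o\<^sub>L R (n + k) = R (n + k)" for n k
  proof (induction k)
    case 0 show ?case using projectionsD[OF Rn(1)] by simp
  next
    case (Suc k)
    have "R (n + k) o\<^sub>L R (n + Suc k) = R (n + Suc k)" using rest(2)[OF Rn(1) wR] RS cornerD by simp
    thus ?case using Suc by (metis blinfun_assoc)
  qed
  have vw: "op_adjoint (V n) o\<^sub>L w (R (n + k)) = 0" "V n o\<^sub>L op_adjoint (w (R (n + k))) = 0" for n k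
  proof -
    have z: "op_adjoint (V n) o\<^sub>L R n = 0" "V n o\<^sub>L R n = 0" using rest(4,5)[OF p Vn] by (auto simp: R_def)
    have "w (R (n + k)) = R n o\<^sub>L w (R (n + k))" "op_adjoint (w (R (n + k))) = R n o\<^sub>L op_adjoint (w (R (n + k)))"
      using wD(2,7)[of "n + k"] RR[of n k] by (metis blinfun_assoc)+
    thus "op_adjoint (V n) o\<^sub>L w (R (n + k)) = 0" "V n o\<^sub>L op_adjoint (w (R (n + k))) = 0"
      using z by (metis blinfun_assoc blinfun_compose_zero(1))+
  qed
  \<comment> \<open>Later summands lie under \<open>R n\<close>, hence are orthogonal to
    \<open>V n\<close> on both sides. This holds for the adjoints as well, so both sequences
    converge strongly.\<close>
  have VV: "op_adjoint (V n) o\<^sub>L V (n + k) = op_adjoint (V n) o\<^sub>L V n" "V n o\<^sub>L op_adjoint (V (n + k)) = V n o\<^sub>L op_adjoint (V n)" for n k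
    by (induction k) (simp_all add: VS' blinfun_compose_simps vw op_adjoint_add[OF bounded bounded] VD(1) wD(1))
  have bd: "norm (V n) \<le> 1" for n using partial_isometry_norm_le VD by blast
  have bd': "norm (op_adjoint (V n)) \<le> 1" for n using bd VD by (simp add: norm_op_adjoint)
  have cauchy: "Cauchy (\<lambda>n. X n x)"
    if X: "\<And>n k. op_adjoint (X n) o\<^sub>L X (n + k) = op_adjoint (X n) o\<^sub>L X n" "\<And>n. X n \<in> N" "\<And>n. norm (X n) \<le> 1" for X x
  proof (rule Cauchy_if_increments)
    fix n m :: nat assume nm: "n \<le> m"
    have "inner (X n x) (X m x) = inner x ((op_adjoint (X n) o\<^sub>L X m) x)"
      using X(2) by (simp add: inner_op_left)
    also have "\<dots> = inner x ((op_adjoint (X n) o\<^sub>L X n) x)" using X(1)[of n "m - n"] nm by simp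
    also have "\<dots> = inner (X n x) (X n x)" using X(2) by (simp add: inner_op_left)
    finally show "(norm (X m x - (X n) x))\<^sup>2 \<le> (norm (X m x))\<^sup>2 - (norm (X n x))\<^sup>2"
      by (simp add: power2_norm_eq_inner inner_simps inner_commute)
  next
    show "(norm (X n x))\<^sup>2 \<le> (norm x)\<^sup>2" for n
      using norm_blinfun[of "X n" x] mult_right_mono[OF X(3), of "norm x" n] by (intro power_mono) auto
  qed
  obtain v :: "'h op" where v: "\<And>x. (\<lambda>n. V n x) \<longlonglongrightarrow> v x"
    using strong_limit_exists[OF bd cauchy[of V]] VV VD bd by blast
  obtain v' :: "'h op" where v': "\<And>x. (\<lambda>n. (op_adjoint (V n)) x) \<longlonglongrightarrow> v' x"
    using strong_limit_exists[OF bd' cauchy[of "\<lambda>n. op_adjoint (V n)"]] VV VD bd' by (auto simp: op_adjoint_adjoint)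
  have vN: "v \<in> N" "v' \<in> N" using strong_limit[OF _ v] strong_limit[OF _ v'] VD by auto
  have va: "op_adjoint v = v'" using adjoint_strong_limit[OF VD(1) vN v v'] .
  note c = strong_limit_compose
  have l1: "(\<lambda>n. (op_adjoint (V n) o\<^sub>L V n) x) \<longlonglongrightarrow> (v' o\<^sub>L v) x" for x using c[OF bd' v' v] by simp
  have l2: "(\<lambda>n. (V n o\<^sub>L op_adjoint (V n)) x) \<longlonglongrightarrow> (v o\<^sub>L v') x" for x using c[OF bd v v'] by simp
  have uniq: "X = Y" if "\<And>x. (\<lambda>n. Z n x) \<longlonglongrightarrow> X x" "\<And>x. (\<lambda>n. Z n x) \<longlonglongrightarrow> Y x" for X Y :: "'h op" and Z
    using LIMSEQ_unique[OF that] by (intro blinfun_eqI) blast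
  have vnil: "v \<in> nil_pi p"
  proof -
    have "v o\<^sub>L (v' o\<^sub>L v) = v"
    proof (rule uniq[of "\<lambda>n. V n o\<^sub>L (op_adjoint (V n) o\<^sub>L V n)"])
      show "(\<lambda>n. (V n o\<^sub>L (op_adjoint (V n) o\<^sub>L V n)) x) \<longlonglongrightarrow> (v o\<^sub>L (v' o\<^sub>L v)) x" for x
        using c[OF bd v l1] by simp
      show "(\<lambda>n. (V n o\<^sub>L (op_adjoint (V n) o\<^sub>L V n)) x) \<longlonglongrightarrow> v x" for x
        unfolding VD(5) by (rule v)
    qed
    moreover have "v o\<^sub>L v = 0"
    proof (rule uniq[of "\<lambda>n. V n o\<^sub>L V n"])
      show "(\<lambda>n. (V n o\<^sub>L V n) x) \<longlonglongrightarrow> (v o\<^sub>L v) x" for x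
        using c[OF bd v v] by simp
      show "(\<lambda>n. (V n o\<^sub>L V n) x) \<longlonglongrightarrow> blinfun_apply 0 x" for x
        unfolding VD(4) by simp
    qed
    moreover have "p o\<^sub>L v = v"
    proof (rule uniq[of "\<lambda>n. p o\<^sub>L V n"])
      show "(\<lambda>n. (p o\<^sub>L V n) x) \<longlonglongrightarrow> (p o\<^sub>L v) x" for x
        using c[OF order_refl tendsto_const v, of p] by simp
      show "(\<lambda>n. (p o\<^sub>L V n) x) \<longlonglongrightarrow> v x" for x
        unfolding VD(2) by (rule v)
    qed
    moreover have "v o\<^sub>L p = v"
    proof (rule uniq[of "\<lambda>n. V n o\<^sub>L p"])
      show "(\<lambda>n. (V n o\<^sub>L p) x) \<longlonglongrightarrow> (v o\<^sub>L p) x" for x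
        using v[of "p x"] by simp
      show "(\<lambda>n. (V n o\<^sub>L p) x) \<longlonglongrightarrow> v x" for x
        unfolding VD(3) by (rule v)
    qed
    ultimately show ?thesis using vN va by (simp add: nil_pi_def corner_def blinfun_assoc)
  qed
  define r where "r = rest p v"
  have rP: "r \<in> projections N" "r \<in> corner p" using rest[OF p vnil] by (auto simp: r_def)
  have Rlim: "(\<lambda>n. R n x) \<longlonglongrightarrow> r x" for x
    unfolding R_def r_def rest_def va blinfun.bilinear_simps by (intro tendsto_intros l1 l2)
  have "r = 0"
  proof (rule ccontr)
    assume "r \<noteq> 0"
    then obtain x where "x \<in> corner r" "x o\<^sub>L x = 0" "x \<noteq> 0" using ex rP by blast
    then obtain u where u: "u \<in> nil_pi r" "u \<noteq> 0" using nil_pi_exists rP by blast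
    note uD = nil_piD[OF u(1) rP(1)]
    have Rr: "R n o\<^sub>L r = r" for n
    proof (rule uniq[of "\<lambda>k. R n o\<^sub>L R (n + k)"])
      have sh: "(\<lambda>k. (R (n + k)) x) \<longlonglongrightarrow> r x" for x
        using LIMSEQ_ignore_initial_segment[OF Rlim, of n x] by (simp add: add.commute)
      show "(\<lambda>k. (R n o\<^sub>L R (n + k)) x) \<longlonglongrightarrow> r x" for x using sh by (simp only: RR)
      show "(\<lambda>k. (R n o\<^sub>L R (n + k)) x) \<longlonglongrightarrow> (R n o\<^sub>L r) x" for x
        using c[OF order_refl tendsto_const sh, of "R n"] by simp
    qed
    have rR: "r o\<^sub>L R n = r" for n
      using arg_cong[OF Rr[of n], of op_adjoint] projectionsD[OF rP(1)] projectionsD[OF Rn(1)[of n]] by (simp add: adj_simps)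
    have "u \<in> corner (R n)" for n
      using uD Rr[of n] rR[of n] by (auto intro!: cornerI) (metis blinfun_assoc)+
    hence "u \<in> nil_pi (R n)" for n using u by (auto simp: nil_pi_def)
    hence le: "ip u u \<le> 2 * ip (w (R n)) (w (R n))" for n using w(2) Rn by blast
    have "real n * ip u u \<le> 2 * ip (V n) (V n)" for n
    proof (induction n)
      case (Suc n)
      have "ip (V (Suc n)) (V (Suc n)) = ip (V n) (V n) + ip (w (R n)) (w (R n))"
        using nil_pi_extend(2)[OF p Vn wR[of n, unfolded R_def]] VD(1,6)[of n] wD(1,6)[of n]
        by (simp add: ip_def VS R_def tr_add)
      thus ?case using Suc le[of n] by (simp add: algebra_simps)
    qed (simp add: V0 ip_def)
    moreover have "2 * ip (V n) (V n) \<le> 2" for n using nil_pi_ip_le[OF Vn p, of n] by simp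
    ultimately have "real n * ip u u \<le> 2" for n by (rule order_trans)
    moreover have "ip u u > 0"
      using n2_eq_zero[of u] ip_nonneg[of u] u(2) uD(1) by (auto simp: n2_def less_le)
    ultimately show False using reals_Archimedean3[of "ip u u"] by (meson not_le)
  qed
  thus ?thesis using vnil by (auto simp: r_def)
qed

text \<open>Only one column of matrix units is kept: the \<open>u a\<close> carry \<open>f\<close>
  onto 2^k orthogonal projections under \<open>e\<close>, and the trace identity says that these
  exhaust the trace of \<open>e\<close>.\<close>

lemma matrix_system_exists:
  assumes e: "e \<in> projections N"
    and ex: "\<And>q. q \<in> projections N \<Longrightarrow> q \<in> corner e \<Longrightarrow> q \<noteq> 0 \<Longrightarrow> \<exists>x\<in>corner q. x o\<^sub>L x = 0 \<and> x \<noteq> 0"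
  shows "\<exists>f (u :: nat \<Rightarrow> 'h op). f \<in> projections N \<and> f \<in> corner e \<and> 2 ^ k * Re (\<tau> f) = Re (\<tau> e) \<and>
    (\<forall>a<2^k. u a \<in> corner e \<and> u a o\<^sub>L f = u a) \<and>
    (\<forall>a<2^k. \<forall>b<2^k. op_adjoint (u a) o\<^sub>L u b = (if a = b then f else 0))"
proof (induction k)
  case 0
  show ?case using e corner_closed(7)[OF e] projectionsD[OF e] by (intro exI[of _ e] exI[of _ "\<lambda>_. e"]) auto
next
  case (Suc k)
  then obtain f and u :: "nat \<Rightarrow> 'h op" where f: "f \<in> projections N" "f \<in> corner e" "2 ^ k * Re (\<tau> f) = Re (\<tau> e)"
    and u: "\<And>a. a < 2^k \<Longrightarrow> u a \<in> corner e" "\<And>a. a < 2^k \<Longrightarrow> u a o\<^sub>L f = u a"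
    and uu: "\<And>a b. a < 2^k \<Longrightarrow> b < 2^k \<Longrightarrow> op_adjoint (u a) o\<^sub>L u b = (if a = b then f else 0)" by blast
  obtain v where v: "v \<in> nil_pi f" "rest f v = 0"
    using halving[OF f(1)] ex corner_trans[OF f(2)] by blast
  note vD = nil_piD[OF v(1) f(1)]
  define f' where "f' = op_adjoint v o\<^sub>L v"
  have f'N: "f' \<in> N" "op_adjoint f' = f'" "f' o\<^sub>L f' = f'" using vD by (auto simp: f'_def adj_simps blinfun_assoc)
  have f'f: "f' o\<^sub>L f = f'" "f o\<^sub>L f' = f'" using vD by (simp_all add: f'_def blinfun_assoc) (simp flip: blinfun_assoc add: vD)
  have f'v: "f' o\<^sub>L v = 0" "op_adjoint v o\<^sub>L f' = 0" "v o\<^sub>L f' = v"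
    using vD by (simp_all add: f'_def blinfun_assoc) (simp flip: blinfun_assoc add: vD)
  have "\<tau> f = \<tau> (op_adjoint v o\<^sub>L v) + \<tau> (v o\<^sub>L op_adjoint v)"
    using v(2) vD f(1) tr_add[of "op_adjoint v o\<^sub>L v" "v o\<^sub>L op_adjoint v"] by (simp add: rest_def algebra_simps)
  also have "\<tau> (v o\<^sub>L op_adjoint v) = \<tau> (op_adjoint v o\<^sub>L v)" using vD by (intro tr_comm)
  finally have tf: "2 ^ Suc k * Re (\<tau> f') = Re (\<tau> e)" using f(3) by (simp add: f'_def algebra_simps)
  have ve: "v \<in> corner e" "f' \<in> corner e"
    using v f'N f'f corner_trans[OF f(2)] by (auto simp: nil_pi_def intro!: cornerI corner_trans[OF f(2)])
  \<comment> \<open>With \<open>f\<close> halved by \<open>v\<close>, each \<open>u a\<close> splits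
    in two: its restriction to the initial half \<open>f'\<close>, and its composition with
    \<open>v\<close>, which reaches the other half from \<open>f'\<close>.\<close>
  define u' where "u' a = (if a < 2^k then u a o\<^sub>L f' else u (a - 2^k) o\<^sub>L v)" for a
  have u'c: "u' a \<in> corner e" "u' a o\<^sub>L f' = u' a" if "a < 2 ^ Suc k" for a
    using that u(1) ve f'N f'v by (auto simp: u'_def blinfun_assoc intro!: corner_closed)
  have adj': "op_adjoint (u a o\<^sub>L x) o\<^sub>L (u b o\<^sub>L y) = (if a = b then op_adjoint x o\<^sub>L (f o\<^sub>L y) else 0)"
    if "a < 2^k" "b < 2^k" "x \<in> N" "y \<in> N" for a b x y
  proof -
    have "op_adjoint (u a o\<^sub>L x) o\<^sub>L (u b o\<^sub>L y) = op_adjoint x o\<^sub>L ((op_adjoint (u a) o\<^sub>L u b) o\<^sub>L y)"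
      using that cornerD(1)[OF u(1)[OF that(1)]] by (simp add: adj_simps blinfun_assoc)
    thus ?thesis using uu that by simp
  qed
  have "op_adjoint (u' a) o\<^sub>L u' b = (if a = b then f' else 0)" if "a < 2 ^ Suc k" "b < 2 ^ Suc k" for a b
    using that f'N vD f'f f'v by (auto simp: u'_def adj' f'_def[symmetric])
  moreover have "f' \<in> projections N" using f'N by (simp add: projections_def)
  ultimately show ?case using ve tf u'c by (intro exI[of _ f'] exI[of _ u']) blast
qed

end

text \<open>Moves the absence of abelian projections from the summand \<open>z N\<close>, an algebra
  with unit \<open>z\<close>, to corners of \<open>N\<close>, where the other lemmas apply.\<close>

lemma nonabelian_corners_if_type_II:
  assumes N: "vna N" and z: "z \<in> central_projections N" and II: "type_II ((\<lambda>T. z o\<^sub>L T) ` N)"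
    and q: "q \<in> projections N" "z o\<^sub>L q = q" "q \<noteq> 0"
  shows "\<exists>S\<in>vna.corner N q. \<exists>T\<in>vna.corner N q. S o\<^sub>L T \<noteq> T o\<^sub>L S"
proof -
  interpret vna N by (rule N)
  note qD = projectionsD[OF q(1)]
  have zN: "z \<in> N" using z by (auto simp: central_projections_def projections_def)
  have "q \<in> projections ((\<lambda>T. z o\<^sub>L T) ` N)" using qD q(2) by (force simp: projections_def)
  moreover have "\<not> abelian_projection ((\<lambda>T. z o\<^sub>L T) ` N) q" using II q by (auto simp: type_II_def)
  ultimately obtain S T where ST: "S \<in> N" "T \<in> N"
    "(q o\<^sub>L (z o\<^sub>L S) o\<^sub>L q) o\<^sub>L (q o\<^sub>L (z o\<^sub>L T) o\<^sub>L q) \<noteq> (q o\<^sub>L (z o\<^sub>L T) o\<^sub>L q) o\<^sub>L (q o\<^sub>L (z o\<^sub>L S) o\<^sub>L q)"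
    unfolding abelian_projection_def by blast
  have "q o\<^sub>L (z o\<^sub>L x) o\<^sub>L q \<in> corner q" if "x \<in> N" for x
    using that zN qD projection_compose[OF q(1)] by (auto intro!: cornerI simp: blinfun_assoc)
  thus ?thesis using ST by blast
qed

section \<open>Spectral gap on the punctured torus\<close>

text \<open>Factor the difference of squares and apply Cauchy-Schwarz: almost invariance of
  \<open>f\<close> in the 2-norm becomes almost invariance of the measure with density f^2.\<close>

lemma sum_square_shift_le:
  fixes f :: "'z \<Rightarrow> real"
  assumes A: "finite A" and d: "(\<Sum>z\<in>A. (f (G z) - f z)\<^sup>2) \<le> \<delta>\<^sup>2" "0 \<le> \<delta>"
    and R: "(\<Sum>z\<in>A. (f z)\<^sup>2) \<le> R\<^sup>2" "(\<Sum>z\<in>A. (f (G z))\<^sup>2) \<le> R\<^sup>2" "0 \<le> R"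
  shows "\<bar>(\<Sum>z\<in>A. (f (G z))\<^sup>2) - (\<Sum>z\<in>A. (f z)\<^sup>2)\<bar> \<le> 2 * \<delta> * R"
proof -
  have "(\<Sum>z\<in>A. (f (G z))\<^sup>2) - (\<Sum>z\<in>A. (f z)\<^sup>2) = (\<Sum>z\<in>A. (f (G z) - f z) * (f (G z) + f z))"
    by (simp add: sum_subtractf[symmetric] power2_eq_square algebra_simps)
  hence "((\<Sum>z\<in>A. (f (G z))\<^sup>2) - (\<Sum>z\<in>A. (f z)\<^sup>2))\<^sup>2 \<le> (\<Sum>z\<in>A. (f (G z) - f z)\<^sup>2) * (\<Sum>z\<in>A. (f (G z) + f z)\<^sup>2)"
    using Cauchy_Schwarz_ineq_sum[of "\<lambda>z. f (G z) - f z" "\<lambda>z. f (G z) + f z" A] by simp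
  also have "\<dots> \<le> \<delta>\<^sup>2 * (4 * R\<^sup>2)"
  proof (intro mult_mono d)
    have "(\<Sum>z\<in>A. (f (G z) + f z)\<^sup>2) \<le> (\<Sum>z\<in>A. 2 * (f (G z))\<^sup>2 + 2 * (f z)\<^sup>2)"
    proof (rule sum_mono)
      fix z
      have "0 \<le> (f (G z) - f z)\<^sup>2" by simp
      thus "(f (G z) + f z)\<^sup>2 \<le> 2 * (f (G z))\<^sup>2 + 2 * (f z)\<^sup>2" by (simp add: power2_sum power2_diff)
    qed
    thus "(\<Sum>z\<in>A. (f (G z) + f z)\<^sup>2) \<le> 4 * R\<^sup>2" using R by (simp add: sum.distrib sum_distrib_left[symmetric])
  qed (auto intro: sum_nonneg)
  also have "\<dots> = (2 * \<delta> * R)\<^sup>2" by (simp add: power2_eq_square)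
  finally show ?thesis using d(2) R(3) abs_le_square_iff[of _ "2 * \<delta> * R"] by (simp add: abs_mult)
qed

text \<open>The constant 5 of the spectral gap: it rounds up 2 + sqrt (11/2), the positive root of
  R^2 = 4 R + 3/2.\<close>

lemma square_le_if_quadratic:
  fixes R S :: real
  assumes "0 \<le> R" "0 \<le> S" "R\<^sup>2 \<le> 3 / 2 * S\<^sup>2 + 4 * S * R"
  shows "R \<le> 5 * S"
proof (rule ccontr)
  assume "\<not> R \<le> 5 * S"
  have "R\<^sup>2 - 4 * S * R = (R - 5 * S)\<^sup>2 + 6 * (S * (R - 5 * S)) + 5 * S\<^sup>2" by (simp add: power2_eq_square algebra_simps)
  moreover have "0 \<le> S * (R - 5 * S)" using assms \<open>\<not> R \<le> 5 * S\<close> by simp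
  moreover have "0 < (R - 5 * S)\<^sup>2" "0 \<le> S\<^sup>2" using \<open>\<not> R \<le> 5 * S\<close> by auto
  ultimately show False using assms(3) by linarith
qed

text \<open>After Burger and Shalom: an almost invariant measure \<open>f\<^sup>2\<close> on the
  punctured torus lives near \<open>0\<close>, where the elementary matrices act without wrapping around. They map the sector
  \<open>\<theta>1 \<theta>2 \<ge> 0\<close>, \<open>\<theta>1 \<noteq> 0\<close> into disjoint subsectors, and their inverses do the same for the complementary sector.\<close>

lemma torus_gap:
  fixes f \<theta>1 \<theta>2 :: "'z \<Rightarrow> real"
  assumes Z: "finite Z" and G1: "bij_betw G1 Z Z" and G2: "bij_betw G2 Z Z"
    and b: "\<And>z. z \<in> Z \<Longrightarrow> \<bar>\<theta>1 z\<bar> \<le> 1/2" "\<And>z. z \<in> Z \<Longrightarrow> \<bar>\<theta>2 z\<bar> \<le> 1/2"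
    and nz: "\<And>z. z \<in> Z \<Longrightarrow> \<theta>1 z \<noteq> 0 \<or> \<theta>2 z \<noteq> 0"
    and g1: "\<And>z. z \<in> Z \<Longrightarrow> \<theta>1 (G1 z) - (\<theta>1 z + \<theta>2 z) \<in> \<int>" "\<And>z. z \<in> Z \<Longrightarrow> \<theta>2 (G1 z) = \<theta>2 z"
    and g2: "\<And>z. z \<in> Z \<Longrightarrow> \<theta>2 (G2 z) - (\<theta>1 z + \<theta>2 z) \<in> \<int>" "\<And>z. z \<in> Z \<Longrightarrow> \<theta>1 (G2 z) = \<theta>1 z"
    and e1: "(\<Sum>z\<in>Z. (cmod (cis (2 * pi * \<theta>1 z) - 1) * f z)\<^sup>2) \<le> \<epsilon>1\<^sup>2" "0 \<le> \<epsilon>1"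
    and e2: "(\<Sum>z\<in>Z. (cmod (cis (2 * pi * \<theta>2 z) - 1) * f z)\<^sup>2) \<le> \<epsilon>2\<^sup>2" "0 \<le> \<epsilon>2"
    and d1: "(\<Sum>z\<in>Z. (f (G1 z) - f z)\<^sup>2) \<le> \<delta>1\<^sup>2" "0 \<le> \<delta>1"
    and d2: "(\<Sum>z\<in>Z. (f (G2 z) - f z)\<^sup>2) \<le> \<delta>2\<^sup>2" "0 \<le> \<delta>2"
  shows "sqrt (\<Sum>z\<in>Z. (f z)\<^sup>2) \<le> 5 * (\<epsilon>1 + \<epsilon>2 + \<delta>1 + \<delta>2)"
proof -
  define \<mu> where "\<mu> A = (\<Sum>z\<in>A. (f z)\<^sup>2)" for A
  define R where "R = sqrt (\<mu> Z)"
  have \<mu>0: "0 \<le> \<mu> A" for A by (simp add: \<mu>_def sum_nonneg)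
  have R: "0 \<le> R" "R\<^sup>2 = \<mu> Z" using \<mu>0 by (simp_all add: R_def)
  have mono: "\<mu> A \<le> \<mu> B" if "A \<subseteq> B" "B \<subseteq> Z" for A B
    unfolding \<mu>_def using that Z by (intro sum_mono2) (auto intro: finite_subset)
  have union: "\<mu> A + \<mu> B \<le> \<mu> C" if "A \<inter> B = {}" "A \<subseteq> C" "B \<subseteq> C" "C \<subseteq> Z" for A B C
  proof -
    have "finite A" "finite B" using that Z by (meson finite_subset subset_trans)+
    hence "\<mu> A + \<mu> B = \<mu> (A \<union> B)" unfolding \<mu>_def using that by (simp add: sum.union_disjoint)
    thus ?thesis using mono[of "A \<union> B" C] that by simp
  qed
  have cover: "\<mu> C \<le> \<mu> A + \<mu> B" if "C \<subseteq> A \<union> B" "A \<subseteq> Z" "B \<subseteq> Z" for A B C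
  proof -
    have "finite A" "finite B" using that Z by (meson finite_subset subset_trans)+
    hence "\<mu> (A \<union> B) \<le> \<mu> A + \<mu> B" using sum.union_inter[of A B "\<lambda>z. (f z)\<^sup>2"] \<mu>0[of "A \<inter> B"] by (simp add: \<mu>_def)
    thus ?thesis using mono[of C "A \<union> B"] that by simp
  qed
  have shift: "\<bar>\<mu> (G ` A) - \<mu> A\<bar> \<le> 2 * \<delta> * R"
    if G: "bij_betw G Z Z" and d: "(\<Sum>z\<in>Z. (f (G z) - f z)\<^sup>2) \<le> \<delta>\<^sup>2" "0 \<le> \<delta>" and A: "A \<subseteq> Z" for G \<delta> A
  proof -
    have inj: "inj_on G A" using G A by (meson bij_betw_def inj_on_subset)
    have GA: "G ` A \<subseteq> Z" using G A by (auto simp: bij_betw_def)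
    have e: "\<mu> (G ` A) = (\<Sum>z\<in>A. (f (G z))\<^sup>2)" unfolding \<mu>_def using inj by (simp add: sum.reindex)
    have "(\<Sum>z\<in>A. (f (G z) - f z)\<^sup>2) \<le> (\<Sum>z\<in>Z. (f (G z) - f z)\<^sup>2)" using Z A by (intro sum_mono2) auto
    hence "(\<Sum>z\<in>A. (f (G z) - f z)\<^sup>2) \<le> \<delta>\<^sup>2" using d by linarith
    moreover have "(\<Sum>z\<in>A. (f z)\<^sup>2) \<le> R\<^sup>2" "(\<Sum>z\<in>A. (f (G z))\<^sup>2) \<le> R\<^sup>2"
      using mono[OF A] mono[OF GA] e R by (simp_all add: \<mu>_def)
    ultimately show ?thesis using sum_square_shift_le[of A f G \<delta> R] R d A Z
      unfolding e unfolding \<mu>_def by (simp add: finite_subset)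
  qed
  define W where "W = {z\<in>Z. 1/4 \<le> \<bar>\<theta>1 z\<bar> \<or> 1/4 \<le> \<bar>\<theta>2 z\<bar>}"
  have bad: "\<mu> {z\<in>Z. 1/4 \<le> \<bar>\<theta> z\<bar>} \<le> \<epsilon>\<^sup>2 / 2"
    if e: "(\<Sum>z\<in>Z. (cmod (cis (2 * pi * \<theta> z) - 1) * f z)\<^sup>2) \<le> \<epsilon>\<^sup>2" and b: "\<And>z. z \<in> Z \<Longrightarrow> \<bar>\<theta> z\<bar> \<le> 1/2" for \<theta> \<epsilon>
  proof -
    let ?A = "{z\<in>Z. 1/4 \<le> \<bar>\<theta> z\<bar>}"
    \<comment> \<open>For 1/4 <= |t| <= 1/2 one has |exp (2 pi i t) - 1|^2 = 2 - 2 cos (2 pi t) >=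
      2.\<close>
    have "2 * (f z)\<^sup>2 \<le> (cmod (cis (2 * pi * \<theta> z) - 1) * f z)\<^sup>2" if z: "z \<in> ?A" for z
    proof -
      have "cos (2 * pi * \<bar>\<theta> z\<bar>) \<le> cos (pi / 2)"
        using z b[of z] by (intro cos_monotone_0_pi_le) (auto simp: field_simps)
      moreover have "cos (2 * pi * \<bar>\<theta> z\<bar>) = cos (2 * pi * \<theta> z)" by (cases "\<theta> z \<ge> 0") auto
      moreover have "(cmod (cis t - 1))\<^sup>2 = 2 - 2 * cos t" for t
        using sin_cos_squared_add[of t] unfolding cmod_power2 by (simp add: power2_diff)
      ultimately have "2 \<le> (cmod (cis (2 * pi * \<theta> z) - 1))\<^sup>2" by simp
      thus ?thesis unfolding power_mult_distrib by (rule mult_right_mono) simp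
    qed
    hence "(\<Sum>z\<in>?A. 2 * (f z)\<^sup>2) \<le> (\<Sum>z\<in>?A. (cmod (cis (2 * pi * \<theta> z) - 1) * f z)\<^sup>2)" by (rule sum_mono)
    also have "\<dots> \<le> (\<Sum>z\<in>Z. (cmod (cis (2 * pi * \<theta> z) - 1) * f z)\<^sup>2)" using Z by (intro sum_mono2) auto
    finally show ?thesis using e by (simp add: \<mu>_def sum_distrib_left[symmetric])
  qed
  have \<mu>W: "\<mu> W \<le> (\<epsilon>1\<^sup>2 + \<epsilon>2\<^sup>2) / 2"
  proof -
    have "\<mu> W \<le> \<mu> {z\<in>Z. 1/4 \<le> \<bar>\<theta>1 z\<bar>} + \<mu> {z\<in>Z. 1/4 \<le> \<bar>\<theta>2 z\<bar>}" by (rule cover) (auto simp: W_def)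
    thus ?thesis using bad[OF e1(1) b(1)] bad[OF e2(1) b(2)] by (simp add: add_divide_distrib)
  qed
  \<comment> \<open>Two such reals differ by less than 1. Outside \<open>W\<close> the sum of two
    coordinates stays below 1/2 in absolute value, so the congruences for the shears become
    equalities.\<close>
  have exact: "x = y" if "x - y \<in> \<int>" "\<bar>x\<bar> \<le> 1/2" "\<bar>y\<bar> < 1/2" for x y :: real
    using that Ints_nonzero_abs_ge1[of "x - y"] by (cases "x = y") auto
  \<comment> \<open>The axes are shared out: P takes the nonzero points with \<theta>2 = 0 and Q
    those with \<theta>1 = 0, so that P, Q and W cover the punctured torus.\<close>
  define P where "P = {z\<in>Z - W. 0 \<le> \<theta>1 z * \<theta>2 z \<and> \<theta>1 z \<noteq> 0}"
  define Q where "Q = {z\<in>Z - W. \<theta>1 z * \<theta>2 z \<le> 0 \<and> \<theta>2 z \<noteq> 0}"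
  have small: "\<bar>\<theta>1 z\<bar> < 1/4" "\<bar>\<theta>2 z\<bar> < 1/4" if "z \<in> Z - W" for z using that by (auto simp: W_def)
  have PZ: "P \<subseteq> Z" "Q \<subseteq> Z" by (auto simp: P_def Q_def)
  have GZ: "G1 z \<in> Z" "G2 z \<in> Z" if "z \<in> Z" for z using G1 G2 that by (auto simp: bij_betw_def)
  \<comment> \<open>The images of P under the two shears are disjoint, stay in P or W, and each has
    nearly the measure of P. So twice that measure is at most \<mu> P + \<mu> W up to the shift
    errors.\<close>
  have \<mu>P: "\<mu> P \<le> \<mu> W + 2 * (\<delta>1 + \<delta>2) * R"
  proof -
    define P1 where "P1 = {z\<in>Z. 0 \<le> \<theta>1 z * \<theta>2 z \<and> \<bar>\<theta>2 z\<bar> < \<bar>\<theta>1 z\<bar>}"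
    define P2 where "P2 = {z\<in>Z. 0 \<le> \<theta>1 z * \<theta>2 z \<and> \<theta>1 z \<noteq> 0 \<and> \<bar>\<theta>1 z\<bar> \<le> \<bar>\<theta>2 z\<bar>}"
    have P12: "P1 \<inter> P2 = {}" "P1 \<subseteq> Z" "P2 \<subseteq> Z" by (auto simp: P1_def P2_def)
    have "G1 ` P \<subseteq> P1"
    proof (clarify)
      fix z assume z: "z \<in> P"
      hence zZ: "z \<in> Z" and s: "0 \<le> \<theta>1 z * \<theta>2 z" "\<theta>1 z \<noteq> 0" and sm: "\<bar>\<theta>1 z\<bar> < 1/4" "\<bar>\<theta>2 z\<bar> < 1/4"
        using small[of z] by (auto simp: P_def)
      have "\<theta>1 (G1 z) = \<theta>1 z + \<theta>2 z" using sm by (intro exact[OF g1(1)[OF zZ] b(1)[OF GZ(1)[OF zZ]]]) linarith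
      moreover have "\<bar>\<theta>2 z\<bar> < \<bar>\<theta>1 z + \<theta>2 z\<bar>" using s by (auto simp: zero_le_mult_iff)
      moreover have "0 \<le> (\<theta>1 z + \<theta>2 z) * \<theta>2 z" using s by (simp add: distrib_right)
      ultimately show "G1 z \<in> P1" using GZ(1)[OF zZ] g1(2)[OF zZ] by (simp add: P1_def)
    qed
    moreover have "G2 ` P \<subseteq> P2"
    proof (clarify)
      fix z assume z: "z \<in> P"
      hence zZ: "z \<in> Z" and s: "0 \<le> \<theta>1 z * \<theta>2 z" "\<theta>1 z \<noteq> 0" and sm: "\<bar>\<theta>1 z\<bar> < 1/4" "\<bar>\<theta>2 z\<bar> < 1/4"
        using small[of z] by (auto simp: P_def)
      have "\<theta>2 (G2 z) = \<theta>1 z + \<theta>2 z" using sm by (intro exact[OF g2(1)[OF zZ] b(2)[OF GZ(2)[OF zZ]]]) linarith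
      moreover have "\<bar>\<theta>1 z\<bar> \<le> \<bar>\<theta>1 z + \<theta>2 z\<bar>" using s by (auto simp: zero_le_mult_iff)
      moreover have "0 \<le> \<theta>1 z * (\<theta>1 z + \<theta>2 z)" using s by (simp add: distrib_left)
      ultimately show "G2 z \<in> P2" using GZ(2)[OF zZ] g2(2)[OF zZ] s by (simp add: P2_def)
    qed
    ultimately have "\<mu> (G1 ` P) + \<mu> (G2 ` P) \<le> \<mu> (P1 \<union> P2)"
      using P12 by (intro union) blast+
    also have "\<dots> \<le> \<mu> P + \<mu> W" by (rule cover) (auto simp: P1_def P2_def P_def W_def)
    finally show ?thesis
      using shift[OF G1 d1 PZ(1)] shift[OF G2 d2 PZ(1)] by (simp add: algebra_simps)
  qed
  have \<mu>Q: "\<mu> Q \<le> \<mu> W + 2 * (\<delta>1 + \<delta>2) * R"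
  proof -
    define Q1 where "Q1 = {z\<in>Z. G1 z \<in> Q}"
    define Q2 where "Q2 = {z\<in>Z. G2 z \<in> Q}"
    have im: "G1 ` Q1 = Q" "G2 ` Q2 = Q" using G1 G2 PZ(2) by (auto simp: Q1_def Q2_def bij_betw_def)
    have q1: "\<theta>1 z * \<theta>2 z \<le> 0 \<and> \<theta>2 z \<noteq> 0 \<and> \<bar>\<theta>2 z\<bar> \<le> \<bar>\<theta>1 z\<bar>" if z: "z \<in> Q1" for z
    proof -
      have zZ: "z \<in> Z" and s: "\<theta>1 (G1 z) * \<theta>2 z \<le> 0" "\<theta>2 z \<noteq> 0" and sm: "\<bar>\<theta>1 (G1 z)\<bar> < 1/4" "\<bar>\<theta>2 z\<bar> < 1/4"
        using z small[of "G1 z"] g1(2)[of z] by (auto simp: Q_def Q1_def)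
      have "- (\<theta>1 (G1 z) - (\<theta>1 z + \<theta>2 z)) \<in> \<int>" using g1(1)[OF zZ] by (rule Ints_minus)
      hence i: "\<theta>1 z - (\<theta>1 (G1 z) - \<theta>2 z) \<in> \<int>" by (simp add: algebra_simps)
      have "\<theta>1 z = \<theta>1 (G1 z) - \<theta>2 z" using sm by (intro exact[OF i b(1)[OF zZ]]) linarith
      moreover have "\<bar>\<theta>2 z\<bar> \<le> \<bar>\<theta>1 (G1 z) - \<theta>2 z\<bar>" using s by (auto simp: mult_le_0_iff)
      moreover have "(\<theta>1 (G1 z) - \<theta>2 z) * \<theta>2 z \<le> 0" using s by (simp add: left_diff_distrib) (smt (verit) zero_le_square)
      ultimately show ?thesis using s by simp
    qed
    have q2: "\<theta>1 z * \<theta>2 z \<le> 0 \<and> \<theta>2 z \<noteq> 0 \<and> \<bar>\<theta>1 z\<bar> < \<bar>\<theta>2 z\<bar>" if z: "z \<in> Q2" for z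
    proof -
      have zZ: "z \<in> Z" and s: "\<theta>1 z * \<theta>2 (G2 z) \<le> 0" "\<theta>2 (G2 z) \<noteq> 0" and sm: "\<bar>\<theta>1 z\<bar> < 1/4" "\<bar>\<theta>2 (G2 z)\<bar> < 1/4"
        using z small[of "G2 z"] g2(2)[of z] by (auto simp: Q_def Q2_def)
      have "- (\<theta>2 (G2 z) - (\<theta>1 z + \<theta>2 z)) \<in> \<int>" using g2(1)[OF zZ] by (rule Ints_minus)
      hence i: "\<theta>2 z - (\<theta>2 (G2 z) - \<theta>1 z) \<in> \<int>" by (simp add: algebra_simps)
      have "\<theta>2 z = \<theta>2 (G2 z) - \<theta>1 z" using sm by (intro exact[OF i b(2)[OF zZ]]) linarith
      moreover have "\<bar>\<theta>1 z\<bar> < \<bar>\<theta>2 (G2 z) - \<theta>1 z\<bar>" using s by (auto simp: mult_le_0_iff)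
      moreover have "\<theta>1 z * (\<theta>2 (G2 z) - \<theta>1 z) \<le> 0" using s by (simp add: right_diff_distrib) (smt (verit) zero_le_square)
      ultimately show ?thesis using s by auto
    qed
    have "\<mu> Q1 + \<mu> Q2 \<le> \<mu> (Q1 \<union> Q2)"
    proof (rule union)
      have "False" if "z \<in> Q1" "z \<in> Q2" for z using q1[OF that(1)] q2[OF that(2)] by linarith
      thus "Q1 \<inter> Q2 = {}" by blast
    qed (auto simp: Q1_def Q2_def)
    also have "\<dots> \<le> \<mu> Q + \<mu> W"

    proof (rule cover)
      have "z \<in> Q \<union> W" if "z \<in> Q1 \<union> Q2" for z
        using that q1[of z] q2[of z] by (auto simp: Q1_def Q2_def Q_def)
      thus "Q1 \<union> Q2 \<subseteq> Q \<union> W" by blast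
    qed (auto simp: Q_def W_def)
    finally show ?thesis
      using shift[OF G1 d1, of Q1] shift[OF G2 d2, of Q2] unfolding im by (simp add: algebra_simps Q1_def Q2_def)
  qed
  have "Z \<subseteq> (P \<union> Q) \<union> W"
  proof
    fix z assume z: "z \<in> Z"
    consider "\<theta>1 z = 0" | "\<theta>1 z \<noteq> 0" "0 \<le> \<theta>1 z * \<theta>2 z" | "\<theta>1 z * \<theta>2 z < 0" by linarith
    thus "z \<in> (P \<union> Q) \<union> W" using nz[OF z] z by cases (auto simp: P_def Q_def)
  qed
  hence "\<mu> Z \<le> \<mu> (P \<union> Q) + \<mu> W" using PZ by (intro cover) (auto simp: W_def)
  also have "\<mu> (P \<union> Q) \<le> \<mu> P + \<mu> Q" using PZ by (intro cover) auto
  finally have "R\<^sup>2 \<le> 3 * \<mu> W + 4 * (\<delta>1 + \<delta>2) * R" using \<mu>P \<mu>Q R by (simp add: algebra_simps)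
  also have "\<dots> \<le> 3 / 2 * (\<epsilon>1 + \<epsilon>2 + \<delta>1 + \<delta>2)\<^sup>2 + 4 * (\<epsilon>1 + \<epsilon>2 + \<delta>1 + \<delta>2) * R"
  proof (intro add_mono)
    have "\<epsilon>1\<^sup>2 + \<epsilon>2\<^sup>2 \<le> (\<epsilon>1 + \<epsilon>2)\<^sup>2" using e1 e2 by (simp add: power2_sum)
    also have "\<dots> \<le> (\<epsilon>1 + \<epsilon>2 + \<delta>1 + \<delta>2)\<^sup>2" using e1 e2 d1 d2 by (intro power_mono) auto
    finally have "3 / 2 * (\<epsilon>1\<^sup>2 + \<epsilon>2\<^sup>2) \<le> 3 / 2 * (\<epsilon>1 + \<epsilon>2 + \<delta>1 + \<delta>2)\<^sup>2" by (intro mult_left_mono) auto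
    moreover have "3 * \<mu> W \<le> 3 / 2 * (\<epsilon>1\<^sup>2 + \<epsilon>2\<^sup>2)" using \<mu>W by simp
    ultimately show "3 * \<mu> W \<le> 3 / 2 * (\<epsilon>1 + \<epsilon>2 + \<delta>1 + \<delta>2)\<^sup>2" by (rule order_trans[rotated])
    show "4 * (\<delta>1 + \<delta>2) * R \<le> 4 * (\<epsilon>1 + \<epsilon>2 + \<delta>1 + \<delta>2) * R" using e1 e2 R by (intro mult_right_mono mult_left_mono) auto
  qed
  finally have "R \<le> 5 * (\<epsilon>1 + \<epsilon>2 + \<delta>1 + \<delta>2)" using R e1 e2 d1 d2 by (intro square_le_if_quadratic) auto
  thus ?thesis by (simp add: R_def \<mu>_def)
qed

section \<open>Representations on primitive vectors\<close>

context tracial_vna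
begin

lemma corner_sum: "(\<And>i. i \<in> I \<Longrightarrow> a i \<in> corner p) \<Longrightarrow> (\<Sum>i\<in>I. a i) \<in> corner p"
  by (induction I rule: infinite_finite_induct) (auto intro: corner_closed(1) cornerI)

text \<open>The \<open>u x\<close> act as an orthonormal family with coefficients in the corner of
  \<open>f\<close>. Their ranges lie under \<open>e\<close> but need not fill it, because the
  primitive vectors index only part of the available matrix units.\<close>

definition matrix_system :: "'h op \<Rightarrow> 'h op \<Rightarrow> 'x set \<Rightarrow> ('x \<Rightarrow> 'h op) \<Rightarrow> bool" where
  "matrix_system e f X u \<longleftrightarrow> finite X \<and> e \<in> projections N \<and> f \<in> projections N \<and>
     (\<forall>x\<in>X. u x \<in> N \<and> e o\<^sub>L u x = u x \<and> u x o\<^sub>L f = u x) \<and>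
     (\<forall>x\<in>X. \<forall>y\<in>X. op_adjoint (u x) o\<^sub>L u y = (if x = y then f else 0))"

text \<open>The monomial matrix that sends the basis vector of x to \<kappa> x times that of g x: a
  diagonal matrix for \<open>g = id\<close>, a permutation matrix for \<kappa> = 1.\<close>

definition monomial :: "'x set \<Rightarrow> ('x \<Rightarrow> 'h op) \<Rightarrow> ('x \<Rightarrow> complex) \<Rightarrow> ('x \<Rightarrow> 'x) \<Rightarrow> 'h op" where
  "monomial X u \<kappa> g = (\<Sum>x\<in>X. op_scale (\<kappa> x) (u (g x) o\<^sub>L op_adjoint (u x)))"

lemma matrix_systemD:
  assumes "matrix_system e f X u"
  shows "finite X" "e \<in> projections N" "f \<in> projections N" "\<And>x. x \<in> X \<Longrightarrow> e o\<^sub>L u x = u x" "\<And>x. x \<in> X \<Longrightarrow> u x \<in> N"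
    "\<And>x. x \<in> X \<Longrightarrow> u x o\<^sub>L f = u x" "\<And>x. x \<in> X \<Longrightarrow> f o\<^sub>L op_adjoint (u x) = op_adjoint (u x)"
    "\<And>x y. x \<in> X \<Longrightarrow> y \<in> X \<Longrightarrow> op_adjoint (u x) o\<^sub>L u y = (if x = y then f else 0)"
    "\<And>x y z. x \<in> X \<Longrightarrow> y \<in> X \<Longrightarrow> op_adjoint (u x) o\<^sub>L (u y o\<^sub>L z) = (if x = y then f o\<^sub>L z else 0)"
proof -
  show m: "finite X" "e \<in> projections N" "f \<in> projections N" "\<And>x. x \<in> X \<Longrightarrow> e o\<^sub>L u x = u x" "\<And>x. x \<in> X \<Longrightarrow> u x \<in> N"
    "\<And>x. x \<in> X \<Longrightarrow> u x o\<^sub>L f = u x" "\<And>x y. x \<in> X \<Longrightarrow> y \<in> X \<Longrightarrow> op_adjoint (u x) o\<^sub>L u y = (if x = y then f else 0)"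
    using assms by (auto simp: matrix_system_def)
  show "f o\<^sub>L op_adjoint (u x) = op_adjoint (u x)" if "x \<in> X" for x
    using arg_cong[OF m(6)[OF that], of op_adjoint] m(5)[OF that] projectionsD[OF m(3)] by (simp add: adj_simps)
  show "op_adjoint (u x) o\<^sub>L (u y o\<^sub>L z) = (if x = y then f o\<^sub>L z else 0)" if "x \<in> X" "y \<in> X" for x y z
    using m(7)[OF that] by (simp add: blinfun_assoc[symmetric])
qed

context
  fixes e f :: "'h op" and X :: "'x set" and u
  assumes m: "matrix_system e f X u"
begin

lemmas mD = matrix_systemD[OF m]

lemma monomial_corner: assumes "g ` X \<subseteq> X" shows "monomial X u \<kappa> g \<in> corner e"
proof -
  have "op_scale (\<kappa> x) (u (g x) o\<^sub>L op_adjoint (u x)) \<in> corner e" if "x \<in> X" for x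
  proof (rule corner_closed(4)[OF projectionsD(1)[OF mD(2)]], rule cornerI)
    have g: "g x \<in> X" using assms that by blast
    show "u (g x) o\<^sub>L op_adjoint (u x) \<in> N" using mD(5) g that by blast
    show "e o\<^sub>L (u (g x) o\<^sub>L op_adjoint (u x)) = u (g x) o\<^sub>L op_adjoint (u x)" using mD(4)[OF g] by (simp flip: blinfun_assoc)
    have "op_adjoint (e o\<^sub>L u x) = op_adjoint (u x) o\<^sub>L e" using projectionsD[OF mD(2)] mD(5)[OF that] by (simp add: adj_simps)
    thus "u (g x) o\<^sub>L op_adjoint (u x) o\<^sub>L e = u (g x) o\<^sub>L op_adjoint (u x)" using mD(4)[OF that] by (simp add: blinfun_assoc)
  qed
  thus ?thesis unfolding monomial_def by (rule corner_sum)
qed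

lemma monomial_apply:
  assumes g: "g ` X \<subseteq> X" and x: "x \<in> X" shows "monomial X u \<kappa> g o\<^sub>L u x = op_scale (\<kappa> x) (u (g x))"
proof -
  have "monomial X u \<kappa> g o\<^sub>L u x = (\<Sum>y\<in>X. op_scale (\<kappa> y) (u (g y) o\<^sub>L (op_adjoint (u y) o\<^sub>L u x)))"
    by (simp add: monomial_def blinfun_compose_sum op_scale_compose blinfun_assoc)
  also have "\<dots> = (\<Sum>y\<in>X. if y = x then op_scale (\<kappa> x) (u (g x)) else 0)"
  proof (rule sum.cong[OF refl])
    fix y assume y: "y \<in> X"
    have "op_scale c (0 :: 'h op) = 0" for c by (rule blinfun_eqI) simp
    thus "op_scale (\<kappa> y) (u (g y) o\<^sub>L (op_adjoint (u y) o\<^sub>L u x)) = (if y = x then op_scale (\<kappa> x) (u (g x)) else 0)"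
      using mD(8)[OF y x] mD(6)[of "g x"] g x by auto
  qed
  finally show ?thesis using x mD(1) by simp
qed

lemma adjoint_apply_monomial:
  assumes g: "g ` X \<subseteq> X" "inj_on g X" and x: "x \<in> X"
  shows "op_adjoint (u (g x)) o\<^sub>L monomial X u \<kappa> g = op_scale (\<kappa> x) (op_adjoint (u x))"
proof -
  have gN: "op_adjoint (u (g x)) \<in> bounded_operators" using mD(5) g x by auto
  have "op_adjoint (u (g x)) o\<^sub>L monomial X u \<kappa> g = (\<Sum>y\<in>X. op_scale (\<kappa> y) (op_adjoint (u (g x)) o\<^sub>L (u (g y) o\<^sub>L op_adjoint (u y))))"
    by (simp add: monomial_def blinfun_compose_sum op_scale_compose(2)[OF gN])
  also have "\<dots> = (\<Sum>y\<in>X. if y = x then op_scale (\<kappa> x) (op_adjoint (u x)) else 0)"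
  proof (rule sum.cong[OF refl])
    fix y assume y: "y \<in> X"
    have "op_scale c (0 :: 'h op) = 0" for c by (rule blinfun_eqI) simp
    moreover have "g x = g y \<longleftrightarrow> x = y" "g x \<in> X" "g y \<in> X" using g x y by (auto dest: inj_onD)
    ultimately show "op_scale (\<kappa> y) (op_adjoint (u (g x)) o\<^sub>L (u (g y) o\<^sub>L op_adjoint (u y))) = (if y = x then op_scale (\<kappa> x) (op_adjoint (u x)) else 0)"
      using mD(9)[of "g x" "g y" "op_adjoint (u y)"] mD(7)[OF y] g x y by auto
  qed
  finally show ?thesis using x mD(1) by simp
qed

abbreviation "support \<equiv> monomial X u (\<lambda>_. 1) id"

lemma support_eq: "support = (\<Sum>x\<in>X. u x o\<^sub>L op_adjoint (u x))"
  by (simp add: monomial_def op_scale_compose)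

lemma monomial_support: "monomial X u \<kappa> g o\<^sub>L support = monomial X u \<kappa> g" if g: "g ` X \<subseteq> X"
  by (simp add: support_eq blinfun_compose_sum blinfun_assoc[symmetric] monomial_apply[OF g] op_scale_compose)
    (simp add: monomial_def)

lemma support_monomial: "support o\<^sub>L monomial X u \<kappa> g = monomial X u \<kappa> g" if g: "g ` X \<subseteq> X" "inj_on g X"
proof -
  have b: "bij_betw g X X" using g mD(1) by (metis bij_betw_def card_image card_subset_eq)
  have "support o\<^sub>L monomial X u \<kappa> g = (\<Sum>x\<in>X. u x o\<^sub>L (op_adjoint (u x) o\<^sub>L monomial X u \<kappa> g))"
    by (simp add: support_eq blinfun_compose_sum blinfun_assoc)
  also have "\<dots> = (\<Sum>x\<in>X. u (g x) o\<^sub>L (op_adjoint (u (g x)) o\<^sub>L monomial X u \<kappa> g))"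
    by (rule sum.reindex_bij_betw[OF b, symmetric])
  also have "\<dots> = (\<Sum>x\<in>X. op_scale (\<kappa> x) (u (g x) o\<^sub>L op_adjoint (u x)))"
    using g mD(5) by (intro sum.cong refl) (auto simp: adjoint_apply_monomial op_scale_compose)
  finally show ?thesis by (simp add: monomial_def)
qed

lemma support_projection: "support \<in> projections N"
proof -
  have "op_adjoint support = support"
    using mD(5) by (simp add: support_eq adj_sum adj_simps)
  moreover have "support \<in> N" using cornerD(1)[OF monomial_corner[of id]] by simp
  ultimately show ?thesis using monomial_support[of id] by (simp add: projections_def)
qed

lemma adjoint_monomial_compose:
  assumes g: "g ` X \<subseteq> X" "inj_on g X" and c: "\<And>x. x \<in> X \<Longrightarrow> cmod (\<kappa> x) = 1"
  shows "op_adjoint (monomial X u \<kappa> g) o\<^sub>L monomial X u \<kappa> g = support"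
proof -
  have N1: "op_scale (\<kappa> x) (u (g x) o\<^sub>L op_adjoint (u x)) \<in> N" if "x \<in> X" for x using mD(5) g that by auto
  have "op_adjoint (monomial X u \<kappa> g) = (\<Sum>x\<in>X. op_scale (cnj (\<kappa> x)) (u x o\<^sub>L op_adjoint (u (g x))))"
    unfolding monomial_def using N1 mD(5) g by (simp add: adj_sum adj_simps image_subset_iff)
  hence "op_adjoint (monomial X u \<kappa> g) o\<^sub>L monomial X u \<kappa> g = (\<Sum>x\<in>X. op_scale (cnj (\<kappa> x) * \<kappa> x) (u x o\<^sub>L op_adjoint (u x)))"
    using g mD(5) by (simp add: blinfun_compose_sum op_scale_compose blinfun_assoc adjoint_apply_monomial)
  also have "\<dots> = support" unfolding support_eq
    using c by (intro sum.cong refl) (simp add: mult.commute complex_norm_square[symmetric] op_scale_compose)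
  finally show ?thesis .
qed

lemma norm_monomial_le:
  assumes g: "g ` X \<subseteq> X" "inj_on g X" and c: "\<And>x. x \<in> X \<Longrightarrow> cmod (\<kappa> x) = 1"
  shows "norm (monomial X u \<kappa> g) \<le> 1"
proof (rule partial_isometry_norm_le)
  show "monomial X u \<kappa> g \<in> N" using monomial_corner[OF g(1)] cornerD by blast
  show "monomial X u \<kappa> g o\<^sub>L (op_adjoint (monomial X u \<kappa> g) o\<^sub>L monomial X u \<kappa> g) = monomial X u \<kappa> g"
    using adjoint_monomial_compose[OF g c] monomial_support[OF g(1)] by simp
qed

lemma tr_support: "\<tau> support = of_nat (card X) * \<tau> f"
proof -
  have "\<tau> support = (\<Sum>x\<in>X. \<tau> (u x o\<^sub>L op_adjoint (u x)))" unfolding support_eq using mD(5) by (intro tr_sum) auto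
  also have "\<dots> = (\<Sum>x\<in>X. \<tau> f)"
  proof (rule sum.cong[OF refl])
    fix x assume x: "x \<in> X"
    have "\<tau> (u x o\<^sub>L op_adjoint (u x)) = \<tau> (op_adjoint (u x) o\<^sub>L u x)" using mD(5)[OF x] by (intro tr_comm) auto
    thus "\<tau> (u x o\<^sub>L op_adjoint (u x)) = \<tau> f" using mD(8)[OF x x] by simp
  qed
  finally show ?thesis by simp
qed

end

text \<open>The Hilbert-Schmidt norm computed by entries: expand both supports as sums of range
  projections and rotate each summand under the trace.\<close>

lemma n2_square_compress:
  assumes m: "matrix_system e f X u" and m': "matrix_system e' f' Y w" and T: "T \<in> N"
  shows "(n2 (monomial X u (\<lambda>_. 1) id o\<^sub>L T o\<^sub>L monomial Y w (\<lambda>_. 1) id))\<^sup>2 = (\<Sum>(x,y)\<in>X \<times> Y. (n2 (op_adjoint (u x) o\<^sub>L T o\<^sub>L w y))\<^sup>2)"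
proof -
  let ?s = "monomial X u (\<lambda>_. 1) id" and ?t = "monomial Y w (\<lambda>_. 1) id"
  note mD = matrix_systemD[OF m] and mD' = matrix_systemD[OF m']
  note sD = projectionsD[OF support_projection[OF m]] and tD = projectionsD[OF support_projection[OF m']]
  have "\<tau> (op_adjoint (?s o\<^sub>L T o\<^sub>L ?t) o\<^sub>L (?s o\<^sub>L T o\<^sub>L ?t)) = \<tau> (?t o\<^sub>L ((op_adjoint T o\<^sub>L (?s o\<^sub>L T)) o\<^sub>L ?t))"
    using T sD tD by (simp add: adj_simps blinfun_assoc projection_compose[OF support_projection[OF m]])
  also have "\<dots> = \<tau> (((op_adjoint T o\<^sub>L (?s o\<^sub>L T)) o\<^sub>L ?t) o\<^sub>L ?t)" using T sD tD by (intro tr_comm) auto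
  also have "\<dots> = \<tau> (op_adjoint T o\<^sub>L ?s o\<^sub>L T o\<^sub>L ?t)" using tD by (simp add: blinfun_assoc)
  also have "op_adjoint T o\<^sub>L ?s o\<^sub>L T o\<^sub>L ?t = (\<Sum>x\<in>X. \<Sum>y\<in>Y. op_adjoint T o\<^sub>L (u x o\<^sub>L op_adjoint (u x)) o\<^sub>L T o\<^sub>L (w y o\<^sub>L op_adjoint (w y)))"
    unfolding support_eq[OF m] support_eq[OF m'] by (simp add: blinfun_compose_sum) (rule sum.swap)
  also have "\<tau> \<dots> = (\<Sum>x\<in>X. \<Sum>y\<in>Y. \<tau> (op_adjoint T o\<^sub>L (u x o\<^sub>L op_adjoint (u x)) o\<^sub>L T o\<^sub>L (w y o\<^sub>L op_adjoint (w y))))"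
    using T mD(5) mD'(5) by (subst tr_sum) (auto intro!: sum.cong tr_sum)
  also have "\<dots> = (\<Sum>x\<in>X. \<Sum>y\<in>Y. \<tau> (op_adjoint (op_adjoint (u x) o\<^sub>L T o\<^sub>L w y) o\<^sub>L (op_adjoint (u x) o\<^sub>L T o\<^sub>L w y)))"
  proof (intro sum.cong refl)
    fix x y assume xy: "x \<in> X" "y \<in> Y"
    note uN = mD(5)[OF xy(1)] and wN = mD'(5)[OF xy(2)]
    have "\<tau> ((op_adjoint T o\<^sub>L (u x o\<^sub>L op_adjoint (u x)) o\<^sub>L T o\<^sub>L w y) o\<^sub>L op_adjoint (w y)) = \<tau> (op_adjoint (w y) o\<^sub>L (op_adjoint T o\<^sub>L (u x o\<^sub>L op_adjoint (u x)) o\<^sub>L T o\<^sub>L w y))"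
      using T uN wN by (intro tr_comm) auto
    thus "\<tau> (op_adjoint T o\<^sub>L (u x o\<^sub>L op_adjoint (u x)) o\<^sub>L T o\<^sub>L (w y o\<^sub>L op_adjoint (w y))) = \<tau> (op_adjoint (op_adjoint (u x) o\<^sub>L T o\<^sub>L w y) o\<^sub>L (op_adjoint (u x) o\<^sub>L T o\<^sub>L w y))"
      using T uN wN by (simp add: adj_simps blinfun_assoc)
  qed
  finally have tr: "\<tau> (op_adjoint (?s o\<^sub>L T o\<^sub>L ?t) o\<^sub>L (?s o\<^sub>L T o\<^sub>L ?t))
    = (\<Sum>x\<in>X. \<Sum>y\<in>Y. \<tau> (op_adjoint (op_adjoint (u x) o\<^sub>L T o\<^sub>L w y) o\<^sub>L (op_adjoint (u x) o\<^sub>L T o\<^sub>L w y)))" .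
  have "ip (?s o\<^sub>L T o\<^sub>L ?t) (?s o\<^sub>L T o\<^sub>L ?t) = (\<Sum>x\<in>X. \<Sum>y\<in>Y. ip (op_adjoint (u x) o\<^sub>L T o\<^sub>L w y) (op_adjoint (u x) o\<^sub>L T o\<^sub>L w y))"
    unfolding ip_def tr Re_sum by (rule refl)
  also have "\<dots> = (\<Sum>x\<in>X. \<Sum>y\<in>Y. (n2 (op_adjoint (u x) o\<^sub>L T o\<^sub>L w y))\<^sup>2)"
    using T mD(5) mD'(5) by (intro sum.cong refl) (simp add: n2_sq)
  finally show ?thesis using T sD tD by (simp add: n2_sq sum.cartesian_product)
qed

text \<open>Entries are read in row \<open>g x\<close> and column \<open>y\<close>, where the left
  factor picks up row \<open>x\<close> and the right factor column \<open>h y\<close>. The matrix of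
  \<open>b\<close> thus turns into a function on X x Y with a twisted action of (g, h).\<close>

lemma n2_square_commutator:
  assumes m: "matrix_system e f X u" and m': "matrix_system e' f' Y w" and b: "b \<in> N"
    and g: "g ` X \<subseteq> X" "inj_on g X" and h: "h ` Y \<subseteq> Y" "inj_on h Y"
  defines "s \<equiv> monomial X u (\<lambda>_. 1) id" and "t \<equiv> monomial Y w (\<lambda>_. 1) id"
  shows "(n2 ((monomial X u \<kappa> g o\<^sub>L b o\<^sub>L t) - (s o\<^sub>L b o\<^sub>L monomial Y w \<psi> h)))\<^sup>2
    = (\<Sum>(x,y)\<in>X \<times> Y. (n2 (op_scale (\<kappa> x) (op_adjoint (u x) o\<^sub>L b o\<^sub>L w y) - op_scale (\<psi> y) (op_adjoint (u (g x)) o\<^sub>L b o\<^sub>L w (h y))))\<^sup>2)"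
proof -
  note mD = matrix_systemD[OF m] and mD' = matrix_systemD[OF m']
  let ?A = "monomial X u \<kappa> g" and ?B = "monomial Y w \<psi> h"
  have bij: "bij_betw g X X" using g mD(1) by (metis bij_betw_def card_image card_subset_eq)
  have N: "?A \<in> N" "?B \<in> N" using monomial_corner[OF m g(1)] monomial_corner[OF m' h(1)] cornerD by blast+
  have "(?A o\<^sub>L b o\<^sub>L t) - (s o\<^sub>L b o\<^sub>L ?B) = s o\<^sub>L ((?A o\<^sub>L b) - (b o\<^sub>L ?B)) o\<^sub>L t"
    using support_monomial[OF m g, of \<kappa>] monomial_support[OF m' h(1), of \<psi>]
    by (simp add: s_def t_def blinfun_compose_simps blinfun_assoc) (simp flip: blinfun_assoc)
  hence "(n2 ((?A o\<^sub>L b o\<^sub>L t) - (s o\<^sub>L b o\<^sub>L ?B)))\<^sup>2 = (\<Sum>x\<in>X. \<Sum>y\<in>Y. (n2 (op_adjoint (u x) o\<^sub>L ((?A o\<^sub>L b) - (b o\<^sub>L ?B)) o\<^sub>L w y))\<^sup>2)"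
    unfolding s_def t_def using N b by (simp add: n2_square_compress[OF m m'] sum.cartesian_product)
  also have "\<dots> = (\<Sum>x\<in>X. \<Sum>y\<in>Y. (n2 (op_adjoint (u (g x)) o\<^sub>L ((?A o\<^sub>L b) - (b o\<^sub>L ?B)) o\<^sub>L w y))\<^sup>2)"
    by (rule sum.reindex_bij_betw[OF bij, symmetric])
  also have "\<dots> = (\<Sum>x\<in>X. \<Sum>y\<in>Y. (n2 (op_scale (\<kappa> x) (op_adjoint (u x) o\<^sub>L b o\<^sub>L w y) - op_scale (\<psi> y) (op_adjoint (u (g x)) o\<^sub>L b o\<^sub>L w (h y))))\<^sup>2)"
  proof (intro sum.cong refl)
    fix x y assume xy: "x \<in> X" "y \<in> Y"
    have 1: "op_adjoint (u (g x)) o\<^sub>L ((?A o\<^sub>L b) - (b o\<^sub>L ?B)) o\<^sub>L w y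
       = ((op_adjoint (u (g x)) o\<^sub>L ?A) o\<^sub>L b o\<^sub>L w y) - (op_adjoint (u (g x)) o\<^sub>L b o\<^sub>L (?B o\<^sub>L w y))"
      by (simp add: blinfun_compose_simps blinfun_assoc)
    have "op_adjoint (u (g x)) o\<^sub>L b \<in> bounded_operators" using mD(5) g xy b by auto
    thus "(n2 (op_adjoint (u (g x)) o\<^sub>L ((?A o\<^sub>L b) - (b o\<^sub>L ?B)) o\<^sub>L w y))\<^sup>2 = (n2 (op_scale (\<kappa> x) (op_adjoint (u x) o\<^sub>L b o\<^sub>L w y) - op_scale (\<psi> y) (op_adjoint (u (g x)) o\<^sub>L b o\<^sub>L w (h y))))\<^sup>2"
      unfolding 1 adjoint_apply_monomial[OF m g xy(1)] monomial_apply[OF m' h(1) xy(2)] by (simp add: op_scale_compose)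
  qed
  finally show ?thesis by (simp add: sum.cartesian_product)
qed

end

text \<open>Modulo a power of 2 a vector is primitive when one of its coordinates is odd. The set is
  empty for \<open>i = 0\<close>, which explains the assumptions \<open>i \<ge> 1\<close>
  below.\<close>

definition level :: "nat \<Rightarrow> (nat \<times> nat) set" where
  "level i = {(x, y). x < 2^i \<and> y < 2^i \<and> (odd x \<or> odd y)}"

definition shear1 :: "nat \<Rightarrow> nat \<times> nat \<Rightarrow> nat \<times> nat" where "shear1 i p = ((fst p + snd p) mod 2^i, snd p)"
definition shear2 :: "nat \<Rightarrow> nat \<times> nat \<Rightarrow> nat \<times> nat" where "shear2 i p = (fst p, (fst p + snd p) mod 2^i)"
definition coord1 :: "nat \<Rightarrow> nat \<times> nat \<Rightarrow> real" where "coord1 i p = real (fst p) / 2^i"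
definition coord2 :: "nat \<Rightarrow> nat \<times> nat \<Rightarrow> real" where "coord2 i p = real (snd p) / 2^i"

lemma finite_level: "finite (level i)"
proof (rule finite_subset)
  show "level i \<subseteq> {..<2^i} \<times> {..<2^i}" by (auto simp: level_def)
qed simp

text \<open>The vectors with odd first coordinate already make up half of all vectors.\<close>

lemma card_level: assumes "i \<ge> 1" shows "2 ^ (2 * i) \<le> 2 * card (level i)"
proof -
  obtain k where i: "i = Suc k" using assms by (cases i) auto
  have "(\<lambda>(a, y). (2 * a + 1, y)) ` ({..<2^k} \<times> {..<2^i}) \<subseteq> level i" by (auto simp: level_def i)
  hence "card ((\<lambda>(a::nat, y::nat). (2 * a + 1, y)) ` ({..<2^k} \<times> {..<2^i})) \<le> card (level i)"
    by (intro card_mono finite_level)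
  moreover have "card ((\<lambda>(a::nat, y::nat). (2 * a + 1, y)) ` ({..<2^k} \<times> {..<2^i})) = 2^k * 2^i"
    by (subst card_image) (auto simp: inj_on_def)
  moreover have "2 * i = Suc (k + i)" by (simp add: i)
  ultimately show ?thesis by (simp only: power_Suc power_add)
qed

lemma mod_add_cancel_less:
  assumes "(a + c) mod n = (b + c) mod n" "a < n" "b < n"
  shows "a = (b::nat)"
proof -
  have "a = b" if "a \<le> b" "(b + c) mod n = (a + c) mod n" "b < n" for a b
  proof -
    have "n dvd (b + c) - (a + c)" using that mod_eq_dvd_iff_nat[of "a + c" "b + c" n] by simp
    hence "n dvd b - a" by simp
    thus ?thesis using that by (auto dest: dvd_imp_le)
  qed
  from this[of a b] this[of b a] show ?thesis using assms by (metis nat_le_linear)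
qed

lemma mod_add_cancel_less':
  assumes "(c + a) mod n = (c + b) mod n" "a < n" "b < n"
  shows "a = (b::nat)"
  using mod_add_cancel_less[of a c n b] assms by (simp add: add.commute)

text \<open>Reduction modulo an even number keeps parity, and adding one coordinate to the other
  cannot make both even.\<close>

lemma shear_level:
  assumes "i \<ge> 1"
  shows "shear1 i ` level i \<subseteq> level i" "inj_on (shear1 i) (level i)" "shear2 i ` level i \<subseteq> level i" "inj_on (shear2 i) (level i)"
proof -
  have "even ((2::nat)^i)" using assms by simp
  hence par: "even (a mod 2^i) \<longleftrightarrow> even a" for a :: nat by (metis dvd_mod_iff)
  show "shear1 i ` level i \<subseteq> level i" "shear2 i ` level i \<subseteq> level i"
    by (auto simp: level_def shear1_def shear2_def par)
  show "inj_on (shear1 i) (level i)"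
    by (auto simp: inj_on_def level_def shear1_def dest: mod_add_cancel_less)
  show "inj_on (shear2 i) (level i)"
    by (auto simp: inj_on_def level_def shear2_def dest: mod_add_cancel_less')
qed

lemma mod_div_Ints: "real ((a + b) mod 2^i) / 2^i - (real a / 2^i + real b / 2^i) \<in> \<int>"
proof -
  have "real (a + b) = real ((a + b) div 2^i * 2^i + (a + b) mod 2^i)" by (simp only: div_mult_mod_eq)
  hence "real (a + b) = real ((a + b) div 2^i) * 2^i + real ((a + b) mod 2^i)" by simp
  hence "real ((a + b) mod 2^i) / 2^i - (real a / 2^i + real b / 2^i) = - real ((a + b) div 2^i)"
    by (simp add: field_simps)
  thus ?thesis by simp
qed

lemma coord_shear:
  "coord1 i (shear1 i p) - (coord1 i p + coord2 i p) \<in> \<int>" "coord2 i (shear1 i p) = coord2 i p"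
  "coord2 i (shear2 i p) - (coord1 i p + coord2 i p) \<in> \<int>" "coord1 i (shear2 i p) = coord1 i p"
  using mod_div_Ints by (simp_all add: shear1_def shear2_def coord1_def coord2_def)

text \<open>If both differences were integers, clearing the larger denominator would make both
  coordinates of the vector at the higher level even.\<close>

lemma coord_disjoint:
  assumes ij: "i \<noteq> j" and p: "p \<in> level i" and q: "q \<in> level j"
  shows "coord1 i p - coord1 j q \<notin> \<int> \<or> coord2 i p - coord2 j q \<notin> \<int>"
proof -
  have ev: "even (b::nat)" if ab: "a / 2^i - real b / 2^j \<in> \<int>" and a: "a \<in> \<int>" and ij: "i < j" for a b i j
  proof -
    obtain n where n: "a / 2^i - real b / 2^j = of_int n" using ab by (rule Ints_cases)
    obtain c where c: "a = of_int c" using a by (rule Ints_cases)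
    obtain k where k: "j = Suc (i + k)" using ij less_imp_Suc_add by blast
    have "real b = a * 2^(Suc k) - of_int n * 2^j"
      using n by (simp add: k field_simps power_add)
    hence "of_int (int b) = (of_int (c * 2^Suc k - n * 2^j) :: real)" by (simp add: c)
    hence "int b = c * 2^Suc k - n * 2^j" by (rule of_int_eq_iff[THEN iffD1])
    hence "even (int b)" by (simp add: k)
    thus ?thesis by simp
  qed
  show ?thesis
  proof (rule ccontr)
    assume "\<not> ?thesis"
    hence c: "coord1 i p - coord1 j q \<in> \<int>" "coord2 i p - coord2 j q \<in> \<int>" by auto
    hence c': "coord1 j q - coord1 i p \<in> \<int>" "coord2 j q - coord2 i p \<in> \<int>" using Ints_minus by fastforce+
    show False
    proof (cases "i < j")
      case True
      hence "even (fst q)" "even (snd q)" using c ev by (auto simp: coord1_def coord2_def)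
      thus False using q by (auto simp: level_def)
    next
      case False
      hence "even (fst p)" "even (snd p)" using c' ev ij by (auto simp: coord1_def coord2_def)
      thus False using p by (auto simp: level_def)
    qed
  qed
qed

section \<open>The gap for intertwiners between different levels\<close>

context tracial_vna
begin

lemma op_scale_diff_left: "op_scale c T - op_scale d T = op_scale (c - d) (T :: 'h op)"
  using op_scale_compose(6)[of c "-d" T] by (simp add: op_scale_minus_left)

lemma n2_abs_diff_le: "S \<in> N \<Longrightarrow> T \<in> N \<Longrightarrow> \<bar>n2 S - n2 T\<bar> \<le> n2 (S - T)"
  using n2_triangle[of "S - T" T] n2_triangle[of "T - S" S] n2_diff_commute[of S T] by auto

text \<open>Index 0 is the unit of the representation, 1 and 2 are the generators of the lattice, 3
  and 4 the elementary matrices; larger indices repeat 4, so bounds hold for every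
  \<open>k\<close>.\<close>

definition gen :: "nat \<Rightarrow> (nat \<times> nat \<Rightarrow> 'h op) \<Rightarrow> nat \<Rightarrow> 'h op" where
  "gen i u k = (if k = 0 then monomial (level i) u (\<lambda>_. 1) id
    else if k = 1 then monomial (level i) u (\<lambda>p. cis (2 * pi * coord1 i p)) id
    else if k = 2 then monomial (level i) u (\<lambda>p. cis (2 * pi * coord2 i p)) id
    else if k = 3 then monomial (level i) u (\<lambda>_. 1) (shear1 i)
    else monomial (level i) u (\<lambda>_. 1) (shear2 i))"

lemma gen_props:
  assumes m: "matrix_system e f (level i) u" and i: "i \<ge> 1"
  shows "gen i u k \<in> corner e" "norm (gen i u k) \<le> 1" "gen i u k o\<^sub>L gen i u 0 = gen i u k" "gen i u 0 o\<^sub>L gen i u k = gen i u k"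
    "gen i u 0 \<in> projections N"
proof -
  note sh = shear_level[OF i]
  have P: "monomial (level i) u \<kappa> g \<in> corner e \<and> norm (monomial (level i) u \<kappa> g) \<le> 1 \<and>
      monomial (level i) u \<kappa> g o\<^sub>L gen i u 0 = monomial (level i) u \<kappa> g \<and> gen i u 0 o\<^sub>L monomial (level i) u \<kappa> g = monomial (level i) u \<kappa> g"
    if "g ` level i \<subseteq> level i" "inj_on g (level i)" "\<And>x. cmod (\<kappa> x) = 1" for \<kappa> g
    using monomial_corner[OF m that(1)] norm_monomial_le[OF m that(1,2)] that(3) monomial_support[OF m that(1)] support_monomial[OF m that(1,2)]
    unfolding gen_def by simp
  have "gen i u k \<in> corner e \<and> norm (gen i u k) \<le> 1 \<and> gen i u k o\<^sub>L gen i u 0 = gen i u k \<and> gen i u 0 o\<^sub>L gen i u k = gen i u k"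
    unfolding gen_def[of i u k] using P[of id] P[OF sh(1,2)] P[OF sh(3,4)] by simp
  thus "gen i u k \<in> corner e" "norm (gen i u k) \<le> 1" "gen i u k o\<^sub>L gen i u 0 = gen i u k" "gen i u 0 o\<^sub>L gen i u k = gen i u k"
    by blast+
  show "gen i u 0 \<in> projections N" using support_projection[OF m] by (simp add: gen_def)
qed

text \<open>The k-th summand measures how far the compression of \<open>b\<close> between the two
  units is from intertwining \<open>A k\<close> and \<open>B k\<close>. The inequality is
  homogeneous in \<open>b\<close>, so no norm bound on \<open>b\<close> is imposed.\<close>

definition intertwiner_gap :: "(nat \<Rightarrow> 'h op) \<Rightarrow> (nat \<Rightarrow> 'h op) \<Rightarrow> bool" where
  "intertwiner_gap A B \<longleftrightarrow> (\<forall>b\<in>N. n2 (A 0 o\<^sub>L b o\<^sub>L B 0) \<le> 5 * (\<Sum>k=1..4. n2 ((A k o\<^sub>L b o\<^sub>L B 0) - (A 0 o\<^sub>L b o\<^sub>L B k))))"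

text \<open>Index the entries of \<open>b\<close> by pairs of vectors. The lattice generators
  multiply an entry by characters at the difference of the two coordinates, and the shears permute
  the pairs. Because the levels differ, no pair sits at the origin of the torus, and
  \<open>torus_gap\<close> applies to the 2-norms of the entries.\<close>

lemma gen_gap:
  assumes ij: "i \<noteq> j" "i \<ge> 1" "j \<ge> 1" and m: "matrix_system e f (level i) u" and m': "matrix_system e' f' (level j) w"
  shows "intertwiner_gap (gen i u) (gen j w)"
  unfolding intertwiner_gap_def
proof
  fix b assume b: "b \<in> N"
  note mD = matrix_systemD[OF m] and mD' = matrix_systemD[OF m']
  define Z where "Z = level i \<times> level j"
  define Y where "Y = (\<lambda>z. op_adjoint (u (fst z)) o\<^sub>L b o\<^sub>L w (snd z))"
  have YN: "Y z \<in> N" if "z \<in> Z" for z using that mD(5) mD'(5) b by (auto simp: Y_def Z_def)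
  define F where "F z = n2 (Y z)" for z
  \<comment> \<open>The representative modulo 1 in [-1/2, 1/2], as \<open>torus_gap\<close>
    requires.\<close>
  define cen where "cen r = r - of_int (round r)" for r :: real
  have cenI: "cen r - r \<in> \<int>" for r by (simp add: cen_def)
  have cen_b: "\<bar>cen r\<bar> \<le> 1/2" for r using of_int_round_abs_le[of r] by (simp add: cen_def abs_minus_commute)
  define \<theta>1 where "\<theta>1 z = cen (coord1 i (fst z) - coord1 j (snd z))" for z
  define \<theta>2 where "\<theta>2 z = cen (coord2 i (fst z) - coord2 j (snd z))" for z
  define G1 where "G1 = map_prod (shear1 i) (shear1 j)"
  define G2 where "G2 = map_prod (shear2 i) (shear2 j)"
  define \<delta> where "\<delta> k = n2 ((gen i u k o\<^sub>L b o\<^sub>L gen j w 0) - (gen i u 0 o\<^sub>L b o\<^sub>L gen j w k))" for k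
  have fin: "finite Z" by (simp add: Z_def finite_level)
  note sh = shear_level[OF ij(2)] and sh' = shear_level[OF ij(3)]
  have genN: "gen i u k \<in> N" "gen j w k \<in> N" for k
    using gen_props(1)[OF m ij(2)] gen_props(1)[OF m' ij(3)] cornerD(1) by blast+
  have \<delta>0: "0 \<le> \<delta> k" for k using genN b by (auto simp: \<delta>_def)
  have id: "id ` A \<subseteq> A" "inj_on id A" for A :: "(nat \<times> nat) set" by auto
  have cisd: "cmod (cis (2 * pi * a) - cis (2 * pi * c)) = cmod (cis (2 * pi * cen (a - c)) - 1)" for a c
  proof -
    obtain n where n: "cen (a - c) - (a - c) = of_int n" using cenI by (rule Ints_cases)
    have cn: "cen (a - c) = (a - c) + of_int n" using n by simp
    have "cis (2 * pi * cen (a - c)) = cis (2 * pi * (a - c)) * cis (2 * pi * of_int n)"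
      by (simp only: cn distrib_left cis_mult)
    also have "cis (2 * pi * of_int n) = 1" by (rule cis_multiple_2pi) simp
    finally have "cis (2 * pi * cen (a - c)) * cis (2 * pi * c) = cis (2 * pi * a)" by (simp add: cis_mult right_diff_distrib)
    hence "cis (2 * pi * a) - cis (2 * pi * c) = (cis (2 * pi * cen (a - c)) - 1) * cis (2 * pi * c)" by (simp only: left_diff_distrib mult_1)
    hence "cmod (cis (2 * pi * a) - cis (2 * pi * c)) = cmod (cis (2 * pi * cen (a - c)) - 1) * cmod (cis (2 * pi * c))" by (simp only: norm_mult)
    thus ?thesis by simp
  qed
  have bij: "bij_betw (map_prod g h) Z Z" if "g ` level i \<subseteq> level i" "inj_on g (level i)" "h ` level j \<subseteq> level j" "inj_on h (level j)" for g h
  proof -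
    have "inj_on (map_prod g h) Z" "map_prod g h ` Z \<subseteq> Z" using that unfolding Z_def by (auto intro: map_prod_inj_on)
    thus ?thesis using fin by (metis bij_betw_def card_image card_subset_eq)
  qed
  have e1: "(\<Sum>z\<in>Z. (cmod (cis (2 * pi * \<theta>1 z) - 1) * F z)\<^sup>2) = (\<delta> 1)\<^sup>2"
    unfolding \<delta>_def gen_def
    by (simp add: n2_square_commutator[OF m m' b id id] Z_def case_prod_unfold op_scale_diff_left)
      (auto intro!: sum.cong simp: n2_scale YN[unfolded Z_def Y_def, simplified] F_def Y_def \<theta>1_def cisd power_mult_distrib mD(5) mD'(5) b)
  have e2: "(\<Sum>z\<in>Z. (cmod (cis (2 * pi * \<theta>2 z) - 1) * F z)\<^sup>2) = (\<delta> 2)\<^sup>2"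
    unfolding \<delta>_def gen_def
    by (simp add: n2_square_commutator[OF m m' b id id] Z_def case_prod_unfold op_scale_diff_left)
      (auto intro!: sum.cong simp: n2_scale YN[unfolded Z_def Y_def, simplified] F_def Y_def \<theta>2_def cisd power_mult_distrib mD(5) mD'(5) b)
  \<comment> \<open>The reverse triangle inequality passes from operator-valued entries to their
    norms.\<close>
  have sq: "(F (G z) - F z)\<^sup>2 \<le> (n2 (Y z - Y (G z)))\<^sup>2" if "z \<in> Z" "G z \<in> Z" for G z
    using n2_abs_diff_le[OF YN[OF that(2)] YN[OF that(1)]] n2_diff_commute[OF YN[OF that(1)] YN[OF that(2)]]
    by (simp add: F_def abs_le_square_iff[symmetric] YN that)
  have d1: "(\<Sum>z\<in>Z. (F (G1 z) - F z)\<^sup>2) \<le> (\<delta> 3)\<^sup>2"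
  proof -
    have "(\<delta> 3)\<^sup>2 = (\<Sum>z\<in>Z. (n2 (Y z - Y (G1 z)))\<^sup>2)"
      by (simp add: \<delta>_def gen_def n2_square_commutator[OF m m' b sh(1,2) sh'(1,2)] Z_def case_prod_unfold op_scale_compose Y_def G1_def)
    moreover have "G1 z \<in> Z" if "z \<in> Z" for z using that sh(1) sh'(1) unfolding image_subset_iff by (auto simp: Z_def G1_def)
    ultimately show ?thesis using sq by (auto intro: sum_mono)
  qed
  have d2: "(\<Sum>z\<in>Z. (F (G2 z) - F z)\<^sup>2) \<le> (\<delta> 4)\<^sup>2"
  proof -
    have "(\<delta> 4)\<^sup>2 = (\<Sum>z\<in>Z. (n2 (Y z - Y (G2 z)))\<^sup>2)"
      by (simp add: \<delta>_def gen_def n2_square_commutator[OF m m' b sh(3,4) sh'(3,4)] Z_def case_prod_unfold op_scale_compose Y_def G2_def)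
    moreover have "G2 z \<in> Z" if "z \<in> Z" for z using that sh(3) sh'(3) unfolding image_subset_iff by (auto simp: Z_def G2_def)
    ultimately show ?thesis using sq by (auto intro: sum_mono)
  qed
  have "sqrt (\<Sum>z\<in>Z. (F z)\<^sup>2) \<le> 5 * (\<delta> 1 + \<delta> 2 + \<delta> 3 + \<delta> 4)"
  proof (rule torus_gap[where ?G1.0 = G1 and ?G2.0 = G2 and ?\<theta>1.0 = \<theta>1 and ?\<theta>2.0 = \<theta>2, OF fin])
    show "bij_betw G1 Z Z" "bij_betw G2 Z Z" unfolding G1_def G2_def using sh sh' by (auto intro: bij)
    fix z assume z: "z \<in> Z"
    show "\<bar>\<theta>1 z\<bar> \<le> 1/2" "\<bar>\<theta>2 z\<bar> \<le> 1/2" by (simp_all add: \<theta>1_def \<theta>2_def cen_b[simplified])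
    show "\<theta>1 z \<noteq> 0 \<or> \<theta>2 z \<noteq> 0"
    proof -
      have "r \<in> \<int>" if "cen r = 0" for r using that by (simp add: cen_def) (metis Ints_of_int eq_iff_diff_eq_0)
      thus ?thesis using coord_disjoint[OF ij(1), of "fst z" "snd z"] z by (auto simp: \<theta>1_def \<theta>2_def Z_def)
    qed
    have I3: "cen A - (cen B + cen C) \<in> \<int>" if "A - (B + C) \<in> \<int>" for A B C
    proof -
      have "cen A - (cen B + cen C) = (cen A - A) - (cen B - B) - (cen C - C) + (A - (B + C))" by simp
      also have "\<dots> \<in> \<int>" by (rule Ints_add[OF Ints_diff[OF Ints_diff[OF cenI cenI] cenI] that])
      finally show ?thesis .
    qed
    have I4: "(A - A') - ((B - B') + (C - C')) \<in> \<int>" if "A - (B + C) \<in> \<int>" "A' - (B' + C') \<in> \<int>" for A A' B B' C C' :: real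
    proof -
      have "(A - A') - ((B - B') + (C - C')) = (A - (B + C)) - (A' - (B' + C'))" by simp
      thus ?thesis using Ints_diff[OF that] by (simp only:)
    qed
    show "\<theta>1 (G1 z) - (\<theta>1 z + \<theta>2 z) \<in> \<int>" "\<theta>2 (G2 z) - (\<theta>1 z + \<theta>2 z) \<in> \<int>"
      unfolding \<theta>1_def \<theta>2_def G1_def G2_def fst_map_prod snd_map_prod by (rule I3 I4 coord_shear)+
    show "\<theta>2 (G1 z) = \<theta>2 z" "\<theta>1 (G2 z) = \<theta>1 z"
      by (simp_all add: \<theta>1_def \<theta>2_def G1_def G2_def coord_shear)
  qed (use e1 e2 d1 d2 \<delta>0 in auto)
  moreover have "n2 (gen i u 0 o\<^sub>L b o\<^sub>L gen j w 0) = sqrt (\<Sum>z\<in>Z. (F z)\<^sup>2)"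
  proof -
    have "(n2 (gen i u 0 o\<^sub>L b o\<^sub>L gen j w 0))\<^sup>2 = (\<Sum>z\<in>Z. (F z)\<^sup>2)"
      by (simp add: gen_def n2_square_compress[OF m m' b] Z_def F_def Y_def case_prod_unfold)
    thus ?thesis using genN b by (metis mult n2_nonneg real_sqrt_unique)
  qed
  moreover have "(\<Sum>k=1..4. \<delta> k) = \<delta> 1 + \<delta> 2 + \<delta> 3 + \<delta> (4::nat)" by (simp add: eval_nat_numeral)
  ultimately show "n2 (gen i u 0 o\<^sub>L b o\<^sub>L gen j w 0) \<le>
      5 * (\<Sum>k=1..4. n2 ((gen i u k o\<^sub>L b o\<^sub>L gen j w 0) - (gen i u 0 o\<^sub>L b o\<^sub>L gen j w k)))"
    unfolding \<delta>_def by simp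
qed

section \<open>Two orthogonal copies with uniform gap\<close>

lemma monomial_conj:
  assumes "v \<in> N" "\<And>x. x \<in> X \<Longrightarrow> u x \<in> N" "g ` X \<subseteq> X"
  shows "monomial X (\<lambda>x. v o\<^sub>L u x) \<kappa> g = v o\<^sub>L monomial X u \<kappa> g o\<^sub>L op_adjoint v"
  unfolding monomial_def blinfun_compose_sum using assms
  by (intro sum.cong refl) (auto simp: adj_simps op_scale_compose blinfun_assoc image_subset_iff)

lemma matrix_system_conj:
  assumes m: "matrix_system e f X u" and v: "v \<in> N" "op_adjoint v o\<^sub>L v = e"
  shows "matrix_system (v o\<^sub>L op_adjoint v) f X (\<lambda>x. v o\<^sub>L u x)"
proof -
  note mD = matrix_systemD[OF m]
  have ve: "v o\<^sub>L (e o\<^sub>L u x) = v o\<^sub>L u x" if "x \<in> X" for x using mD(4)[OF that] by simp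
  have vv: "op_adjoint v o\<^sub>L (v o\<^sub>L T) = e o\<^sub>L T" for T using v by (simp flip: blinfun_assoc)
  have "v o\<^sub>L op_adjoint v \<in> projections N"
  proof -
    have "n2 ((v o\<^sub>L e) - v) = 0"
    proof -
      have "op_adjoint ((v o\<^sub>L e) - v) o\<^sub>L ((v o\<^sub>L e) - v) = 0"
        using v projectionsD[OF mD(2)] by (simp add: adj_simps blinfun_compose_simps blinfun_assoc vv)
      thus ?thesis by (simp add: n2_def ip_def)
    qed
    hence "v o\<^sub>L e = v" using n2_eq_zero[of "(v o\<^sub>L e) - v"] v projectionsD[OF mD(2)] by auto
    hence "v o\<^sub>L (e o\<^sub>L T) = v o\<^sub>L T" for T by (simp flip: blinfun_assoc)
    thus ?thesis using v by (auto simp: projections_def adj_simps blinfun_assoc vv)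
  qed
  moreover have "op_adjoint (v o\<^sub>L u x) o\<^sub>L (v o\<^sub>L u y) = (if x = y then f else 0)" if "x \<in> X" "y \<in> X" for x y
    using that v mD(4,5,8) by (simp add: adj_simps blinfun_assoc vv)
  moreover have "(v o\<^sub>L op_adjoint v) o\<^sub>L (v o\<^sub>L u x) = v o\<^sub>L u x" if "x \<in> X" for x
    using ve[OF that] by (simp add: blinfun_assoc vv)
  ultimately show ?thesis using mD v by (auto simp: matrix_system_def blinfun_assoc)
qed

lemma gen_conj:
  assumes m: "matrix_system e f (level i) u" and i: "i \<ge> 1" and v: "v \<in> N"
  shows "gen i (\<lambda>x. v o\<^sub>L u x) k = v o\<^sub>L gen i u k o\<^sub>L op_adjoint v"
  using monomial_conj[of v "level i" u, OF v matrix_systemD(5)[OF m]] shear_level[OF i] unfolding gen_def by simp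

text \<open>Matrix units of size 4^i are available and at least half of them are indexed by
  primitive vectors, so at least half of the trace of \<open>e\<close> is used, whatever
  \<open>i\<close> is.\<close>

lemma level_system_exists:
  assumes e: "e \<in> projections N" and i: "i \<ge> 1"
    and ex: "\<And>q. q \<in> projections N \<Longrightarrow> q \<in> corner e \<Longrightarrow> q \<noteq> 0 \<Longrightarrow> \<exists>x\<in>corner q. x o\<^sub>L x = 0 \<and> x \<noteq> 0"
  shows "\<exists>f u. matrix_system e f (level i) u \<and> Re (\<tau> e) / 2 \<le> ip (gen i u 0) (gen i u 0)"
proof -
  obtain f and u :: "nat \<Rightarrow> 'h op" where f: "f \<in> projections N" "2 ^ (2 * i) * Re (\<tau> f) = Re (\<tau> e)"
    and u: "\<And>a. a < 2^(2 * i) \<Longrightarrow> u a \<in> corner e \<and> u a o\<^sub>L f = u a"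
    and uu: "\<And>a b. a < 2^(2 * i) \<Longrightarrow> b < 2^(2 * i) \<Longrightarrow> op_adjoint (u a) o\<^sub>L u b = (if a = b then f else 0)"
    using matrix_system_exists[OF e ex, of "2 * i"] by blast
  \<comment> \<open>The two coordinates are the digits of the index in base 2^i.\<close>
  define idx where "idx p = fst p + 2^i * snd p" for p :: "nat \<times> nat"
  have idx: "idx p < 2^(2 * i)" if "p \<in> level i" for p
  proof -
    have "fst p < 2^i" "Suc (snd p) \<le> 2^i" using that by (auto simp: level_def)
    hence "idx p < 2^i * Suc (snd p)" "2^i * Suc (snd p) \<le> 2^i * 2^i" by (auto simp: idx_def simp del: mult_Suc_right) simp
    thus ?thesis by (simp add: mult_2 power_add)
  qed
  have inj: "p = q" if "p \<in> level i" "q \<in> level i" "idx p = idx q" for p q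
  proof (rule prod_eqI)
    have l: "fst p < 2^i" "fst q < 2^i" using that by (auto simp: level_def)
    have "fst p = idx p mod 2^i" "fst q = idx q mod 2^i" using l by (simp_all add: idx_def)
    thus "fst p = fst q" using that by simp
    thus "snd p = snd q" using that by (simp add: idx_def)
  qed
  define u' where "u' p = u (idx p)" for p
  have m: "matrix_system e f (level i) u'"
    unfolding matrix_system_def u'_def
  proof (intro conjI ballI finite_level e f)
    fix p assume p: "p \<in> level i"
    show "u (idx p) \<in> N" "e o\<^sub>L u (idx p) = u (idx p)" "u (idx p) o\<^sub>L f = u (idx p)" using u[OF idx[OF p]] by (auto simp: cornerD)
    fix q assume q: "q \<in> level i"
    show "op_adjoint (u (idx p)) o\<^sub>L u (idx q) = (if p = q then f else 0)"
      using uu[OF idx[OF p] idx[OF q]] inj[OF p q] by auto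
  qed
  have "Re (\<tau> f) \<ge> 0" using tr_sq(2)[of f] projectionsD[OF f(1)] by simp
  have "Re (\<tau> e) = real (2 ^ (2 * i)) * Re (\<tau> f)" using f by simp
  also have "\<dots> \<le> real (2 * card (level i)) * Re (\<tau> f)" using card_level[OF i] \<open>Re (\<tau> f) \<ge> 0\<close> by (intro mult_right_mono) (simp_all only: of_nat_le_iff)
  also have "\<dots> = 2 * Re (\<tau> (gen i u' 0))" using tr_support[OF m] by (simp add: gen_def)
  also have "Re (\<tau> (gen i u' 0)) = ip (gen i u' 0) (gen i u' 0)"
    using projectionsD[OF gen_props(5)[OF m i]] by (simp add: ip_def)
  finally show ?thesis using m by (intro exI[of _ f] exI[of _ u']) simp
qed

text \<open>\<open>e o\<^sub>L v = 0\<close> makes the final projection of \<open>v\<close>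
  orthogonal to \<open>e\<close>, so conjugation by \<open>v\<close> yields the second, orthogonal
  copy. The bound \<open>c\<close> does not depend on \<open>i\<close>.\<close>

definition separated_family :: "'h op \<Rightarrow> 'h op \<Rightarrow> (nat \<Rightarrow> nat \<Rightarrow> 'h op) \<Rightarrow> real \<Rightarrow> bool" where
  "separated_family e v L c \<longleftrightarrow> c > 0 \<and> e \<in> N \<and> v \<in> N \<and> norm v \<le> 1 \<and>
    op_adjoint v o\<^sub>L v = e \<and> v o\<^sub>L e = v \<and> e o\<^sub>L v = 0 \<and>
    (\<forall>i k. L i k \<in> corner e \<and> norm (L i k) \<le> 1 \<and> L i k o\<^sub>L L i 0 = L i k \<and> L i 0 o\<^sub>L L i k = L i k) \<and>
    (\<forall>i. c \<le> n2 (L i 0)) \<and>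
    (\<forall>i j. i \<noteq> j \<longrightarrow> intertwiner_gap (L i) (\<lambda>k. v o\<^sub>L L j k o\<^sub>L op_adjoint v))"

lemma separated_family_exists:
  assumes "has_type_II1_summand N"
  shows "\<exists>e v L c. separated_family e v L c"
proof -
  obtain z where z: "z \<in> central_projections N" "z \<noteq> 0" "type_II ((\<lambda>T. z o\<^sub>L T) ` N)"
    using assms by (auto simp: has_type_II1_summand_def type_II1_def)
  have zP: "z \<in> projections N" using z by (auto simp: central_projections_def)
  have ex: "\<exists>x\<in>corner q. x o\<^sub>L x = 0 \<and> x \<noteq> 0" if q: "q \<in> projections N" "q \<in> corner z" "q \<noteq> 0" for q
    using nonabelian_corners_if_type_II[OF vna_axioms z(1,3) q(1) cornerD(2)[OF q(2)] q(3)] nilpotent_exists[OF q(1)] by blast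
  obtain v where v: "v \<in> nil_pi z" "rest z v = 0" using halving[OF zP ex] by blast
  note vD = nil_piD[OF v(1) zP]
  define e where "e = op_adjoint v o\<^sub>L v"
  have e: "e \<in> projections N" using vD by (auto simp: e_def projections_def adj_simps blinfun_assoc)
  have ez: "e \<in> corner z" using v zP nil_piD(11)[OF v(1) zP] by (auto simp: e_def nil_pi_def intro!: corner_closed(5))
  have "v \<noteq> 0" using v z by (auto simp: rest_def)
  hence "ip v v \<noteq> 0" using n2_eq_zero[of v] vD by (auto simp: n2_def)
  hence te: "Re (\<tau> e) > 0" using ip_nonneg[of v] vD by (simp add: ip_def e_def)
  have "\<exists>f u. matrix_system e f (level (Suc i)) u \<and> Re (\<tau> e) / 2 \<le> ip (gen (Suc i) u 0) (gen (Suc i) u 0)" for i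
    using ex corner_trans[OF ez] by (intro level_system_exists[OF e]) auto
  then obtain f u where m: "\<And>i. matrix_system e (f i) (level (Suc i)) (u i)"
    and l: "\<And>i. Re (\<tau> e) / 2 \<le> ip (gen (Suc i) (u i) 0) (gen (Suc i) (u i) 0)" by metis
  \<comment> \<open>The shift by one avoids the empty level 0.\<close>
  define L where "L i k = gen (Suc i) (u i) k" for i k
  define c where "c = sqrt (Re (\<tau> e) / 2)"
  have vL: "(\<lambda>k. v o\<^sub>L L j k o\<^sub>L op_adjoint v) = gen (Suc j) (\<lambda>x. v o\<^sub>L u j x)" for j
    using gen_conj[OF m _ vD(1), of j] by (simp add: L_def fun_eq_iff)
  have m': "matrix_system (v o\<^sub>L op_adjoint v) (f j) (level (Suc j)) (\<lambda>x. v o\<^sub>L u j x)" for j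
    by (rule matrix_system_conj[OF m vD(1)]) (simp add: e_def)
  have gap: "intertwiner_gap (L i) (\<lambda>k. v o\<^sub>L L j k o\<^sub>L op_adjoint v)" if "i \<noteq> j" for i j
    unfolding vL unfolding L_def using that by (intro gen_gap[OF _ _ _ m m']) auto
  have c: "c > 0" "c \<le> n2 (L i 0)" for i using te l[of i] by (simp_all add: c_def n2_def L_def)
  have ve: "v o\<^sub>L e = v" "e o\<^sub>L v = 0" using vD by (simp_all add: e_def blinfun_assoc)
  have nv: "norm v \<le> 1" using vD by (intro partial_isometry_norm_le)
  have Lp: "L i k \<in> corner e" "norm (L i k) \<le> 1" "L i k o\<^sub>L L i 0 = L i k" "L i 0 o\<^sub>L L i k = L i k" for i k
    using gen_props(1-4)[OF m, of i k] by (simp_all add: L_def)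
  show ?thesis
    by (rule exI[of _ e], rule exI[of _ v], rule exI[of _ L], rule exI[of _ c], unfold separated_family_def, intro conjI allI impI)
      (rule c projectionsD(1)[OF e] vD(1) nv e_def[symmetric] ve Lp gap | assumption)+
qed

end

section \<open>Tracial ultrapowers\<close>

text \<open>Stated for an arbitrary filter because it serves both \<open>U\<close> and the product
  filter.\<close>

lemma continuous_connective_tendsto:
  assumes f: "continuous_connective m f" and g: "\<And>i. i < m \<Longrightarrow> ((\<lambda>n. g n i) \<longlongrightarrow> l i) F"
  shows "((\<lambda>n. f (map (g n) [0..<m])) \<longlongrightarrow> f (map l [0..<m])) F"
proof -
  \<comment> \<open>Convergence in the product topology concerns all coordinates, including those
    from \<open>m\<close> on, so these are set to 0.\<close>
  define h where "h n i = (if i < m then g n i else 0)" for n i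
  define l' where "l' i = (if i < m then l i else 0)" for i
  have c: "((\<lambda>n. h n i) \<longlongrightarrow> l' i) F" for i using g by (cases "i < m") (simp_all add: h_def l'_def)
  have "limitin (product_topology (\<lambda>i. euclidean) UNIV) h l' F"
    unfolding limitin_componentwise using c by (simp add: h_def)
  hence "(h \<longlongrightarrow> l') F" unfolding euclidean_product_topology by simp
  moreover have "isCont (\<lambda>v :: nat \<Rightarrow> real. f (map v [0..<m])) l'"
    using f by (simp add: continuous_connective_def continuous_on_eq_continuous_at)
  ultimately have "((\<lambda>n. f (map (h n) [0..<m])) \<longlongrightarrow> f (map l' [0..<m])) F"
    by (rule isCont_tendsto_compose[rotated])
  moreover have "map (h n) [0..<m] = map (g n) [0..<m]" "map l' [0..<m] = map l [0..<m]" for n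
    by (simp_all add: h_def l'_def)
  ultimately show ?thesis by simp
qed

lemma ultrafilter_tendsto_compact:
  fixes X :: "nat \<Rightarrow> 'b::topological_space"
  assumes U: "nonprincipal_ultrafilter U" and K: "compact K" and X: "\<And>n. X n \<in> K"
  shows "\<exists>l\<in>K. (X \<longlongrightarrow> l) U"
proof -
  have "filtermap X U \<noteq> bot" using U by (simp add: nonprincipal_ultrafilter_def filtermap_bot_iff)
  moreover have "eventually (\<lambda>x. x \<in> K) (filtermap X U)" using X by (simp add: eventually_filtermap)
  ultimately obtain l where l: "l \<in> K" "inf (nhds l) (filtermap X U) \<noteq> bot" using K unfolding compact_filter by blast
  have "eventually (\<lambda>n. P (X n)) U" if P: "eventually P (nhds l)" for P
  proof (rule ccontr)
    assume "\<not> ?thesis"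
    hence "eventually (\<lambda>n. \<not> P (X n)) U" using U by (auto simp: nonprincipal_ultrafilter_def)
    hence "eventually (\<lambda>x. False) (inf (nhds l) (filtermap X U))"
      using P unfolding eventually_inf by (intro exI[of _ P] exI[of _ "\<lambda>x. \<not> P x"]) (simp add: eventually_filtermap)
    thus False using l by (simp add: trivial_limit_def)
  qed
  thus ?thesis using l by (auto simp: filterlim_iff)
qed

text \<open>An ultrafilter containing a singleton is principal, so \<open>U\<close> avoids every
  point and hence every initial segment.\<close>

lemma ultrafilter_le_sequentially:
  assumes U: "nonprincipal_ultrafilter U" shows "U \<le> sequentially"
proof -
  have ne: "eventually (\<lambda>n. n \<noteq> k) U" for k
  proof (rule ccontr)
    assume "\<not> ?thesis"
    hence k: "eventually (\<lambda>n. n = k) U" using U by (auto simp: nonprincipal_ultrafilter_def)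
    have "U = principal {k}"
    proof (rule antisym)
      show "U \<le> principal {k}" using k by (simp add: le_principal)
      show "principal {k} \<le> U"
      proof (rule filter_leI)
        fix P assume "eventually P U"
        hence "eventually (\<lambda>n. P n \<and> n = k) U" using k by (rule eventually_conj)
        hence "\<exists>n. P n \<and> n = k" using U by (intro eventually_happens'[of U]) (auto simp: nonprincipal_ultrafilter_def)
        thus "eventually P (principal {k})" by (simp add: eventually_principal)
      qed
    qed
    thus False using U by (simp add: nonprincipal_ultrafilter_def)
  qed
  have "eventually (\<lambda>n. k \<le> n) U" for k
  proof (induction k)
    case (Suc k) show ?case using eventually_conj[OF Suc ne[of k]] by (rule eventually_mono) auto
  qed simp
  thus ?thesis by (intro filter_leI) (metis (mono_tags, lifting) eventually_mono eventually_sequentially)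
qed

section \<open>Ultrapower operations computed on arbitrary representatives\<close>

locale tracial_ultra = tracial_vna N \<tau> for N :: "'h::complex_hilbert_space op set" and \<tau> +
  fixes U :: "nat filter"
  assumes U: "nonprincipal_ultrafilter U"
begin

abbreviation "S \<equiv> vn_structure N \<tau>"
abbreviation "SU \<equiv> tracial_ultrapower U S"
abbreviation "bs \<equiv> bounded_sequences S"
abbreviation "cl \<equiv> ultra_class U S"

lemma U_bot [simp]: "U \<noteq> bot" using U by (simp add: nonprincipal_ultrafilter_def)

lemma op_scale_minus_one [simp]: "op_scale (- 1) T = - (T :: 'h op)"
  using op_scale_of_real[of "-1" T] by simp

lemma S_simps [simp]:
  "ts_carrier S = N" "ts_zero S = 0" "ts_one S = id_blinfun" "ts_add S = (+)" "ts_mult S = (o\<^sub>L)" "ts_scale S = op_scale"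
  "ts_star S = op_adjoint" "ts_trace S = \<tau>" "ts_norm S = norm"
  by (simp_all add: vn_structure_def)

lemma S_dist [simp]: "ts_dist S x y = n2 (x - y)"
  by (simp add: ts_dist_def ts_norm2_def n2_def ip_def)

lemma bsI: "(\<And>n. a n \<in> N) \<Longrightarrow> (\<And>n. norm (a n) \<le> B) \<Longrightarrow> a \<in> bs"
  by (auto simp: bounded_sequences_def intro!: bdd_aboveI[of _ B])

lemma bs_bound: assumes "a \<in> bs" shows "\<exists>B. 0 \<le> B \<and> (\<forall>n. a n \<in> N) \<and> (\<forall>n. norm (a n) \<le> B)"
proof -
  from assms obtain B where B: "\<And>n. a n \<in> N" "\<And>n. norm (a n) \<le> B" by (auto simp: bounded_sequences_def bdd_above_def)
  thus ?thesis using order_trans[OF norm_ge_zero B(2)] by blast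
qed

lemma bs_N: "a \<in> bs \<Longrightarrow> a n \<in> N" using bs_bound by blast

lemma bs_const: "T \<in> N \<Longrightarrow> (\<lambda>_. T) \<in> bs" by (rule bsI[of _ "norm T"]) auto

lemma bs_add: assumes "a \<in> bs" "b \<in> bs" shows "(\<lambda>n. a n + b n) \<in> bs"
proof -
  obtain A where A: "\<And>n. a n \<in> N" "\<And>n. norm (a n) \<le> A" using bs_bound[OF assms(1)] by blast
  obtain B where B: "\<And>n. b n \<in> N" "\<And>n. norm (b n) \<le> B" using bs_bound[OF assms(2)] by blast
  show ?thesis using A B by (intro bsI[of _ "A + B"]) (auto intro: norm_triangle_mono)
qed

lemma bs_scale: assumes "a \<in> bs" shows "(\<lambda>n. op_scale c (a n)) \<in> bs"
proof -
  obtain A where A: "\<And>n. a n \<in> N" "\<And>n. norm (a n) \<le> A" using bs_bound[OF assms] by blast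
  show ?thesis using A by (intro bsI[of _ "cmod c * A"]) (auto intro!: order_trans[OF norm_op_scale_le] mult_left_mono)
qed

lemma bs_diff: assumes "a \<in> bs" "b \<in> bs" shows "(\<lambda>n. a n - b n) \<in> bs"
  using bs_add[OF assms(1) bs_scale[OF assms(2), of "-1"]] by simp

lemma bs_mult: assumes "a \<in> bs" "b \<in> bs" shows "(\<lambda>n. a n o\<^sub>L b n) \<in> bs"
proof -
  obtain A where A: "\<And>n. a n \<in> N" "\<And>n. norm (a n) \<le> A" "0 \<le> A" using bs_bound[OF assms(1)] by blast
  obtain B where B: "\<And>n. b n \<in> N" "\<And>n. norm (b n) \<le> B" using bs_bound[OF assms(2)] by blast
  show ?thesis using A B by (intro bsI[of _ "A * B"]) (auto intro!: order_trans[OF norm_blinfun_compose] mult_mono)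
qed

lemma bs_star: assumes "a \<in> bs" shows "(\<lambda>n. op_adjoint (a n)) \<in> bs"
proof -
  obtain A where A: "\<And>n. a n \<in> N" "\<And>n. norm (a n) \<le> A" using bs_bound[OF assms] by blast
  show ?thesis using A by (intro bsI[of _ A]) (auto simp: norm_op_adjoint)
qed

lemma rel_iff: "(a, b) \<in> ultra_rel U S \<longleftrightarrow> a \<in> bs \<and> b \<in> bs \<and> ((\<lambda>n. n2 (a n - b n)) \<longlongrightarrow> 0) U"
  by (simp add: ultra_rel_def)

lemma null_if_le:
  assumes g: "(g \<longlongrightarrow> 0) U" and f: "\<And>n. 0 \<le> f n" "\<And>n. f n \<le> (g n :: real)"
  shows "(f \<longlongrightarrow> 0) U"
  by (rule tendsto_sandwich[OF always_eventually always_eventually tendsto_const g]) (use f in auto)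

lemma rel_refl: "a \<in> bs \<Longrightarrow> (a, a) \<in> ultra_rel U S" by (simp add: rel_iff)

lemma rel_sym: "(a, b) \<in> ultra_rel U S \<Longrightarrow> (b, a) \<in> ultra_rel U S"
proof -
  assume ab: "(a, b) \<in> ultra_rel U S"
  hence "n2 (b n - a n) = n2 (a n - b n)" for n by (auto simp: rel_iff bs_N intro: n2_diff_commute)
  thus "(b, a) \<in> ultra_rel U S" using ab by (simp add: rel_iff)
qed

lemma rel_trans:
  assumes "(a, b) \<in> ultra_rel U S" "(b, c) \<in> ultra_rel U S" shows "(a, c) \<in> ultra_rel U S"
proof -
  have "((\<lambda>n. n2 (a n - b n) + n2 (b n - c n)) \<longlongrightarrow> 0 + 0) U" using assms by (intro tendsto_add) (auto simp: rel_iff)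
  hence "((\<lambda>n. n2 (a n - b n) + n2 (b n - c n)) \<longlongrightarrow> 0) U" by simp
  hence "((\<lambda>n. n2 (a n - c n)) \<longlongrightarrow> 0) U"
    by (rule null_if_le) (use assms bs_N n2_diff_triangle in \<open>auto simp: rel_iff\<close>)
  thus ?thesis using assms by (simp add: rel_iff)
qed

lemma cl_eqI: "(a, b) \<in> ultra_rel U S \<Longrightarrow> cl a = cl b"
proof (rule set_eqI)
  fix c assume "(a, b) \<in> ultra_rel U S"
  thus "c \<in> cl a \<longleftrightarrow> c \<in> cl b"
    using rel_trans[of a b c] rel_trans[of b a c] rel_sym[of a b] by (auto simp: ultra_class_def)
qed

lemma mem_cl: "b \<in> cl a \<longleftrightarrow> (a, b) \<in> ultra_rel U S" by (simp add: ultra_class_def)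

lemma rep_cl: assumes "a \<in> bs" shows "(a, ultra_rep (cl a)) \<in> ultra_rel U S"
proof -
  have "a \<in> cl a" using rel_refl[OF assms] by (simp add: mem_cl)
  hence "ultra_rep (cl a) \<in> cl a" unfolding ultra_rep_def by (rule someI[where P = "\<lambda>b. b \<in> cl a"])
  thus ?thesis by (simp add: mem_cl)
qed

lemma rep_bs: "a \<in> bs \<Longrightarrow> ultra_rep (cl a) \<in> bs"
  and rep_lim: "a \<in> bs \<Longrightarrow> ((\<lambda>n. n2 (ultra_rep (cl a) n - a n)) \<longlongrightarrow> 0) U"
  using rep_cl[of a] rel_sym[OF rep_cl[of a]] by (auto simp: rel_iff)

lemma SU_carrierE: assumes "x \<in> ts_carrier SU" obtains a where "a \<in> bs" "x = cl a"
  using assms by (auto simp: tracial_ultrapower_def ultra_class_def elim!: quotientE)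

lemma SU_add: assumes a: "a \<in> bs" and b: "b \<in> bs" shows "ts_add SU (cl a) (cl b) = cl (\<lambda>n. a n + b n)"
proof -
  let ?a = "ultra_rep (cl a)" and ?b = "ultra_rep (cl b)"
  note N = bs_N[OF a] bs_N[OF b] bs_N[OF rep_bs[OF a]] bs_N[OF rep_bs[OF b]]
  have "((\<lambda>n. n2 (?a n - a n) + n2 (?b n - b n)) \<longlongrightarrow> 0) U" using tendsto_add[OF rep_lim[OF a] rep_lim[OF b]] by simp
  hence "((\<lambda>n. n2 ((?a n + ?b n) - (a n + b n))) \<longlongrightarrow> 0) U"
  proof (rule null_if_le)
    fix n
    have "(?a n + ?b n) - (a n + b n) = (?a n - a n) + (?b n - b n)" by simp
    thus "n2 ((?a n + ?b n) - (a n + b n)) \<le> n2 (?a n - a n) + n2 (?b n - b n)" using N by (metis diff n2_triangle)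
  qed (use N in auto)
  hence "cl (\<lambda>n. ?a n + ?b n) = cl (\<lambda>n. a n + b n)" using a b rep_bs by (intro cl_eqI) (simp add: rel_iff bs_add)
  thus ?thesis by (simp add: tracial_ultrapower_def)
qed

lemma SU_mult: assumes a: "a \<in> bs" and b: "b \<in> bs" shows "ts_mult SU (cl a) (cl b) = cl (\<lambda>n. a n o\<^sub>L b n)"
proof -
  let ?a = "ultra_rep (cl a)" and ?b = "ultra_rep (cl b)"
  note N = bs_N[OF a] bs_N[OF b] bs_N[OF rep_bs[OF a]] bs_N[OF rep_bs[OF b]]
  obtain A where A: "\<And>n. norm (a n) \<le> A" using bs_bound[OF a] by blast
  obtain B where B: "\<And>n. norm (?b n) \<le> B" using bs_bound[OF rep_bs[OF b]] by blast
  have "((\<lambda>n. n2 (?a n - a n) * B + A * n2 (?b n - b n)) \<longlongrightarrow> 0 * B + A * 0) U"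
    by (intro tendsto_intros rep_lim a b)
  hence "((\<lambda>n. n2 (?a n - a n) * B + A * n2 (?b n - b n)) \<longlongrightarrow> 0) U" by simp
  hence "((\<lambda>n. n2 ((?a n o\<^sub>L ?b n) - (a n o\<^sub>L b n))) \<longlongrightarrow> 0) U"
  proof (rule null_if_le)
    fix n
    have "(?a n o\<^sub>L ?b n) - (a n o\<^sub>L b n) = ((?a n - a n) o\<^sub>L ?b n) + (a n o\<^sub>L (?b n - b n))" by (simp add: blinfun_compose_simps)
    hence "n2 ((?a n o\<^sub>L ?b n) - (a n o\<^sub>L b n)) \<le> n2 ((?a n - a n) o\<^sub>L ?b n) + n2 (a n o\<^sub>L (?b n - b n))"
      using N by (metis diff mult n2_triangle)
    also have "\<dots> \<le> n2 (?a n - a n) * norm (?b n) + norm (a n) * n2 (?b n - b n)"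
      using N by (intro add_mono n2_mult_left n2_mult_right) auto
    also have "\<dots> \<le> n2 (?a n - a n) * B + A * n2 (?b n - b n)"
      using A B N by (intro add_mono mult_left_mono mult_right_mono) auto
    finally show "n2 ((?a n o\<^sub>L ?b n) - (a n o\<^sub>L b n)) \<le> n2 (?a n - a n) * B + A * n2 (?b n - b n)" .
  qed (use N in auto)
  hence "cl (\<lambda>n. ?a n o\<^sub>L ?b n) = cl (\<lambda>n. a n o\<^sub>L b n)" using a b rep_bs by (intro cl_eqI) (simp add: rel_iff bs_mult)
  thus ?thesis by (simp add: tracial_ultrapower_def)
qed

lemma SU_scale: assumes a: "a \<in> bs" shows "ts_scale SU c (cl a) = cl (\<lambda>n. op_scale c (a n))"
proof -
  let ?a = "ultra_rep (cl a)"
  note N = bs_N[OF a] bs_N[OF rep_bs[OF a]]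
  have "((\<lambda>n. cmod c * n2 (?a n - a n)) \<longlongrightarrow> cmod c * 0) U" by (intro tendsto_intros rep_lim a)
  hence "((\<lambda>n. n2 (op_scale c (?a n) - op_scale c (a n))) \<longlongrightarrow> 0) U"
    using N by (simp add: n2_scale flip: op_scale_diff)
  hence "cl (\<lambda>n. op_scale c (?a n)) = cl (\<lambda>n. op_scale c (a n))" using a rep_bs by (intro cl_eqI) (simp add: rel_iff bs_scale)
  thus ?thesis by (simp add: tracial_ultrapower_def)
qed

lemma SU_star: assumes a: "a \<in> bs" shows "ts_star SU (cl a) = cl (\<lambda>n. op_adjoint (a n))"
proof -
  let ?a = "ultra_rep (cl a)"
  note N = bs_N[OF a] bs_N[OF rep_bs[OF a]]
  have "n2 (op_adjoint (?a n) - op_adjoint (a n)) = n2 (?a n - a n)" for n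
    using N n2_adj[of "?a n - a n"] by (simp add: adj_simps)
  hence "((\<lambda>n. n2 (op_adjoint (?a n) - op_adjoint (a n))) \<longlongrightarrow> 0) U" using rep_lim[OF a] by simp
  hence "cl (\<lambda>n. op_adjoint (?a n)) = cl (\<lambda>n. op_adjoint (a n))" using a rep_bs by (intro cl_eqI) (simp add: rel_iff bs_star)
  thus ?thesis by (simp add: tracial_ultrapower_def)
qed

lemma SU_const: "ts_zero SU = cl (\<lambda>_. 0)" "ts_one SU = cl (\<lambda>_. id_blinfun)"
  by (simp_all add: tracial_ultrapower_def)

text \<open>\<open>Lim\<close> means something only once a limit exists. Existence comes from
  compactness, as the traces of a bounded sequence stay in a disc; independence of the chosen
  representative comes from the 2-norm bound on the trace.\<close>

lemma SU_trace: assumes a: "a \<in> bs" shows "((\<lambda>n. \<tau> (a n)) \<longlongrightarrow> ts_trace SU (cl a)) U"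
proof -
  let ?a = "ultra_rep (cl a)"
  note N = bs_N[OF a] bs_N[OF rep_bs[OF a]]
  obtain B where B: "\<And>n. norm (?a n) \<le> B" using bs_bound[OF rep_bs[OF a]] by blast
  have "\<tau> (?a n) \<in> cball 0 B" for n
    using tr_le_n2[of "?a n"] n2_le_norm[of "?a n"] N B[of n] by simp
  then obtain l where l: "((\<lambda>n. \<tau> (?a n)) \<longlongrightarrow> l) U"
    using ultrafilter_tendsto_compact[OF U compact_cball, of "\<lambda>n. \<tau> (?a n)" 0 B] by blast
  have "((\<lambda>n. norm (\<tau> (a n) - \<tau> (?a n))) \<longlongrightarrow> 0) U"
  proof (rule null_if_le[OF rep_lim[OF a]])
    fix n
    have "norm (\<tau> (a n) - \<tau> (?a n)) = cmod (\<tau> (?a n - a n))" using N by (simp add: tr_diff norm_minus_commute)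
    thus "norm (\<tau> (a n) - \<tau> (?a n)) \<le> n2 (?a n - a n)" using N tr_le_n2 by simp
  qed simp
  hence "((\<lambda>n. \<tau> (a n) - \<tau> (?a n)) \<longlongrightarrow> 0) U" by (rule tendsto_norm_zero_cancel)
  from tendsto_add[OF this l] have "((\<lambda>n. \<tau> (a n)) \<longlongrightarrow> l) U" by simp
  moreover have "ts_trace SU (cl a) = l" using l by (simp add: tracial_ultrapower_def tendsto_Lim)
  ultimately show ?thesis by simp
qed

lemma SU_dist: assumes a: "a \<in> bs" and b: "b \<in> bs" shows "((\<lambda>n. n2 (a n - b n)) \<longlongrightarrow> ts_dist SU (cl a) (cl b)) U"
proof -
  define d where "d n = a n - b n" for n
  have d: "d \<in> bs" unfolding d_def using a b by (rule bs_diff)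
  have "ts_add SU (cl a) (ts_scale SU (- 1) (cl b)) = cl d"
    using a b by (simp add: SU_scale SU_add bs_scale d_def[abs_def] del: op_scale_minus_one) (simp add: d_def[abs_def])
  hence "ts_dist SU (cl a) (cl b) = sqrt (Re (ts_trace SU (cl (\<lambda>n. op_adjoint (d n) o\<^sub>L d n))))"
    using d by (simp add: ts_dist_def ts_norm2_def SU_star SU_mult bs_star)
  moreover have "((\<lambda>n. sqrt (Re (\<tau> (op_adjoint (d n) o\<^sub>L d n)))) \<longlongrightarrow> sqrt (Re (ts_trace SU (cl (\<lambda>n. op_adjoint (d n) o\<^sub>L d n))))) U"
    by (intro tendsto_intros SU_trace bs_mult bs_star d)
  ultimately show ?thesis by (simp add: n2_def ip_def d_def)
qed

section \<open>Quantifier-free formulas in the ultrapower\<close>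

lemma term_los:
  assumes "\<And>x. x \<in> X \<Longrightarrow> a x \<in> bs \<and> v x = cl (a x)" and "term_vars t \<subseteq> X"
  shows "(\<lambda>n. term_eval S t (\<lambda>x. a x n)) \<in> bs \<and> term_eval SU t v = cl (\<lambda>n. term_eval S t (\<lambda>x. a x n))"
  using assms(2)
proof (induction t)
  case (TVar x)
  thus ?case using assms(1) by simp
qed (simp_all add: bs_const bs_add bs_mult bs_scale bs_star SU_const SU_add SU_mult SU_scale SU_star)

text \<open>The theorem of Los for quantifier-free formulas. The one quantifier of the argument is
  evaluated directly as a supremum over the ball of the ultrapower.\<close>

lemma formula_los:
  assumes a: "\<And>x. x \<in> X \<Longrightarrow> a x \<in> bs \<and> v x = cl (a x)"
    and "well_formed \<phi>" "quantifier_free \<phi>" "free_vars \<phi> \<subseteq> X"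
  shows "((\<lambda>n. formula_eval S \<phi> (\<lambda>x. a x n)) \<longlongrightarrow> formula_eval SU \<phi> v) U"
  using assms(2-)
proof (induction \<phi>)
  case (TraceRe t)
  hence "term_vars t \<subseteq> X" by simp
  from term_los[OF a this] show ?case using SU_trace by (auto intro: tendsto_Re)
next
  case (TraceIm t)
  hence "term_vars t \<subseteq> X" by simp
  from term_los[OF a this] show ?case using SU_trace by (auto intro: tendsto_Im)
next
  case (Distance s t)
  hence "term_vars s \<subseteq> X" "term_vars t \<subseteq> X" by simp_all
  with term_los[OF a this(1)] term_los[OF a this(2)] show ?case using SU_dist by simp
next
  case (Connective f \<phi>s)
  have m: "map h \<phi>s = map (\<lambda>i. h (\<phi>s ! i)) [0..<length \<phi>s]" for h :: "tvn_formula \<Rightarrow> real"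
    by (rule nth_equalityI) auto
  have "((\<lambda>n. f (map (\<lambda>i. formula_eval S (\<phi>s ! i) (\<lambda>x. a x n)) [0..<length \<phi>s])) \<longlongrightarrow> f (map (\<lambda>i. formula_eval SU (\<phi>s ! i) v) [0..<length \<phi>s])) U"
  proof (rule continuous_connective_tendsto)
    show "continuous_connective (length \<phi>s) f" using Connective by simp
    fix i assume "i < length \<phi>s"
    hence i: "\<phi>s ! i \<in> set \<phi>s" by simp
    thus "((\<lambda>n. formula_eval S (\<phi>s ! i) (\<lambda>x. a x n)) \<longlongrightarrow> formula_eval SU (\<phi>s ! i) v) U"
      using Connective.prems by (intro Connective.IH[OF i]) auto
  qed
  thus ?case by (simp add: m[of "\<lambda>\<phi>. formula_eval S \<phi> _"] m[of "\<lambda>\<phi>. formula_eval SU \<phi> _"])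
qed simp_all

text \<open>The norm of a class is an infimum over representatives and may not be attained, hence
  the strict slack between \<open>r\<close> and \<open>R\<close>.\<close>

lemma SU_ball_rep:
  assumes x: "x \<in> ts_ball SU r" and r: "r < R"
  shows "\<exists>a\<in>bs. x = cl a \<and> (\<forall>n. norm (a n) \<le> R)"
proof -
  have "x \<in> ts_carrier SU" and n: "(INF a\<in>x. SUP n. norm (a n)) \<le> r"
    using x by (auto simp: ts_ball_def) (simp add: tracial_ultrapower_def)
  then obtain a0 where a0: "a0 \<in> bs" "x = cl a0" by (auto elim: SU_carrierE)
  have "a0 \<in> x" using a0 rel_refl by (simp add: mem_cl)
  moreover have "(INF a\<in>x. SUP n. norm (a n)) < R" using n r by simp
  ultimately obtain a where a: "a \<in> x" "(SUP n. norm (a n)) < R"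
    using cInf_lessD[of "(\<lambda>a. SUP n. norm (a n)) ` x" R] by blast
  have rel: "(a0, a) \<in> ultra_rel U S" using a a0 by (simp add: mem_cl)
  hence abs: "a \<in> bs" by (simp add: rel_iff)
  hence "bdd_above (range (\<lambda>n. norm (a n)))" by (simp add: bounded_sequences_def)
  hence "norm (a n) \<le> (SUP n. norm (a n))" for n by (intro cSUP_upper) auto
  hence "norm (a n) \<le> R" for n using a(2) by (meson less_imp_le order_trans)
  thus ?thesis using abs cl_eqI[OF rel] a0 by blast
qed

lemma SU_ball_const: assumes T: "T \<in> N" "norm T \<le> 1" shows "cl (\<lambda>_. T) \<in> ts_ball SU 1"
proof -
  have "(INF a\<in>cl (\<lambda>_. T). SUP n. norm (a n)) \<le> (SUP n::nat. norm T)"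
  proof (rule cINF_lower)
    show "(\<lambda>_. T) \<in> cl (\<lambda>_. T)" using rel_refl[OF bs_const[OF T(1)]] by (simp add: mem_cl)
    show "bdd_below ((\<lambda>a. SUP n. norm (a n)) ` cl (\<lambda>_. T))"
    proof (rule bdd_belowI2[of _ 0])
      fix a assume "a \<in> cl (\<lambda>_. T)"
      hence "a \<in> bs" by (simp add: mem_cl rel_iff)
      hence "bdd_above (range (\<lambda>n. norm (a n)))" by (simp add: bounded_sequences_def)
      hence "norm (a 0) \<le> (SUP n. norm (a n))" by (intro cSUP_upper) auto
      thus "0 \<le> (SUP n. norm (a n))" using norm_ge_zero order_trans by blast
    qed
  qed
  moreover have "cl (\<lambda>_. T) \<in> ts_carrier SU"
    using bs_const[OF T(1)] by (simp add: tracial_ultrapower_def ultra_class_def quotientI)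
  ultimately show ?thesis using T(2) by (simp add: ts_ball_def) (simp add: tracial_ultrapower_def)
qed

text \<open>Compactness through the ultraproduct: a sequence of tuples witnessing unboundedness would define
  a point of the ultrapower at which the formula has no value.\<close>

lemma quantifier_free_bounded:
  assumes \<phi>: "well_formed \<phi>" "quantifier_free \<phi>" "free_vars \<phi> \<subseteq> X"
  shows "\<exists>C. \<forall>v\<in>X \<rightarrow> ts_ball SU 1. \<bar>formula_eval SU \<phi> v\<bar> \<le> C"
proof -
  \<comment> \<open>Radius 2 leaves room for representatives of elements of the unit ball.\<close>
  have "\<exists>C. \<forall>a. (\<forall>x\<in>X. a x \<in> N \<and> norm (a x) \<le> 2) \<longrightarrow> \<bar>formula_eval S \<phi> a\<bar> \<le> C"
  proof (rule ccontr)
    assume "\<not> ?thesis"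
    hence "\<forall>k::nat. \<exists>a. (\<forall>x\<in>X. a x \<in> N \<and> norm (a x) \<le> 2) \<and> real k < \<bar>formula_eval S \<phi> a\<bar>" by (meson not_le)
    then obtain a where a: "\<And>k x. x \<in> X \<Longrightarrow> a k x \<in> N \<and> norm (a k x) \<le> 2" "\<And>k. real k < \<bar>formula_eval S \<phi> (a k)\<bar>" by metis
    have "((\<lambda>n. formula_eval S \<phi> (\<lambda>x. a n x)) \<longlongrightarrow> formula_eval SU \<phi> (\<lambda>x. cl (\<lambda>k. a k x))) U"
      using a(1) by (intro formula_los[OF _ \<phi>]) (auto intro: bsI[of _ 2])
    from tendsto_rabs[OF this] obtain L where "((\<lambda>n. \<bar>formula_eval S \<phi> (a n)\<bar>) \<longlongrightarrow> L) U" by auto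
    hence "eventually (\<lambda>n. \<bar>formula_eval S \<phi> (a n)\<bar> < L + 1) U" by (rule order_tendstoD) simp
    moreover obtain m where "L + 1 \<le> real m" using real_arch_simple by blast
    hence "eventually (\<lambda>n. L + 1 \<le> real n) sequentially"
      by (intro eventually_sequentiallyI[of m]) (meson of_nat_le_iff order_trans)
    hence "eventually (\<lambda>n. L + 1 \<le> real n) U" using ultrafilter_le_sequentially[OF U] by (rule filter_leD[rotated])
    ultimately have "eventually (\<lambda>n. \<bar>formula_eval S \<phi> (a n)\<bar> < real n) U" by (rule eventually_elim2) simp
    hence "\<exists>n. \<bar>formula_eval S \<phi> (a n)\<bar> < real n" by (rule eventually_happens'[OF U_bot])
    thus False using a(2) by (meson less_asym)
  qed
  then obtain C where C: "\<And>a. (\<And>x. x \<in> X \<Longrightarrow> a x \<in> N \<and> norm (a x) \<le> 2) \<Longrightarrow> \<bar>formula_eval S \<phi> a\<bar> \<le> C" by blast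
  have "\<bar>formula_eval SU \<phi> v\<bar> \<le> C" if v: "v \<in> X \<rightarrow> ts_ball SU 1" for v
  proof -
    have "\<forall>x\<in>X. \<exists>a\<in>bs. v x = cl a \<and> (\<forall>n. norm (a n) \<le> 2)" using v SU_ball_rep[of _ 1 2] by fastforce
    then obtain a where a: "\<And>x. x \<in> X \<Longrightarrow> a x \<in> bs \<and> v x = cl (a x)" "\<And>x n. x \<in> X \<Longrightarrow> norm (a x n) \<le> 2" by metis
    have "((\<lambda>n. \<bar>formula_eval S \<phi> (\<lambda>x. a x n)\<bar>) \<longlongrightarrow> \<bar>formula_eval SU \<phi> v\<bar>) U"
      by (intro tendsto_rabs formula_los[OF a(1) \<phi>])
    moreover have "\<bar>formula_eval S \<phi> (\<lambda>x. a x n)\<bar> \<le> C" for n using a bs_N by (intro C) auto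
    ultimately show ?thesis by (intro tendsto_upperbound) auto
  qed
  thus ?thesis by blast
qed

text \<open>The seminorm is a real supremum, which says nothing about an unbounded set. The bounds
  on both formulas are what turns a small seminorm into pointwise closeness.\<close>

lemma quantifier_elimination_approximates:
  assumes qe: "admits_quantifier_elimination U S" and X: "finite X" and \<phi>: "\<phi> \<in> formulas X" and \<epsilon>: "\<epsilon> > 0"
    and bd: "\<And>v. v \<in> X \<rightarrow> ts_ball SU 1 \<Longrightarrow> \<bar>formula_eval SU \<phi> v\<bar> \<le> C"
  shows "\<exists>\<psi>\<in>qf_formulas X. \<forall>v\<in>X \<rightarrow> ts_ball SU 1. \<bar>formula_eval SU \<phi> v - formula_eval SU \<psi> v\<bar> < \<epsilon>"
proof -
  obtain \<psi> where \<psi>: "\<psi> \<in> qf_formulas X" "formula_seminorm U S X (formula_diff \<phi> \<psi>) < \<epsilon>"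
    using qe X \<phi> \<epsilon> unfolding admits_quantifier_elimination_def by blast
  obtain D where D: "\<And>v. v \<in> X \<rightarrow> ts_ball SU 1 \<Longrightarrow> \<bar>formula_eval SU \<psi> v\<bar> \<le> D"
    using quantifier_free_bounded[of \<psi> X] \<psi>(1) by (auto simp: qf_formulas_def formulas_def)
  have d: "formula_eval SU (formula_diff \<phi> \<psi>) v = formula_eval SU \<phi> v - formula_eval SU \<psi> v" for v
    by (simp add: formula_diff_def)
  have "\<bar>formula_eval SU \<phi> v - formula_eval SU \<psi> v\<bar> < \<epsilon>" if v: "v \<in> X \<rightarrow> ts_ball SU 1" for v
  proof -
    have "\<bar>formula_eval SU (formula_diff \<phi> \<psi>) v\<bar> \<le> formula_seminorm U S X (formula_diff \<phi> \<psi>)"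
      unfolding formula_seminorm_def
    proof (rule cSUP_upper[OF v], rule bdd_aboveI2)
      fix w assume "w \<in> X \<rightarrow> ts_ball SU 1"
      thus "\<bar>formula_eval SU (formula_diff \<phi> \<psi>) w\<bar> \<le> C + D" using bd[of w] D[of w] unfolding d by linarith
    qed
    thus ?thesis using \<psi>(2) by (simp add: d)
  qed
  thus ?thesis using \<psi>(1) by blast
qed

end

section \<open>The separating formula\<close>

text \<open>Variables 0 to 4 and 5 to 9 hold the two representations, variable 10 the candidate
  \<open>b\<close>. The value is positive exactly where \<open>b\<close> violates the inequality of
  \<open>intertwiner_gap\<close>; truncation to [0, 1] keeps the suprema finite.\<close>

definition test_matrix :: tvn_formula where
  "test_matrix = Connective (\<lambda>r. max 0 (min 1 (r ! 0 - 5 * (r ! 1 + r ! 2 + r ! 3 + r ! 4))))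
     (Distance (TMult (TMult (TVar 0) (TVar 10)) (TVar 5)) TZero #
      map (\<lambda>k. Distance (TMult (TMult (TVar k) (TVar 10)) (TVar 5)) (TMult (TMult (TVar 0) (TVar 10)) (TVar (k + 5)))) [1, 2, 3, 4])"

lemma test_matrix_wf: "well_formed test_matrix" "quantifier_free test_matrix" "free_vars test_matrix = {..<11}"
proof -
  show "well_formed test_matrix"
    by (simp add: test_matrix_def continuous_connective_def upt_rec numeral_nat) (intro continuous_intros continuous_on_product_coordinates)
  show "quantifier_free test_matrix" by (simp add: test_matrix_def)
  show "free_vars test_matrix = {..<11}" by (simp add: test_matrix_def) (auto simp: eval_nat_numeral less_Suc_eq)
qed

lemma test_formula_in: "FSup 10 1 test_matrix \<in> formulas {..<10}"
proof -
  have "{..<11} - {10} \<subseteq> {..<10::nat}"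
  proof
    fix x :: nat assume "x \<in> {..<11} - {10}"
    thus "x \<in> {..<10}" by simp
  qed
  thus ?thesis by (simp add: formulas_def test_matrix_wf)
qed

lemma test_matrix_range: "0 \<le> formula_eval M test_matrix v" "formula_eval M test_matrix v \<le> 1"
  by (simp_all add: test_matrix_def)

section \<open>Values of the test formula and convergence of quantifier-free formulas\<close>

context tracial_ultra
begin

lemma test_matrix_eval:
  "formula_eval S test_matrix a = max 0 (min 1 (n2 (a 0 o\<^sub>L a 10 o\<^sub>L a 5) -
     5 * (\<Sum>k=1..4. n2 ((a k o\<^sub>L a 10 o\<^sub>L a 5) - (a 0 o\<^sub>L a 10 o\<^sub>L a (k + 5))))))"
  by (simp add: test_matrix_def numeral_eq_Suc)

lemma test_formula_bounded: "\<bar>formula_eval SU (FSup 10 1 test_matrix) v\<bar> \<le> 1"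
proof -
  have ne: "ts_ball SU 1 \<noteq> {}" using SU_ball_const[of 0] by auto
  have "(SUP b\<in>ts_ball SU 1. formula_eval SU test_matrix (v(10 := b))) \<le> 1"
    using ne test_matrix_range by (intro cSUP_least) auto
  moreover have "0 \<le> (SUP b\<in>ts_ball SU 1. formula_eval SU test_matrix (v(10 := b)))"
    using ne test_matrix_range by (metis (mono_tags, lifting) bdd_aboveI2 cSUP_upper2 ex_in_conv)
  ultimately show ?thesis by simp
qed

lemma filterlim_fst_prod: "filterlim fst U (U \<times>\<^sub>F U)" and filterlim_snd_prod: "filterlim snd U (U \<times>\<^sub>F U)"
  by (rule filterlim_fst filterlim_snd)+

context
  fixes e v :: "'h op" and L :: "nat \<Rightarrow> nat \<Rightarrow> 'h op"
  assumes eN: "e \<in> N" and vN: "v \<in> N" and nv: "norm v \<le> 1"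
    and vv: "op_adjoint v o\<^sub>L v = e" and ve: "v o\<^sub>L e = v" and ev: "e o\<^sub>L v = 0"
    and Lc: "\<And>i k. L i k \<in> corner e" and nL: "\<And>i k. norm (L i k) \<le> 1"
begin

definition tup :: "nat \<Rightarrow> nat \<Rightarrow> nat \<Rightarrow> 'h op" where
  "tup i j x = (if x < 5 then L i x else v o\<^sub>L L j (x - 5) o\<^sub>L op_adjoint v)"

lemma tup_N: "tup i j x \<in> N" and norm_tup: "norm (tup i j x) \<le> 1"
proof -
  show "tup i j x \<in> N" using vN cornerD(1)[OF Lc] by (auto simp: tup_def)
  have "norm (v o\<^sub>L T o\<^sub>L op_adjoint v) \<le> 1" if "norm T \<le> 1" for T
  proof -
    have "norm (v o\<^sub>L T o\<^sub>L op_adjoint v) \<le> norm (v o\<^sub>L T) * norm (op_adjoint v)" by (rule norm_blinfun_compose)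
    also have "\<dots> \<le> (norm v * norm T) * norm v" using vN by (intro mult_mono norm_blinfun_compose) (auto simp: norm_op_adjoint)
    also have "\<dots> \<le> (1 * 1) * 1" using nv that by (intro mult_mono) auto
    finally show ?thesis by simp
  qed
  thus "norm (tup i j x) \<le> 1" using nL by (simp add: tup_def)
qed

lemma e_adj: "op_adjoint e = e" using vN vv by (auto simp: adj_simps simp flip: vv)

lemma e_projection: "e \<in> projections N"
  using e_adj eN ve vv by (simp add: projections_def) (metis blinfun_assoc)

lemma corner_v: assumes P: "P \<in> corner e" shows "P o\<^sub>L (v o\<^sub>L T) = 0" "op_adjoint v o\<^sub>L (P o\<^sub>L T) = 0"
  "op_adjoint v o\<^sub>L (v o\<^sub>L (P o\<^sub>L T)) = P o\<^sub>L T"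
proof -
  have "P o\<^sub>L v = P o\<^sub>L (e o\<^sub>L v)" using cornerD(3)[OF P] by (simp flip: blinfun_assoc)
  hence "P o\<^sub>L v = 0" using ev by simp
  thus "P o\<^sub>L (v o\<^sub>L T) = 0" by (simp flip: blinfun_assoc)
  have "op_adjoint v o\<^sub>L e = 0" using arg_cong[OF ev, of op_adjoint] eN vN e_adj by (simp add: adj_simps)
  moreover have "op_adjoint v o\<^sub>L P = (op_adjoint v o\<^sub>L e) o\<^sub>L P" using cornerD(2)[OF P] by (simp add: blinfun_assoc)
  ultimately show "op_adjoint v o\<^sub>L (P o\<^sub>L T) = 0" by (simp flip: blinfun_assoc)
  show "op_adjoint v o\<^sub>L (v o\<^sub>L (P o\<^sub>L T)) = P o\<^sub>L T"
    using vv cornerD(2)[OF P] by (simp flip: blinfun_assoc)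
qed

lemma corner_v_right: assumes P: "P \<in> corner e" shows "P o\<^sub>L v = 0" "op_adjoint v o\<^sub>L P = 0" "op_adjoint v o\<^sub>L (v o\<^sub>L P) = P"
  using corner_v[OF P, of id_blinfun] by simp_all

text \<open>The two halves of the tuple annihilate each other, so no term mixes \<open>i\<close> and \<open>j\<close>.\<close>

lemma term_split:
  assumes "term_vars t \<subseteq> {..<10}"
  shows "\<exists>\<gamma> P Q. P \<in> bs \<and> Q \<in> bs \<and> (\<forall>i. P i \<in> corner e \<and> Q i \<in> corner e) \<and>
    (\<forall>i j. term_eval S t (tup i j) = op_scale \<gamma> id_blinfun + P i + (v o\<^sub>L Q j o\<^sub>L op_adjoint v))"
  using assms
proof (induction t)
  have z: "(\<lambda>_. 0) \<in> bs" "(0 :: 'h op) \<in> corner e" "op_scale 0 id_blinfun = (0 :: 'h op)"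
    using bs_const[of 0] op_scale_of_real[of 0 id_blinfun] by (simp_all add: corner_def)
  have Lbs: "(\<lambda>i. L i k) \<in> bs" for k using cornerD(1)[OF Lc] nL by (intro bsI[of _ 1]) auto
  {
    case (TVar x)
    show ?case
    proof (cases "x < 5")
      case True
      thus ?thesis using z Lbs Lc
        by (intro exI[of _ 0] exI[of _ "\<lambda>i. L i x"] exI[of _ "\<lambda>_. 0"]) (simp add: tup_def)
    next
      case False
      show ?thesis
        by (rule exI[of _ 0], rule exI[of _ "\<lambda>_. 0"], rule exI[of _ "\<lambda>j. L j (x - 5)"]) (use False z Lbs Lc in \<open>simp add: tup_def\<close>)
    qed
  next
    case TZero
    show ?case using z by (intro exI[of _ 0] exI[of _ "\<lambda>_. 0"]) simp
  next
    case TOne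
    show ?case
      by (rule exI[of _ 1], rule exI[of _ "\<lambda>_. 0"], rule exI[of _ "\<lambda>_. 0"]) (use z in \<open>simp add: op_scale_compose\<close>)
  next
    case (TAdd s t)
    then obtain \<gamma> P Q \<gamma>' P' Q' where
      1: "P \<in> bs" "Q \<in> bs" "\<And>i. P i \<in> corner e" "\<And>i. Q i \<in> corner e"
        "\<And>i j. term_eval S s (tup i j) = op_scale \<gamma> id_blinfun + P i + (v o\<^sub>L Q j o\<^sub>L op_adjoint v)"
      and 2: "P' \<in> bs" "Q' \<in> bs" "\<And>i. P' i \<in> corner e" "\<And>i. Q' i \<in> corner e"
        "\<And>i j. term_eval S t (tup i j) = op_scale \<gamma>' id_blinfun + P' i + (v o\<^sub>L Q' j o\<^sub>L op_adjoint v)"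
      by auto
    show ?case
      by (rule exI[of _ "\<gamma> + \<gamma>'"], rule exI[of _ "\<lambda>i. P i + P' i"], rule exI[of _ "\<lambda>i. Q i + Q' i"])
        (use 1 2 in \<open>simp add: bs_add corner_closed op_scale_compose(6) blinfun_compose_simps\<close>)
  next
    case (TMult s t)
    then obtain \<gamma> P Q \<gamma>' P' Q' where
      1: "P \<in> bs" "Q \<in> bs" "\<And>i. P i \<in> corner e" "\<And>i. Q i \<in> corner e"
        "\<And>i j. term_eval S s (tup i j) = op_scale \<gamma> id_blinfun + P i + (v o\<^sub>L Q j o\<^sub>L op_adjoint v)"
      and 2: "P' \<in> bs" "Q' \<in> bs" "\<And>i. P' i \<in> corner e" "\<And>i. Q' i \<in> corner e"
        "\<And>i j. term_eval S t (tup i j) = op_scale \<gamma>' id_blinfun + P' i + (v o\<^sub>L Q' j o\<^sub>L op_adjoint v)"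
      by auto
    have b: "P i \<in> bounded_operators" "Q i \<in> bounded_operators" "v \<in> bounded_operators" for i using 1(1,2) bs_N vN by auto
    have eq: "(op_scale \<gamma> id_blinfun + P i + (v o\<^sub>L Q j o\<^sub>L op_adjoint v)) o\<^sub>L (op_scale \<gamma>' id_blinfun + P' i + (v o\<^sub>L Q' j o\<^sub>L op_adjoint v))
       = op_scale (\<gamma> * \<gamma>') id_blinfun + (op_scale \<gamma> (P' i) + op_scale \<gamma>' (P i) + (P i o\<^sub>L P' i)) +
         (v o\<^sub>L (op_scale \<gamma> (Q' j) + op_scale \<gamma>' (Q j) + (Q j o\<^sub>L Q' j)) o\<^sub>L op_adjoint v)" for i j
      using b vN by (simp add: blinfun_compose_simps blinfun_assoc op_scale_compose corner_v[OF 1(3)] corner_v[OF 2(3)] corner_v[OF 2(4)]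
          corner_v_right[OF 2(3)] corner_v_right[OF 2(4)] add_ac)
    show ?case
      by (rule exI[of _ "\<gamma> * \<gamma>'"], rule exI[of _ "\<lambda>i. op_scale \<gamma> (P' i) + op_scale \<gamma>' (P i) + (P i o\<^sub>L P' i)"],
          rule exI[of _ "\<lambda>i. op_scale \<gamma> (Q' i) + op_scale \<gamma>' (Q i) + (Q i o\<^sub>L Q' i)"])
        (use 1 2 eN eq in \<open>simp add: bs_add bs_mult bs_scale corner_closed\<close>)
  next
    case (TScale c t)
    then obtain \<gamma> P Q where
      1: "P \<in> bs" "Q \<in> bs" "\<And>i. P i \<in> corner e" "\<And>i. Q i \<in> corner e"
        "\<And>i j. term_eval S t (tup i j) = op_scale \<gamma> id_blinfun + P i + (v o\<^sub>L Q j o\<^sub>L op_adjoint v)"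
      by auto
    show ?case
      by (rule exI[of _ "c * \<gamma>"], rule exI[of _ "\<lambda>i. op_scale c (P i)"], rule exI[of _ "\<lambda>i. op_scale c (Q i)"])
        (use 1 eN vN in \<open>simp add: bs_scale corner_closed op_scale_compose\<close>)
  next
    case (TStar t)
    then obtain \<gamma> P Q where
      1: "P \<in> bs" "Q \<in> bs" "\<And>i. P i \<in> corner e" "\<And>i. Q i \<in> corner e"
        "\<And>i j. term_eval S t (tup i j) = op_scale \<gamma> id_blinfun + P i + (v o\<^sub>L Q j o\<^sub>L op_adjoint v)"
      by auto
    show ?case
      by (rule exI[of _ "cnj \<gamma>"], rule exI[of _ "\<lambda>i. op_adjoint (P i)"], rule exI[of _ "\<lambda>i. op_adjoint (Q i)"])
        (use 1 eN vN e_projection bs_N[OF 1(1)] bs_N[OF 1(2)] in \<open>simp add: bs_star corner_closed adj_simps blinfun_assoc\<close>)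
  }
qed

text \<open>Conjugation by \<open>v\<close> preserves the trace of \<open>Q j\<close>, so the trace
  is a constant plus a function of \<open>i\<close> plus a function of \<open>j\<close>. The limits
  in each variable are traces of elements of the ultrapower.\<close>

lemma trace_converges:
  assumes "term_vars t \<subseteq> {..<10}"
  shows "\<exists>l. ((\<lambda>z. \<tau> (term_eval S t (tup (fst z) (snd z)))) \<longlongrightarrow> l) (U \<times>\<^sub>F U)"
proof -
  obtain \<gamma> P Q where P: "P \<in> bs" "Q \<in> bs" "\<And>i. Q i \<in> corner e"
    and t: "\<And>i j. term_eval S t (tup i j) = op_scale \<gamma> id_blinfun + P i + (v o\<^sub>L Q j o\<^sub>L op_adjoint v)"
    using term_split[OF assms] by auto
  have "\<tau> (v o\<^sub>L Q j o\<^sub>L op_adjoint v) = \<tau> (Q j)" for j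
  proof -
    have "\<tau> ((v o\<^sub>L Q j) o\<^sub>L op_adjoint v) = \<tau> (op_adjoint v o\<^sub>L (v o\<^sub>L Q j))" using vN bs_N[OF P(2)] by (intro tr_comm) auto
    thus ?thesis by (simp add: corner_v_right[OF P(3)])
  qed
  hence e: "\<tau> (term_eval S t (tup i j)) = \<gamma> + \<tau> (P i) + \<tau> (Q j)" for i j
    using vN bs_N[OF P(1)] bs_N[OF P(2)] by (simp add: t tr_add tr_scale)
  have "((\<lambda>z. \<gamma> + \<tau> (P (fst z)) + \<tau> (Q (snd z))) \<longlongrightarrow> \<gamma> + ts_trace SU (cl P) + ts_trace SU (cl Q)) (U \<times>\<^sub>F U)"
    by (intro tendsto_intros filterlim_compose[OF SU_trace[OF P(1)] filterlim_fst_prod] filterlim_compose[OF SU_trace[OF P(2)] filterlim_snd_prod])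
  thus ?thesis unfolding e by blast
qed

lemma formula_converges:
  assumes "well_formed \<psi>" "quantifier_free \<psi>" "free_vars \<psi> \<subseteq> {..<10}"
  shows "\<exists>l. ((\<lambda>z. formula_eval S \<psi> (tup (fst z) (snd z))) \<longlongrightarrow> l) (U \<times>\<^sub>F U)"
  using assms
proof (induction \<psi>)
  case (TraceRe t)
  thus ?case using trace_converges[of t] by (auto intro: tendsto_Re)
next
  case (TraceIm t)
  thus ?case using trace_converges[of t] by (auto intro: tendsto_Im)
next
  case (Distance s t)
  \<comment> \<open>A distance is the square root of the trace of a term, so it needs no separate
    treatment.\<close>
  define d where "d = TAdd s (TScale (- 1) t)"
  have "term_vars (TMult (TStar d) d) \<subseteq> {..<10}" using Distance by (simp add: d_def)
  then obtain l where "((\<lambda>z. \<tau> (term_eval S (TMult (TStar d) d) (tup (fst z) (snd z)))) \<longlongrightarrow> l) (U \<times>\<^sub>F U)"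
    using trace_converges by blast
  hence "((\<lambda>z. sqrt (Re (\<tau> (term_eval S (TMult (TStar d) d) (tup (fst z) (snd z)))))) \<longlongrightarrow> sqrt (Re l)) (U \<times>\<^sub>F U)"
    by (intro tendsto_intros)
  thus ?case by (auto simp: d_def n2_def ip_def)
next
  case (Connective f \<phi>s)
  have m: "map h \<phi>s = map (\<lambda>i. h (\<phi>s ! i)) [0..<length \<phi>s]" for h :: "tvn_formula \<Rightarrow> real"
    by (rule nth_equalityI) auto
  have "\<exists>l. ((\<lambda>z. formula_eval S (\<phi>s ! i) (tup (fst z) (snd z))) \<longlongrightarrow> l) (U \<times>\<^sub>F U)" if "i < length \<phi>s" for i
  proof -
    have i: "\<phi>s ! i \<in> set \<phi>s" using that by simp
    thus ?thesis using Connective.prems by (intro Connective.IH[OF i]) auto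
  qed
  then obtain l where l: "\<And>i. i < length \<phi>s \<Longrightarrow> ((\<lambda>z. formula_eval S (\<phi>s ! i) (tup (fst z) (snd z))) \<longlongrightarrow> l i) (U \<times>\<^sub>F U)" by metis
  have "((\<lambda>z. f (map (\<lambda>i. formula_eval S (\<phi>s ! i) (tup (fst z) (snd z))) [0..<length \<phi>s])) \<longlongrightarrow> f (map l [0..<length \<phi>s])) (U \<times>\<^sub>F U)"
    using Connective.prems by (intro continuous_connective_tendsto l) auto
  thus ?case by (auto simp: m[of "\<lambda>\<phi>. formula_eval S \<phi> _"])
qed simp_all

text \<open>The diagonal embedding of a tuple of \<open>N\<close>. Here \<open>i\<close> and
  \<open>j\<close> stay fixed; the limit along \<open>U\<close> in \<open>i\<close> and
  \<open>j\<close> is taken outside the ultrapower.\<close>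

definition utup :: "nat \<Rightarrow> nat \<Rightarrow> nat \<Rightarrow> (nat \<Rightarrow> 'h op) set" where "utup i j x = cl (\<lambda>_. tup i j x)"

lemma utup_ball: "utup i j \<in> A \<rightarrow> ts_ball SU 1"
  using SU_ball_const[OF tup_N norm_tup] by (simp add: utup_def)

lemma quantifier_free_utup:
  assumes "\<psi> \<in> qf_formulas {..<10}"
  shows "formula_eval SU \<psi> (utup i j) = formula_eval S \<psi> (tup i j)"
proof -
  have "((\<lambda>n. formula_eval S \<psi> (tup i j)) \<longlongrightarrow> formula_eval SU \<psi> (utup i j)) U"
    using assms tup_N by (intro formula_los[where a = "\<lambda>x _. tup i j x" and X = "{..<10}"])
      (auto simp: utup_def bs_const qf_formulas_def formulas_def)
  thus ?thesis by (simp add: tendsto_const_iff)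
qed

lemma test_matrix_utup:
  assumes b: "\<beta> \<in> bs"
  shows "((\<lambda>n. formula_eval S test_matrix ((tup i j)(10 := \<beta> n))) \<longlongrightarrow> formula_eval SU test_matrix ((utup i j)(10 := cl \<beta>))) U"
proof -
  have "((\<lambda>n. formula_eval S test_matrix (\<lambda>x. if x = 10 then \<beta> n else tup i j x)) \<longlongrightarrow> formula_eval SU test_matrix ((utup i j)(10 := cl \<beta>))) U"
    using formula_los[where a = "\<lambda>x n. if x = 10 then \<beta> n else tup i j x" and X = "{..<11}" and \<phi> = test_matrix and v = "(utup i j)(10 := cl \<beta>)"]
      tup_N b test_matrix_wf by (auto simp: utup_def bs_const)
  thus ?thesis by (simp add: fun_upd_def)
qed

lemma test_formula_off_diagonal:
  assumes gap: "intertwiner_gap (L i) (\<lambda>k. v o\<^sub>L L j k o\<^sub>L op_adjoint v)"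
  shows "formula_eval SU (FSup 10 1 test_matrix) (utup i j) \<le> 0"
proof -
  have "formula_eval SU test_matrix ((utup i j)(10 := b)) \<le> 0" if b: "b \<in> ts_ball SU 1" for b
  proof -
    \<comment> \<open>Norm at most 2 suffices, because the gap inequality holds for every element of
      \<open>N\<close>.\<close>
    obtain \<beta> where \<beta>: "\<beta> \<in> bs" "b = cl \<beta>" using SU_ball_rep[OF b, of 2] by auto
    have "formula_eval S test_matrix ((tup i j)(10 := \<beta> n)) = 0" for n
      using gap[unfolded intertwiner_gap_def, rule_format, OF bs_N[OF \<beta>(1), of n]] by (simp add: test_matrix_eval tup_def numeral_eq_Suc)
    thus ?thesis using test_matrix_utup[OF \<beta>(1), of i j] \<beta>(2) by (simp add: tendsto_const_iff)
  qed
  moreover have "ts_ball SU 1 \<noteq> {}" using SU_ball_const[of 0] by auto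
  ultimately show ?thesis by (simp add: cSUP_least)
qed

lemma test_formula_diagonal:
  assumes LL: "\<And>k. L i k o\<^sub>L L i 0 = L i k" "\<And>k. L i 0 o\<^sub>L L i k = L i k" and c: "c \<le> n2 (L i 0)"
  shows "min 1 c \<le> formula_eval SU (FSup 10 1 test_matrix) (utup i i)"
proof -
  \<comment> \<open>An exact intertwiner: both defect terms reduce to \<open>L i k\<close> times the
    adjoint of \<open>v\<close>. It is large, since \<open>b o\<^sub>L v = L i 0\<close>.\<close>
  define b where "b = L i 0 o\<^sub>L op_adjoint v"
  have bN: "b \<in> N" using vN cornerD(1)[OF Lc] by (auto simp: b_def)
  have nb: "norm b \<le> 1"
    using order_trans[OF norm_blinfun_compose mult_mono[OF nL[of i 0] nv[folded norm_op_adjoint[OF bounded[OF vN]]]]] by (simp add: b_def)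
  have LLT: "L i k o\<^sub>L (L i 0 o\<^sub>L T) = L i k o\<^sub>L T" "L i 0 o\<^sub>L (L i k o\<^sub>L T) = L i k o\<^sub>L T" for k T
    using LL by (simp_all flip: blinfun_assoc)
  have "L i k o\<^sub>L b o\<^sub>L (v o\<^sub>L L i 0 o\<^sub>L op_adjoint v) = L i k o\<^sub>L op_adjoint v" for k
    by (simp add: b_def blinfun_assoc corner_v[OF Lc] LLT)
  moreover have "L i 0 o\<^sub>L b o\<^sub>L (v o\<^sub>L L i k o\<^sub>L op_adjoint v) = L i k o\<^sub>L op_adjoint v" for k
    by (simp add: b_def blinfun_assoc corner_v[OF Lc] LLT)
  ultimately have "formula_eval S test_matrix ((tup i i)(10 := b)) = max 0 (min 1 (n2 b))"
    by (simp add: test_matrix_eval tup_def numeral_eq_Suc b_def)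
  moreover have "n2 (L i 0) \<le> n2 b"
  proof -
    have "L i 0 = b o\<^sub>L v" using vv cornerD(3)[OF Lc] by (simp add: b_def blinfun_assoc)
    hence "n2 (L i 0) \<le> n2 b * norm v" using n2_mult_right[OF bN vN] by simp
    also have "\<dots> \<le> n2 b * 1" using nv bN by (intro mult_left_mono) auto
    finally show ?thesis by simp
  qed
  ultimately have "min 1 c \<le> formula_eval S test_matrix ((tup i i)(10 := b))" using c by simp
  also have "\<dots> = formula_eval SU test_matrix ((utup i i)(10 := cl (\<lambda>_. b)))"
    using test_matrix_utup[OF bs_const[OF bN], of i i] by (simp add: tendsto_const_iff)
  also have "\<dots> \<le> (SUP b\<in>ts_ball SU 1. formula_eval SU test_matrix ((utup i i)(10 := b)))"
    using test_matrix_range by (intro cSUP_upper SU_ball_const bN nb bdd_aboveI2)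
  finally show ?thesis by simp
qed

end

lemma no_quantifier_elimination:
  assumes II: "has_type_II1_summand N"
  shows "\<not> admits_quantifier_elimination U S"
proof
  assume qe: "admits_quantifier_elimination U S"
  obtain e v L c where fam: "separated_family e v L c" using separated_family_exists[OF II] by blast
  have c: "c > 0"
    and ev': "e \<in> N" "v \<in> N" "norm v \<le> 1" "op_adjoint v o\<^sub>L v = e" "v o\<^sub>L e = v" "e o\<^sub>L v = 0"
    and L: "\<forall>i k. L i k \<in> corner e \<and> norm (L i k) \<le> 1 \<and> L i k o\<^sub>L L i 0 = L i k \<and> L i 0 o\<^sub>L L i k = L i k"
      "\<forall>i. c \<le> n2 (L i 0)"
    and gap: "\<forall>i j. i \<noteq> j \<longrightarrow> intertwiner_gap (L i) (\<lambda>k. v o\<^sub>L L j k o\<^sub>L op_adjoint v)"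
    using fam unfolding separated_family_def by - (elim conjE, assumption)+
  note ev = ev' L(1)[rule_format, THEN conjunct1] L(1)[rule_format, THEN conjunct2, THEN conjunct1]
  note LL = L(1)[rule_format, THEN conjunct2, THEN conjunct2, THEN conjunct1] L(1)[rule_format, THEN conjunct2, THEN conjunct2, THEN conjunct2] L(2)[rule_format]
  define \<phi> where "\<phi> = FSup 10 1 test_matrix"
  \<comment> \<open>Four errors below \<epsilon> separate the two values: from the formula to
    \<open>\<psi>\<close> and from \<open>\<psi>\<close> to its limit, each at (i, i) and at (i,
    j).\<close>
  define \<epsilon> where "\<epsilon> = min 1 c / 4"
  have \<epsilon>: "\<epsilon> > 0" using c by (simp add: \<epsilon>_def)
  obtain \<psi> where \<psi>: "\<psi> \<in> qf_formulas {..<10}"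
    and close: "\<And>w. w \<in> {..<10} \<rightarrow> ts_ball SU 1 \<Longrightarrow> \<bar>formula_eval SU \<phi> w - formula_eval SU \<psi> w\<bar> < \<epsilon>"
    using quantifier_elimination_approximates[OF qe finite_lessThan test_formula_in \<epsilon> test_formula_bounded] unfolding \<phi>_def by blast
  let ?t = "tup v L" and ?u = "utup v L"
  obtain l where "((\<lambda>z. formula_eval S \<psi> (?t (fst z) (snd z))) \<longlongrightarrow> l) (U \<times>\<^sub>F U)"
    using formula_converges[where e = e and v = v and L = L, OF ev] \<psi> by (auto simp: qf_formulas_def formulas_def)
  hence "eventually (\<lambda>z. dist (formula_eval S \<psi> (?t (fst z) (snd z))) l < \<epsilon>) (U \<times>\<^sub>F U)" using \<epsilon> by (rule tendstoD)
  then obtain P Q where PQ: "eventually P U" "eventually Q U"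
    and near: "\<And>i j. P i \<Longrightarrow> Q j \<Longrightarrow> dist (formula_eval S \<psi> (?t i j)) l < \<epsilon>"
    unfolding eventually_prod_filter by auto
  \<comment> \<open>The rectangle of P and Q contains the diagonal point (i, i) for i in both sets,
    and with a larger j from both sets also the off-diagonal point (i, j).\<close>
  obtain i where i: "P i" "Q i" using eventually_happens'[OF U_bot eventually_conj[OF PQ]] by blast
  have "eventually (\<lambda>n. i < n) U"
    using eventually_gt_at_top[of i] ultrafilter_le_sequentially[OF U] by (rule filter_leD[rotated])
  then obtain j where j: "P j" "Q j" "i < j"
    using eventually_happens'[OF U_bot eventually_conj[OF eventually_conj[OF PQ]]] by blast
  have "formula_eval SU \<phi> (?u i j) \<le> 0"
    unfolding \<phi>_def using j(3) by (intro test_formula_off_diagonal[where e = e and v = v and L = L, OF ev] gap[rule_format]) simp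
  moreover have "4 * \<epsilon> \<le> formula_eval SU \<phi> (?u i i)"
    using test_formula_diagonal[where e = e and v = v and L = L, OF ev LL(1,2,3), of i] by (simp add: \<phi>_def \<epsilon>_def)
  moreover have "\<bar>formula_eval SU \<phi> (?u i k) - formula_eval S \<psi> (?t i k)\<bar> < \<epsilon>" for k
    using close[OF utup_ball[where e = e and v = v and L = L, OF ev]] quantifier_free_utup[where e = e and v = v and L = L, OF ev \<psi>] by metis
  from this[of i] this[of j] have "\<bar>formula_eval SU \<phi> (?u i i) - formula_eval S \<psi> (?t i i)\<bar> < \<epsilon>"
    "\<bar>formula_eval SU \<phi> (?u i j) - formula_eval S \<psi> (?t i j)\<bar> < \<epsilon>" .
  moreover have "dist (formula_eval S \<psi> (?t i i)) l < \<epsilon>" "dist (formula_eval S \<psi> (?t i j)) l < \<epsilon>"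
    using near i j by blast+
  ultimately show False unfolding dist_real_def by linarith
qed

end

theorem theorem1:
  fixes N :: "'h::complex_hilbert_space op set"
    and \<tau> :: "'h op \<Rightarrow> complex"
    and U :: "nat filter"
  assumes "tracial_von_neumann_algebra N \<tau>"
    and "has_type_II1_summand N"
    and "nonprincipal_ultrafilter U"
  shows "\<not> admits_quantifier_elimination U (vn_structure N \<tau>)"
proof -
  interpret tracial_ultra N \<tau> U
    using assms by unfold_locales (auto simp: tracial_von_neumann_algebra_def)
  show ?thesis using assms(2) by (rule no_quantifier_elimination)
qed

end
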